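(* Let $\mu$ be the measure on $(0,\infty)$ given by $$\mu=\sum_{m=0}^\infty H_m\delta_{A_m},\qquad H_m=1,\quad A_m=2^{-m^2}.$$ Let $S=(S_t)$ be a non-decreasing, right-continuous Lévy process on $[0,\infty)$ with $S_0=0$, with Lévy measure $\mu$ and drift $0$. Let $X=(X_t)=(W(S_t))$ be a subordinated Brownian motion on $\mathbb{R}^d$ with subordinator $S$. Then $X$ does not satisfy the small-scale elliptic Harnack inequality (SmallEHI).
   Context: $\delta_x$ is the Dirac measure at $x$. A subordinator $S$ with drift $\gamma$ and Lévy measure $\mu$ satisfies $\mathbb{E}e^{-\lambda S_t}=e^{-t\phi(\lambda)}$ with $\phi(\lambda)=\gamma\lambda+\int_{(0,\infty)}(1-e^{-\lambda x})\,\mu(dx)$. $W$ is a standard Brownian motion on $\mathbb{R}^d$ independent of $S$. $X$ is right-continuous with left limits; $\mathbb{E}_x$ is the expectation for the process started at $X_0=x$. $B(x_0,r)$ is the open Euclidean ball; $\tau_U:=\inf\{t\ge0:X_t\notin U\}$. For open $D\subseteq\mathbb{R}^d$, $h:\mathbb{R}^d\to\mathbb{R}$ is harmonic on $D$ (with respect to $X$) if for every open set $E$ whose closure is compact and contained in $D$, $h(x)=\mathbb{E}_x[h(X_{\tau_E})]$ for all $x\in E$. $X$ satisfies SmallEHI if there exist $C_1,C_2>0$ and $\kappa\in(0,1)$ such that for all $x_0\in\mathbb{R}^d$ and $r\in(0,C_1]$, every non-negative $h$ harmonic on $B(x_0,r)$ satisfies $h(x)\le C_2\,h(y)$ for all $x,y\in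 B(x_0,\kappa r)$. (The validity of SmallEHI does not depend on the specific $\kappa$.) *)

theory Defs
  imports "HOL-Probability.Probability"
begin

text \<open>Stochastic processes are indexed by \<^typ>\<open>real\<close>; only the times \<open>t \<ge> 0\<close> matter.\<close>

definition independent_increments :: "'w measure \<Rightarrow> (real \<Rightarrow> 'w \<Rightarrow> 'b::euclidean_space) \<Rightarrow> bool" where
  "independent_increments M Y \<longleftrightarrow>
     (\<forall>(n::nat) (t::nat \<Rightarrow> real). 0 \<le> t 0 \<and> strict_mono_on {..n} t \<longrightarrow>
        prob_space.indep_vars M (\<lambda>_. borel) (\<lambda>i \<omega>. Y (t (Suc i)) \<omega> - Y (t i) \<omega>) {..<n})"

definition stationary_increments :: "'w measure \<Rightarrow> (real \<Rightarrow> 'w \<Rightarrow> 'b::euclidean_space) \<Rightarrow> bool" where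
  "stationary_increments M Y \<longleftrightarrow>
     (\<forall>s t. 0 \<le> s \<and> s \<le> t \<longrightarrow>
        distr M borel (\<lambda>\<omega>. Y t \<omega> - Y s \<omega>) = distr M borel (\<lambda>\<omega>. Y (t - s) \<omega> - Y 0 \<omega>))"

definition cadlag :: "(real \<Rightarrow> 'b::topological_space) \<Rightarrow> bool" where
  "cadlag \<xi> \<longleftrightarrow> (\<forall>t\<ge>0. (\<xi> \<longlongrightarrow> \<xi> t) (at_right t)) \<and> (\<forall>t>0. \<exists>l. (\<xi> \<longlongrightarrow> l) (at_left t))"

definition levy_process :: "'w measure \<Rightarrow> (real \<Rightarrow> 'w \<Rightarrow> 'b::euclidean_space) \<Rightarrow> bool" where
  "levy_process M Y \<longleftrightarrow>
     prob_space M \<and>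
     (\<forall>t\<ge>0. Y t \<in> borel_measurable M) \<and>
     (\<forall>\<omega>\<in>space M. Y 0 \<omega> = 0 \<and> cadlag (\<lambda>t. Y t \<omega>)) \<and>
     independent_increments M Y \<and> stationary_increments M Y"

text \<open>L\'evy measures of subordinators are represented as Borel measures on the real line
  that do not charge \<open>(-\<infinity>, 0]\<close>.\<close>

definition subordinator_levy_measure :: "real measure \<Rightarrow> bool" where
  "subordinator_levy_measure \<mu> \<longleftrightarrow>
     sets \<mu> = sets borel \<and> emeasure \<mu> {..0} = 0 \<and>
     (\<integral>\<^sup>+x\<in>{0<..}. ennreal (min 1 x) \<partial>\<mu>) < \<infinity>"

definition laplace_exponent :: "real \<Rightarrow> real measure \<Rightarrow> real \<Rightarrow> real" where
  "laplace_exponent \<gamma> \<mu> l = \<gamma> * l + (LINT x:{0<..}|\<mu>. 1 - exp (- l * x))"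

definition subordinator ::
  "'w measure \<Rightarrow> real \<Rightarrow> real measure \<Rightarrow> (real \<Rightarrow> 'w \<Rightarrow> real) \<Rightarrow> bool" where
  "subordinator M \<gamma> \<mu> S \<longleftrightarrow>
     levy_process M S \<and>
     (\<forall>\<omega>\<in>space M. mono_on {0..} (\<lambda>t. S t \<omega>)) \<and>
     0 \<le> \<gamma> \<and> subordinator_levy_measure \<mu> \<and>
     (\<forall>t\<ge>0. \<forall>l\<ge>0. (LINT \<omega>|M. exp (- l * S t \<omega>)) = exp (- t * laplace_exponent \<gamma> \<mu> l))"

definition standard_brownian_motion ::
  "'w measure \<Rightarrow> (real \<Rightarrow> 'w \<Rightarrow> real ^ 'd) \<Rightarrow> bool" where
  "standard_brownian_motion M W \<longleftrightarrow>
     prob_space M \<and>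
     (\<forall>t\<ge>0. W t \<in> borel_measurable M) \<and>
     (\<forall>\<omega>\<in>space M. W 0 \<omega> = 0 \<and> continuous_on {0..} (\<lambda>t. W t \<omega>)) \<and>
     independent_increments M W \<and>
     (\<forall>s t. 0 \<le> s \<and> s < t \<longrightarrow>
        distributed M lborel (\<lambda>\<omega>. W t \<omega> - W s \<omega>)
          (\<lambda>x. ennreal (\<Prod>i\<in>UNIV. normal_density 0 (sqrt (t - s)) (x $ i))))"

definition independent_processes ::
  "'w measure \<Rightarrow> (real \<Rightarrow> 'w \<Rightarrow> 'b::topological_space) \<Rightarrow> (real \<Rightarrow> 'w \<Rightarrow> 'c::topological_space) \<Rightarrow> bool"
  where
  "independent_processes M Y Z \<longleftrightarrow>
     prob_space.indep_set M
       (sets (vimage_algebra (space M) (\<lambda>\<omega>. \<lambda>t\<in>{0..}. Y t \<omega>) (Pi\<^sub>M {0..} (\<lambda>_. borel))))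
       (sets (vimage_algebra (space M) (\<lambda>\<omega>. \<lambda>t\<in>{0..}. Z t \<omega>) (Pi\<^sub>M {0..} (\<lambda>_. borel))))"

definition exit_time :: "'b set \<Rightarrow> (real \<Rightarrow> 'b) \<Rightarrow> ereal" where
  "exit_time U \<xi> = (INF t\<in>{t. 0 \<le> t \<and> \<xi> t \<notin> U}. ereal t)"

text \<open>The value of \<open>h\<close> at the exit position, with the usual convention that it is \<open>0\<close> on
  paths that never leave \<open>U\<close>.\<close>

definition exit_value :: "('b \<Rightarrow> real) \<Rightarrow> 'b set \<Rightarrow> (real \<Rightarrow> 'b) \<Rightarrow> real" where
  "exit_value h U \<xi> =
     (if exit_time U \<xi> < \<infinity> then h (\<xi> (real_of_ereal (exit_time U \<xi>))) else 0)"

text \<open>Here \<open>X\<close> is the process started at the origin. It has stationary independent increments,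
  so the process started at \<open>x\<close> is \<open>x + X\<close>, and an expectation under the law of the latter
  is an integral over \<open>\<omega>\<close> of a functional of \<open>x + X\<close>. Exit times are in general only
  measurable for the completed \<open>\<sigma>\<close>-algebra, hence the completion of \<open>M\<close>.
  Integrability is demanded because the Bochner integral of a non-integrable function is \<open>0\<close>.\<close>

definition harmonic_on ::
  "'w measure \<Rightarrow> (real \<Rightarrow> 'w \<Rightarrow> 'b::euclidean_space) \<Rightarrow> 'b set \<Rightarrow> ('b \<Rightarrow> real) \<Rightarrow> bool" where
  "harmonic_on M X D h \<longleftrightarrow>
     h \<in> borel_measurable borel \<and>
     (\<forall>E. open E \<and> compact (closure E) \<and> closure E \<subseteq> D \<longrightarrow>
        (\<forall>x\<in>E. integrable (completion M) (\<lambda>\<omega>. exit_value h E (\<lambda>t. x + X t \<omega>)) \<and>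
               h x = (LINT \<omega>|completion M. exit_value h E (\<lambda>t. x + X t \<omega>))))"

definition small_EHI :: "'w measure \<Rightarrow> (real \<Rightarrow> 'w \<Rightarrow> 'b::euclidean_space) \<Rightarrow> bool" where
  "small_EHI M X \<longleftrightarrow>
     (\<exists>C1>0. \<exists>C2>0. \<exists>\<kappa>. 0 < \<kappa> \<and> \<kappa> < 1 \<and>
        (\<forall>x0 r. 0 < r \<and> r \<le> C1 \<longrightarrow>
           (\<forall>h. (\<forall>z. 0 \<le> h z) \<and> harmonic_on M X (ball x0 r) h \<longrightarrow>
              (\<forall>x\<in>ball x0 (\<kappa> * r). \<forall>y\<in>ball x0 (\<kappa> * r). h x \<le> C2 * h y))))"

definition jump_rate :: "nat \<Rightarrow> real" where
  "jump_rate m = 1"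

definition jump_size :: "nat \<Rightarrow> real" where
  "jump_size m = 2 powr - ((real m)\<^sup>2)"

definition jump_measure :: "real measure" where
  "jump_measure = measure_of UNIV (sets borel)
     (\<lambda>B. \<Sum>m. ennreal (jump_rate m) * emeasure (return borel (jump_size m)) B)"

text \<open>\<^const>\<open>measure_of\<close> yields a meaningful measure only for a countably additive set
  function; the following facts show that this is the case here.\<close>

lemma jump_measure_altdef:
  "jump_measure = distr (density (count_space UNIV) (\<lambda>m. ennreal (jump_rate m))) borel jump_size"
    (is "_ = ?N")
proof -
  have eq: "(\<Sum>m. ennreal (jump_rate m) * emeasure (return borel (jump_size m)) B) = emeasure ?N B"
    if "B \<in> sets borel" for B
    using that
    by (auto simp: emeasure_distr emeasure_density nn_integral_count_space_nat indicator_def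
        intro!: suminf_cong)
  have "jump_measure = measure_of UNIV (sets borel) (emeasure ?N)"
    unfolding jump_measure_def using sets.sigma_sets_eq[of "borel :: real measure"]
    by (intro measure_of_eq) (simp_all only: eq space_borel sets.space_closed Pow_UNIV subset_UNIV)
  also have "\<dots> = ?N"
    using measure_of_of_measure[of ?N] by simp
  finally show ?thesis .
qed

lemma sets_jump_measure [simp, measurable_cong]: "sets jump_measure = sets borel"
  and space_jump_measure [simp]: "space jump_measure = UNIV"
  by (simp_all add: jump_measure_altdef)

lemma nn_integral_jump_measure:
  "f \<in> borel_measurable borel \<Longrightarrow>
    (\<integral>\<^sup>+x. f x \<partial>jump_measure) = (\<Sum>m. ennreal (jump_rate m) * f (jump_size m))"
  by (simp add: jump_measure_altdef nn_integral_distr nn_integral_density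
      nn_integral_count_space_nat)

lemma emeasure_jump_measure:
  "B \<in> sets borel \<Longrightarrow> emeasure jump_measure B =
    (\<Sum>m. ennreal (jump_rate m) * emeasure (return borel (jump_size m)) B)"
  using nn_integral_jump_measure[of "indicator B"] by simp

lemma jump_size_le: "jump_size m \<le> 2 * (1/2) ^ m"
proof -
  have "0 \<le> (real m - 1)\<^sup>2" by simp
  then have "- ((real m)\<^sup>2) \<le> 1 - real m"
    using of_nat_0_le_iff[of m, where 'a = real] by (simp add: power2_diff)
  then have "jump_size m \<le> 2 powr (1 - real m)"
    unfolding jump_size_def by (rule powr_mono) simp
  also have "\<dots> = 2 * (1/2) ^ m"
    by (simp add: powr_diff powr_realpow power_one_over)
  finally show ?thesis .
qed

lemma subordinator_levy_measure_jump_measure: "subordinator_levy_measure jump_measure"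
proof -
  have pos: "0 < jump_size m" for m by (simp add: jump_size_def)
  have 0: "emeasure jump_measure {..0} = 0"
    using pos by (simp add: emeasure_jump_measure not_le)
  have "(\<integral>\<^sup>+x\<in>{0<..}. ennreal (min 1 x) \<partial>jump_measure) =
      (\<Sum>m. ennreal (min 1 (jump_size m)))"
    using pos by (subst nn_integral_jump_measure) (auto simp: jump_rate_def)
  also have "\<dots> \<le> (\<Sum>m. ennreal (2 * (1/2) ^ m))"
    using jump_size_le by (intro suminf_le ennreal_leI) (auto simp: min.coboundedI2)
  also have "\<dots> < \<infinity>"
    by (subst suminf_ennreal2) (auto intro!: summable_mult summable_geometric)
  finally show ?thesis using 0 by (simp add: subordinator_levy_measure_def)
qed

end

theory Submission
  imports Defs "HOL-Real_Asymp.Real_Asymp"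
begin

text \<open>Look at the scale \<open>r = sqrt A\<^sub>m\<^sub>+\<^sub>1\<close>. There the jumps of variance \<open>A\<^sub>0, \<dots>, A\<^sub>m\<close> are
  enormous, those after \<open>A\<^sub>m\<^sub>+\<^sub>1\<close> are negligible, and all jumps up to \<open>A\<^sub>m\<^sub>+\<^sub>1\<close> have rate \<open>1\<close>.
  Starting in \<open>B(0, r)\<close>, the first relevant jump is almost always one of the enormous ones; with
  probability about \<open>1 / m\<close> it is the jump \<open>A\<^sub>m\<^sub>+\<^sub>1\<close>, and two of these occur only with probability
  about \<open>1 / m\<^sup>2\<close>. So the probability of hitting a target at distance \<open>K r\<close> is to leading order a
  Gaussian density over \<open>m\<close>, and its values at \<open>\<plusminus> \<kappa> r / 2\<close> have ratio about \<open>exp (\<kappa> K)\<close>, which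
  is unbounded in \<open>K\<close>.

  To obtain a function that is provably harmonic without the strong Markov property, exit from the
  ball is replaced by sampling at rate \<open>l\<close> outside of it: \<open>H\<close> solves \<open>H = T (\<psi> H + g)\<close> with
  \<open>T\<close> the resolvent of one coordinate of \<open>X\<close>, \<open>\<psi> = 1\<close> on the ball and \<open>g\<close> supported at the
  target. Then \<open>E h(z + X\<^sub>t) - h z = o(t)\<close> uniformly on compact subsets of the ball, so optional
  stopping along dyadic grids and quasi-left-continuity give harmonicity. \<open>H\<close> is compared with
  explicit sums of Gaussians, on which the generator is computed by Fourier transform.\<close>

text \<open>Gaussians suit the barriers because they are closed under the jumps: a jump of variance
  \<open>a j\<close> turns variance \<open>b\<close> into \<open>b + a j\<close>. The generator on
  them is thus explicit up to errors controlled by \<open>q\<close>, and the barrier inequalities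
  become arithmetic. The orders of magnitude fix the constants. Seen through one jump of variance 1,
  a target of variance \<open>b = 1 / \<Lambda>\<close> has height \<open>p\<close>, about \<Lambda>
  to the power -1/2. Divided by the total rate this gives order -3/2, whereas two such jumps and the
  remaining errors are of order -2. With variance of order -2 for the target this gap would vanish;
  with a fixed variance the target would not be exponentially small on the ball. Outside of the ball
  the sign of the generator of a barrier is not controlled. There the sampling rate \<open>l\<close>
  helps: it is so large compared with \<Lambda> that a constant \<open>\<epsilon>\<close> in the
  barriers, multiplied by \<open>l\<close>, outweighs the generator. One coordinate of
  \<open>X\<close> is enough in any dimension: it is a Levy process with exponent
  \<open>laplace_exponent\<close> at \<theta> squared over 2, and a ball lies in the slab of the
  same half-width.\<close>

section \<open>Independence of the past and increments\<close>

lemma (in prob_space) prob_past_increment: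
  fixes Y :: "real \<Rightarrow> 'a \<Rightarrow> 'b::euclidean_space"
  assumes inc: "independent_increments M Y"
    and J: "finite J" "J \<subseteq> {0..u}" and u: "0 \<le> u" "u \<le> u'"
    and A: "A \<in> sets (PiM J (\<lambda>_. borel))" and B: "B \<in> sets borel"
  shows "prob {\<omega>\<in>space M. (\<lambda>j\<in>J. Y j \<omega> - Y 0 \<omega>) \<in> A \<and> Y u' \<omega> - Y u \<omega> \<in> B} =
    prob {\<omega>\<in>space M. (\<lambda>j\<in>J. Y j \<omega> - Y 0 \<omega>) \<in> A} * prob {\<omega>\<in>space M. Y u' \<omega> - Y u \<omega> \<in> B}"
proof -
  \<comment> \<open>The definition of independent increments only speaks of strictly increasing
    times, so the case \<open>u = u'\<close> is treated apart.\<close>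
  have main: "prob {\<omega>\<in>space M. (\<lambda>j\<in>J. Y j \<omega> - Y 0 \<omega>) \<in> A \<and> Y v \<omega> - Y u \<omega> \<in> B} =
    prob {\<omega>\<in>space M. (\<lambda>j\<in>J. Y j \<omega> - Y 0 \<omega>) \<in> A} * prob {\<omega>\<in>space M. Y v \<omega> - Y u \<omega> \<in> B}"
    if v: "u < v" and B: "B \<in> sets borel" for v B
  proof -
    define K where "K = insert 0 (insert u J)"
    define xs where "xs = sorted_list_of_set K"
    define n where "n = length xs - 1"
    \<comment> \<open>The grid lists \<open>J\<close> together with 0 and \<open>u\<close> and is
      prolonged so that \<open>t (Suc n) = v\<close>. The increments with index below
      \<open>n\<close> then carry the past, and the one with index \<open>n\<close> leads from
      \<open>u\<close> to \<open>v\<close>.\<close>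
    define t where "t i = (if i \<le> n then xs ! i else v + (real i - real n - 1))" for i
    have K: "finite K" "K \<subseteq> {0..u}" "0 \<in> K" "u \<in> K"
      using J u by (auto simp: K_def)
    have xs: "set xs = K" "sorted_wrt (<) xs" "length xs = Suc n"
      using K by (auto simp: xs_def n_def intro!: Suc_pred[symmetric] simp: card_gt_0_iff)
    have lt: "xs ! i < xs ! j" if "i < j" "j \<le> n" for i j
      using xs that by (simp add: sorted_wrt_iff_nth_less)
    have "\<exists>i\<le>n. xs ! i = j" if "j \<in> K" for j
      using that xs by (metis in_set_conv_nth less_Suc_eq_le)
    \<comment> \<open>\<open>l j\<close> is the position of \<open>j\<close> in the grid, so
      \<open>Y j - Y 0\<close> is the sum of the first \<open>l j\<close> increments.\<close>
    then obtain l where l: "\<And>j. j \<in> K \<Longrightarrow> l j \<le> n \<and> xs ! l j = j"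
      by metis
    have in_K: "xs ! i \<in> K" if "i \<le> n" for i
      using xs that by (metis less_Suc_eq_le nth_mem)
    have t0: "t 0 = 0"
    proof (rule ccontr)
      assume "t 0 \<noteq> 0"
      then have "l 0 \<noteq> 0" using l[OF K(3)] by (auto simp: t_def intro!: gr0I)
      then have "xs ! 0 < 0" using lt[of 0 "l 0"] l[OF K(3)] by simp
      then show False using in_K[of 0] K by auto
    qed
    have tn: "t n = u"
    proof (rule ccontr)
      assume *: "t n \<noteq> u"
      then have "l u \<noteq> n" using l[OF K(4)] by (auto simp: t_def)
      then have "u < xs ! n" using lt[of "l u" n] l[OF K(4)] by simp
      then show False using in_K[of n] K by auto
    qed
    have tSn: "t (Suc n) = v" by (simp add: t_def)
    have mono: "strict_mono_on {..Suc n} t"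
    proof (rule strict_mono_onI)
      fix r s assume "r \<in> {..Suc n}" "s \<in> {..Suc n}" "r < s"
      moreover have "xs ! r < v" if "r \<le> n" for r
        using in_K[OF that] K v by force
      ultimately show "t r < t s" using lt[of r s] by (auto simp: t_def le_Suc_eq)
    qed
    have "indep_vars (\<lambda>_. borel) (\<lambda>i \<omega>. Y (t (Suc i)) \<omega> - Y (t i) \<omega>) {..<Suc n}"
      using inc mono t0 by (simp add: independent_increments_def)
    from indep_var_restrict[OF this, of "{..<n}" "{n}"]
    have "indep_var (Pi\<^sub>M {..<n} (\<lambda>_. borel)) (\<lambda>\<omega>. \<lambda>i\<in>{..<n}. Y (t (Suc i)) \<omega> - Y (t i) \<omega>)
        (Pi\<^sub>M {n} (\<lambda>_. borel)) (\<lambda>\<omega>. \<lambda>i\<in>{n}. Y (t (Suc i)) \<omega> - Y (t i) \<omega>)"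
      by auto
    moreover have "(\<lambda>f. \<lambda>j\<in>J. \<Sum>i<l j. f i) -` A \<inter> space (Pi\<^sub>M {..<n} (\<lambda>_. borel)) \<in> sets (Pi\<^sub>M {..<n} (\<lambda>_. borel))"
    proof (rule measurable_sets[OF _ A], rule measurable_restrict, rule borel_measurable_sum, rule measurable_component_singleton)
      fix j i assume "j \<in> J" "i \<in> {..<l j}"
      then show "i \<in> {..<n}" using l[of j] by (auto simp: K_def)
    qed
    moreover have "(\<lambda>f. f n) -` B \<inter> space (Pi\<^sub>M {n} (\<lambda>_. borel)) \<in> sets (Pi\<^sub>M {n} (\<lambda>_. borel))"
      by (rule measurable_sets[OF _ B], rule measurable_component_singleton) auto
    ultimately have "prob ((\<lambda>\<omega>. (\<lambda>i\<in>{..<n}. Y (t (Suc i)) \<omega> - Y (t i) \<omega>, \<lambda>i\<in>{n}. Y (t (Suc i)) \<omega> - Y (t i) \<omega>)) -`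
          (((\<lambda>f. \<lambda>j\<in>J. \<Sum>i<l j. f i) -` A \<inter> space (Pi\<^sub>M {..<n} (\<lambda>_. borel))) \<times>
           ((\<lambda>f. f n) -` B \<inter> space (Pi\<^sub>M {n} (\<lambda>_. borel)))) \<inter> space M) =
        prob ((\<lambda>\<omega>. \<lambda>i\<in>{..<n}. Y (t (Suc i)) \<omega> - Y (t i) \<omega>) -`
          ((\<lambda>f. \<lambda>j\<in>J. \<Sum>i<l j. f i) -` A \<inter> space (Pi\<^sub>M {..<n} (\<lambda>_. borel))) \<inter> space M) *
        prob ((\<lambda>\<omega>. \<lambda>i\<in>{n}. Y (t (Suc i)) \<omega> - Y (t i) \<omega>) -`
           ((\<lambda>f. f n) -` B \<inter> space (Pi\<^sub>M {n} (\<lambda>_. borel))) \<inter> space M)"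
      by (rule indep_varD)
    moreover have "(\<Sum>i<l j. if i < n then Y (t (Suc i)) \<omega> - Y (t i) \<omega> else undefined) = Y j \<omega> - Y 0 \<omega>" if "j \<in> J" for j \<omega>
    proof -
      have lj: "l j \<le> n" "xs ! l j = j" using l[of j] that by (auto simp: K_def)
      have "(\<Sum>i<l j. if i < n then Y (t (Suc i)) \<omega> - Y (t i) \<omega> else undefined) =
          (\<Sum>i<l j. Y (t (Suc i)) \<omega> - Y (t i) \<omega>)"
        using lj by (intro sum.cong) auto
      also have "\<dots> = Y (t (l j)) \<omega> - Y (t 0) \<omega>"
        by (rule sum_lessThan_telescope)
      finally show ?thesis using lj t0 by (simp add: t_def)
    qed
    ultimately show ?thesis
      by (simp add: vimage_def Int_def space_PiM PiE_def tn tSn restrict_def Pi_def extensional_def conj_commute cong: if_cong)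
  qed
  show ?thesis
  proof (cases "u = u'")
    case True
    \<comment> \<open>The increment over an empty interval is 0, so the condition on it is either
      sure or impossible. \<open>UNIV\<close> and the empty set, at any later time, imitate these
      two cases.\<close>
    with main[of "u + 1" "if 0 \<in> B then UNIV else {}"] show ?thesis
      by (cases "0 \<in> B") (auto simp: prob_space)
  next
    case False
    then show ?thesis using main u B by simp
  qed
qed

lemma (in prob_space) distr_pair_indep:
  assumes X [measurable]: "X \<in> M \<rightarrow>\<^sub>M N1" and Y [measurable]: "Y \<in> M \<rightarrow>\<^sub>M N2"
    and eq: "\<And>A B. A \<in> sets N1 \<Longrightarrow> B \<in> sets N2 \<Longrightarrow>
      prob {\<omega>\<in>space M. X \<omega> \<in> A \<and> Y \<omega> \<in> B} = prob {\<omega>\<in>space M. X \<omega> \<in> A} * prob {\<omega>\<in>space M. Y \<omega> \<in> B}"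
  shows "distr M (N1 \<Otimes>\<^sub>M N2) (\<lambda>\<omega>. (X \<omega>, Y \<omega>)) = distr M N1 X \<Otimes>\<^sub>M distr M N2 Y"
proof (rule pair_measure_eqI[symmetric])
  interpret X: prob_space "distr M N1 X" by (rule prob_space_distr) simp
  interpret Y: prob_space "distr M N2 Y" by (rule prob_space_distr) simp
  show "sigma_finite_measure (distr M N1 X)" "sigma_finite_measure (distr M N2 Y)"
    by unfold_locales
  show "sets (distr M N1 X \<Otimes>\<^sub>M distr M N2 Y) = sets (distr M (N1 \<Otimes>\<^sub>M N2) (\<lambda>\<omega>. (X \<omega>, Y \<omega>)))"
    by (simp cong: sets_pair_measure_cong)
  fix A B assume A: "A \<in> sets (distr M N1 X)" and B: "B \<in> sets (distr M N2 Y)"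
  then have [measurable]: "A \<in> sets N1" "B \<in> sets N2" by auto
  show "emeasure (distr M N1 X) A * emeasure (distr M N2 Y) B =
      emeasure (distr M (N1 \<Otimes>\<^sub>M N2) (\<lambda>\<omega>. (X \<omega>, Y \<omega>))) (A \<times> B)"
    using eq[of A B] by (simp add: emeasure_distr emeasure_eq_measure ennreal_mult[symmetric] vimage_def Int_def conj_commute)
qed

text \<open>Independence is assumed as a product rule on rectangles because this is the form in
  which increments and independent processes supply it. The two conclusions freeze one component or
  the other.\<close>

lemma (in prob_space) integral_indep_pair:
  fixes f :: "'x \<Rightarrow> 'y \<Rightarrow> real"
  assumes X [measurable]: "X \<in> M \<rightarrow>\<^sub>M N1" and Y [measurable]: "Y \<in> M \<rightarrow>\<^sub>M N2"
    and eq: "\<And>A B. A \<in> sets N1 \<Longrightarrow> B \<in> sets N2 \<Longrightarrow>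
      prob {\<omega>\<in>space M. X \<omega> \<in> A \<and> Y \<omega> \<in> B} = prob {\<omega>\<in>space M. X \<omega> \<in> A} * prob {\<omega>\<in>space M. Y \<omega> \<in> B}"
    and f [measurable]: "case_prod f \<in> borel_measurable (N1 \<Otimes>\<^sub>M N2)"
    and bound: "\<And>x y. \<bar>f x y\<bar> \<le> C"
  shows "(LINT \<omega>|M. f (X \<omega>) (Y \<omega>)) = (LINT \<omega>'|M. LINT \<omega>|M. f (X \<omega>) (Y \<omega>'))"
    and "(LINT \<omega>|M. f (X \<omega>) (Y \<omega>)) = (LINT \<omega>|M. LINT \<omega>'|M. f (X \<omega>) (Y \<omega>'))"
proof -
  interpret X: prob_space "distr M N1 X" by (rule prob_space_distr) simp
  interpret Y: prob_space "distr M N2 Y" by (rule prob_space_distr) simp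
  interpret P: pair_prob_space "distr M N1 X" "distr M N2 Y" ..
  have m [measurable_cong]: "sets (distr M N1 X \<Otimes>\<^sub>M distr M N2 Y) = sets (N1 \<Otimes>\<^sub>M N2)"
    by (simp cong: sets_pair_measure_cong)
  have int: "integrable (distr M N1 X \<Otimes>\<^sub>M distr M N2 Y) (case_prod f)"
    by (rule P.P.integrable_const_bound[of _ C]) (use bound in auto)
  have "(LINT \<omega>|M. f (X \<omega>) (Y \<omega>)) = (LINT p|distr M (N1 \<Otimes>\<^sub>M N2) (\<lambda>\<omega>. (X \<omega>, Y \<omega>)). case_prod f p)"
    by (subst integral_distr) auto
  also have "\<dots> = (LINT p|(distr M N1 X \<Otimes>\<^sub>M distr M N2 Y). case_prod f p)"
    by (subst distr_pair_indep[OF X Y eq]) auto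
  finally have *: "(LINT \<omega>|M. f (X \<omega>) (Y \<omega>)) = (LINT p|(distr M N1 X \<Otimes>\<^sub>M distr M N2 Y). case_prod f p)" .
  have "\<dots> = (LINT y|distr M N2 Y. LINT x|distr M N1 X. f x y)"
    using P.integral_snd[OF int] by simp
  also have "\<dots> = (LINT \<omega>'|M. LINT \<omega>|M. f (X \<omega>) (Y \<omega>'))"
  proof (subst integral_distr[OF Y])
    show "(\<lambda>y. LINT x|distr M N1 X. f x y) \<in> borel_measurable N2"
      by measurable
    show "(LINT \<omega>'|M. LINT x|distr M N1 X. f x (Y \<omega>')) = (LINT \<omega>'|M. LINT \<omega>|M. f (X \<omega>) (Y \<omega>'))"
    proof (rule Bochner_Integration.integral_cong[OF refl], rule integral_distr[OF X])
      fix \<omega>' assume "\<omega>' \<in> space M"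
      then have [measurable]: "Y \<omega>' \<in> space N2" using measurable_space[OF Y] by auto
      show "(\<lambda>x. f x (Y \<omega>')) \<in> borel_measurable N1" by measurable
    qed
  qed
  finally show "(LINT \<omega>|M. f (X \<omega>) (Y \<omega>)) = (LINT \<omega>'|M. LINT \<omega>|M. f (X \<omega>) (Y \<omega>'))" using * by simp
  have "(LINT p|(distr M N1 X \<Otimes>\<^sub>M distr M N2 Y). case_prod f p) = (LINT x|distr M N1 X. LINT y|distr M N2 Y. f x y)"
    using P.integral_fst[OF int] by simp
  also have "\<dots> = (LINT \<omega>|M. LINT \<omega>'|M. f (X \<omega>) (Y \<omega>'))"
  proof (subst integral_distr[OF X])
    show "(\<lambda>x. LINT y|distr M N2 Y. f x y) \<in> borel_measurable N1"
      by measurable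
    show "(LINT \<omega>|M. LINT y|distr M N2 Y. f (X \<omega>) y) = (LINT \<omega>|M. LINT \<omega>'|M. f (X \<omega>) (Y \<omega>'))"
    proof (rule Bochner_Integration.integral_cong[OF refl], rule integral_distr[OF Y])
      fix \<omega> assume "\<omega> \<in> space M"
      then have [measurable]: "X \<omega> \<in> space N1" using measurable_space[OF X] by auto
      show "(\<lambda>y. f (X \<omega>) y) \<in> borel_measurable N2" by measurable
    qed
  qed
  finally show "(LINT \<omega>|M. f (X \<omega>) (Y \<omega>)) = (LINT \<omega>|M. LINT \<omega>'|M. f (X \<omega>) (Y \<omega>'))" using * by simp
qed

section \<open>Paths and increments of the subordinated process\<close>

locale subordinated_bm = prob_space M for M :: "'w measure" +
  fixes S :: "real \<Rightarrow> 'w \<Rightarrow> real" and W :: "real \<Rightarrow> 'w \<Rightarrow> real ^ 'd" and X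
  assumes sub: "subordinator M 0 jump_measure S"
    and bm: "standard_brownian_motion M W"
    and ind: "independent_processes M W S"
  defines "X t \<omega> \<equiv> W (S t \<omega>) \<omega>"
begin

lemma S_measurable [measurable]: "0 \<le> t \<Longrightarrow> S t \<in> borel_measurable M"
  using sub by (simp add: subordinator_def levy_process_def)

lemma W_measurable [measurable]: "0 \<le> t \<Longrightarrow> W t \<in> borel_measurable M"
  using bm by (simp add: standard_brownian_motion_def)

lemma S_0 [simp]: "\<omega> \<in> space M \<Longrightarrow> S 0 \<omega> = 0"
  using sub by (simp add: subordinator_def levy_process_def)

lemma W_0 [simp]: "\<omega> \<in> space M \<Longrightarrow> W 0 \<omega> = 0"
  using bm by (simp add: standard_brownian_motion_def)

lemma X_0 [simp]: "\<omega> \<in> space M \<Longrightarrow> X 0 \<omega> = 0"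
  by (simp add: X_def)

lemma S_mono: "\<omega> \<in> space M \<Longrightarrow> 0 \<le> s \<Longrightarrow> s \<le> t \<Longrightarrow> S s \<omega> \<le> S t \<omega>"
  using sub by (auto simp: subordinator_def mono_on_def)

lemma S_nonneg: "\<omega> \<in> space M \<Longrightarrow> 0 \<le> t \<Longrightarrow> 0 \<le> S t \<omega>"
  using S_mono[of \<omega> 0 t] by simp

lemma W_continuous: "\<omega> \<in> space M \<Longrightarrow> continuous_on {0..} (\<lambda>t. W t \<omega>)"
  using bm by (simp add: standard_brownian_motion_def)

lemma S_right_cont: "\<omega> \<in> space M \<Longrightarrow> 0 \<le> t \<Longrightarrow> ((\<lambda>t. S t \<omega>) \<longlongrightarrow> S t \<omega>) (at_right t)"
  using sub by (simp add: subordinator_def levy_process_def cadlag_def)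

lemma W_tendsto:
  assumes "\<omega> \<in> space M" "(f \<longlongrightarrow> l) F" "0 \<le> l" "eventually (\<lambda>x. 0 \<le> f x) F"
  shows "((\<lambda>x. W (f x) \<omega>) \<longlongrightarrow> W l \<omega>) F"
  using continuous_on_tendsto_compose[OF W_continuous[OF assms(1)] assms(2)] assms(3,4) by simp

lemma X_right_cont:
  assumes "\<omega> \<in> space M" "0 \<le> t"
  shows "((\<lambda>t. X t \<omega>) \<longlongrightarrow> X t \<omega>) (at_right t)"
  unfolding X_def
proof (rule W_tendsto[OF assms(1) S_right_cont[OF assms] S_nonneg[OF assms]])
  show "\<forall>\<^sub>F x in at_right t. 0 \<le> S x \<omega>"
    using eventually_at_right_less[of t] by eventually_elim (use assms S_nonneg in auto)
qed

text \<open>The point lies strictly to the right of \<open>u \<ge> 0\<close>, so right-continuity is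
  enough to approximate the value at \<open>u\<close>. Because \<open>nat\<close> clamps, it is a
  positive time for negative \<open>u\<close> too, which spares side conditions in measurability
  proofs.\<close>

definition dyadic_above :: "nat \<Rightarrow> real \<Rightarrow> real" where
  "dyadic_above n u = (real (nat \<lfloor>2 ^ n * u\<rfloor>) + 1) / 2 ^ n"

lemma dyadic_above_pos: "0 < dyadic_above n u"
  by (simp add: dyadic_above_def)

lemma dyadic_above:
  assumes "0 \<le> u"
  shows "u < dyadic_above n u" "dyadic_above n u \<le> u + 1 / 2 ^ n"
proof -
  have *: "real (nat \<lfloor>2 ^ n * u\<rfloor>) = of_int \<lfloor>2 ^ n * u\<rfloor>"
    using assms by simp
  have "2 ^ n * u < of_int \<lfloor>2 ^ n * u\<rfloor> + 1" "of_int \<lfloor>2 ^ n * u\<rfloor> \<le> 2 ^ n * u" by linarith+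
  then show "u < dyadic_above n u" "dyadic_above n u \<le> u + 1 / 2 ^ n"
    unfolding dyadic_above_def * by (auto simp: field_simps)
qed

lemma dyadic_above_tendsto:
  assumes "0 \<le> u"
  shows "(\<lambda>n. dyadic_above n u) \<longlonglongrightarrow> u"
proof (rule tendsto_sandwich[of "\<lambda>_. u" _ _ "\<lambda>n. u + 1 / 2 ^ n"])
  show "(\<lambda>n. u + 1 / 2 ^ n) \<longlonglongrightarrow> u"
    by real_asymp
qed (use dyadic_above[OF assms] in \<open>auto intro!: always_eventually less_imp_le\<close>)

text \<open>The product \<open>\<sigma>\<close>-algebra does not see continuity of paths; \<open>path_eval\<close> reads off the
  value of a right-continuous path at a random time from its values at dyadic times only.\<close>

definition path_eval :: "(real \<Rightarrow> real ^ 'd) \<Rightarrow> real \<Rightarrow> real ^ 'd" where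
  "path_eval w u = lim (\<lambda>n. w (dyadic_above n u))"

lemma measurable_path_eval [measurable]:
  assumes [measurable]: "f \<in> N \<rightarrow>\<^sub>M PiM {0..} (\<lambda>_. borel)" "g \<in> borel_measurable N"
  shows "(\<lambda>x. path_eval (f x) (g x)) \<in> borel_measurable N"
proof -
  have "(\<lambda>x. f x ((real k + 1) / 2 ^ n)) \<in> borel_measurable N" for k n
    by (rule measurable_compose[OF assms(1)]) (rule measurable_component_singleton, simp)
  then have "(\<lambda>x. f x (dyadic_above n (g x))) \<in> borel_measurable N" for n
    unfolding dyadic_above_def
    by (rule measurable_compose_countable[where g="\<lambda>x. nat \<lfloor>2 ^ n * g x\<rfloor>"]) measurable
  then show ?thesis
    unfolding path_eval_def by (rule borel_measurable_lim_metric)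
qed

definition RW where "RW \<omega> = (\<lambda>t\<in>{0..}. W t \<omega>)"
definition RS where "RS \<omega> = (\<lambda>t\<in>{0..}. S t \<omega>)"

lemma RW_measurable [measurable]: "RW \<in> M \<rightarrow>\<^sub>M PiM {0..} (\<lambda>_. borel)"
  unfolding RW_def by (rule measurable_restrict) simp

lemma RS_measurable [measurable]: "RS \<in> M \<rightarrow>\<^sub>M PiM {0..} (\<lambda>_. borel)"
  unfolding RS_def by (rule measurable_restrict) simp

lemma path_eval_RW:
  assumes "\<omega> \<in> space M" "0 \<le> u"
  shows "path_eval (RW \<omega>) u = W u \<omega>"
proof -
  have "(\<lambda>n. RW \<omega> (dyadic_above n u)) = (\<lambda>n. W (dyadic_above n u) \<omega>)"
    using dyadic_above_pos by (auto simp: RW_def less_imp_le)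
  moreover have "(\<lambda>n. W (dyadic_above n u) \<omega>) \<longlonglongrightarrow> W u \<omega>"
    using assms dyadic_above_pos
    by (intro W_tendsto dyadic_above_tendsto always_eventually) (auto simp: less_imp_le)
  ultimately show ?thesis
    unfolding path_eval_def by (simp add: limI)
qed

lemma X_measurable [measurable]:
  assumes "0 \<le> t"
  shows "X t \<in> borel_measurable M"
proof -
  have "(\<lambda>\<omega>. path_eval (RW \<omega>) (S t \<omega>)) \<in> borel_measurable M"
    using assms by measurable
  then show ?thesis
    by (rule measurable_cong[THEN iffD1, rotated]) (use assms S_nonneg in \<open>simp add: path_eval_RW X_def\<close>)
qed

lemma prob_RW_RS:
  assumes "A \<in> sets (PiM {0..} (\<lambda>_. borel))" "B \<in> sets (PiM {0..} (\<lambda>_. borel))"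
  shows "prob {\<omega>\<in>space M. RW \<omega> \<in> A \<and> RS \<omega> \<in> B} = prob {\<omega>\<in>space M. RW \<omega> \<in> A} * prob {\<omega>\<in>space M. RS \<omega> \<in> B}"
proof -
  have "prob ((RW -` A \<inter> space M) \<inter> (RS -` B \<inter> space M)) = prob (RW -` A \<inter> space M) * prob (RS -` B \<inter> space M)"
  proof (rule indep_setD)
    show "indep_set
       (sets (vimage_algebra (space M) (\<lambda>\<omega>. \<lambda>t\<in>{0..}. W t \<omega>) (Pi\<^sub>M {0..} (\<lambda>_. borel))))
       (sets (vimage_algebra (space M) (\<lambda>\<omega>. \<lambda>t\<in>{0..}. S t \<omega>) (Pi\<^sub>M {0..} (\<lambda>_. borel))))"
      using ind by (simp add: independent_processes_def)
  qed (use assms in \<open>auto simp: RW_def[abs_def] RS_def[abs_def] intro!: in_vimage_algebra\<close>)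
  then show ?thesis
    by (simp add: vimage_def Int_def conj_ac)
qed

text \<open>This freezes the path of \<open>S\<close>: in the inner integral the time change is
  deterministic and only \<open>W\<close> is random.\<close>

lemma decouple:
  fixes f :: "(real \<Rightarrow> real ^ 'd) \<Rightarrow> (real \<Rightarrow> real) \<Rightarrow> real"
  assumes "case_prod f \<in> borel_measurable (PiM {0..} (\<lambda>_. borel) \<Otimes>\<^sub>M PiM {0..} (\<lambda>_. borel))"
    and "\<And>w s. \<bar>f w s\<bar> \<le> C"
  shows "(LINT \<omega>|M. f (RW \<omega>) (RS \<omega>)) = (LINT \<omega>'|M. LINT \<omega>|M. f (RW \<omega>) (RS \<omega>'))"
  by (rule integral_indep_pair(1)[OF RW_measurable RS_measurable prob_RW_RS assms])

lemma distr_W_increment: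
  assumes "0 \<le> u" "u \<le> u'"
  shows "distr M borel (\<lambda>\<omega>. W u' \<omega> - W u \<omega>) = distr M borel (W (u' - u))"
proof (cases "u = u'")
  case True
  then show ?thesis by (intro distr_cong) auto
next
  case False
  let ?D = "density lborel (\<lambda>x::real^'d. ennreal (\<Prod>i\<in>UNIV. normal_density 0 (sqrt (u' - u)) (x $ i)))"
  have d: "distributed M lborel (\<lambda>\<omega>. W u' \<omega> - W u \<omega>)
      (\<lambda>x. ennreal (\<Prod>i\<in>UNIV. normal_density 0 (sqrt (u' - u)) (x $ i)))"
    using bm False assms by (simp add: standard_brownian_motion_def)
  have "\<forall>s t. 0 \<le> s \<and> s < t \<longrightarrow> distributed M lborel (\<lambda>\<omega>. W t \<omega> - W s \<omega>)
      (\<lambda>x. ennreal (\<Prod>i\<in>UNIV. normal_density 0 (sqrt (t - s)) (x $ i)))"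
    using bm by (simp add: standard_brownian_motion_def)
  from this[rule_format, of 0 "u' - u"]
  have "distributed M lborel (\<lambda>\<omega>. W (u' - u) \<omega> - W 0 \<omega>)
      (\<lambda>x. ennreal (\<Prod>i\<in>UNIV. normal_density 0 (sqrt (u' - u)) (x $ i)))"
    using False assms by simp
  then have "distr M lborel (\<lambda>\<omega>. W (u' - u) \<omega> - W 0 \<omega>) = distr M lborel (\<lambda>\<omega>. W u' \<omega> - W u \<omega>)"
    using d by (simp add: distributed_def)
  moreover have "distr M lborel (\<lambda>\<omega>. W (u' - u) \<omega> - W 0 \<omega>) = distr M borel (W (u' - u))"
    by (intro distr_cong) auto
  moreover have "distr M lborel (\<lambda>\<omega>. W u' \<omega> - W u \<omega>) = distr M borel (\<lambda>\<omega>. W u' \<omega> - W u \<omega>)"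
    by (intro distr_cong) auto
  ultimately show ?thesis by simp
qed

lemma prob_W_past_increment:
  assumes J: "finite J" "J \<subseteq> {0..u}" and u: "0 \<le> u" "u \<le> u'"
    and A [measurable]: "A \<in> sets (PiM J (\<lambda>_. borel))" and B [measurable]: "B \<in> sets borel"
  shows "prob {\<omega>\<in>space M. (\<lambda>j\<in>J. W j \<omega>) \<in> A \<and> W u' \<omega> - W u \<omega> \<in> B} =
    prob {\<omega>\<in>space M. (\<lambda>j\<in>J. W j \<omega>) \<in> A} * prob {\<omega>\<in>space M. W (u' - u) \<omega> \<in> B}"
proof -
  have inc: "independent_increments M W"
    using bm by (simp add: standard_brownian_motion_def)
  have eq: "{\<omega>\<in>space M. (\<lambda>j\<in>J. W j \<omega> - W 0 \<omega>) \<in> A \<and> W u' \<omega> - W u \<omega> \<in> B} = {\<omega>\<in>space M. (\<lambda>j\<in>J. W j \<omega>) \<in> A \<and> W u' \<omega> - W u \<omega> \<in> B}"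
    "{\<omega>\<in>space M. (\<lambda>j\<in>J. W j \<omega> - W 0 \<omega>) \<in> A} = {\<omega>\<in>space M. (\<lambda>j\<in>J. W j \<omega>) \<in> A}"
    by auto
  have "measure (distr M borel (\<lambda>\<omega>. W u' \<omega> - W u \<omega>)) B = measure (distr M borel (W (u' - u))) B"
    using distr_W_increment[OF u] by simp
  then have "prob {\<omega>\<in>space M. W u' \<omega> - W u \<omega> \<in> B} = prob {\<omega>\<in>space M. W (u' - u) \<omega> \<in> B}"
    using u by (simp add: measure_distr vimage_def Int_def conj_commute)
  then show ?thesis
    using prob_past_increment[OF inc J u A B] unfolding eq by simp
qed

lemma distr_S_increment:
  assumes "0 \<le> t" "0 \<le> s"
  shows "distr M borel (\<lambda>\<omega>. S (t + s) \<omega> - S t \<omega>) = distr M borel (S s)"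
proof -
  have "distr M borel (\<lambda>\<omega>. S (t + s) \<omega> - S t \<omega>) = distr M borel (\<lambda>\<omega>. S s \<omega> - S 0 \<omega>)"
  proof -
    have "stationary_increments M S" using sub by (simp add: subordinator_def levy_process_def)
    then have "0 \<le> t \<and> t \<le> t + s \<longrightarrow> distr M borel (\<lambda>\<omega>. S (t + s) \<omega> - S t \<omega>) = distr M borel (\<lambda>\<omega>. S (t + s - t) \<omega> - S 0 \<omega>)"
      unfolding stationary_increments_def by blast
    then show ?thesis using assms by simp
  qed
  also have "\<dots> = distr M borel (S s)"
    by (intro distr_cong) auto
  finally show ?thesis .
qed

lemma prob_S_past_increment:
  assumes J: "finite J" "J \<subseteq> {0..t}" and t: "0 \<le> t" "0 \<le> s"
    and A [measurable]: "A \<in> sets (PiM J (\<lambda>_. borel))" and B [measurable]: "B \<in> sets borel"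
  shows "prob {\<omega>\<in>space M. (\<lambda>j\<in>J. S j \<omega>) \<in> A \<and> S (t + s) \<omega> - S t \<omega> \<in> B} =
    prob {\<omega>\<in>space M. (\<lambda>j\<in>J. S j \<omega>) \<in> A} * prob {\<omega>\<in>space M. S (t + s) \<omega> - S t \<omega> \<in> B}"
proof -
  have inc: "independent_increments M S"
    using sub by (simp add: subordinator_def levy_process_def)
  have eq: "{\<omega>\<in>space M. (\<lambda>j\<in>J. S j \<omega> - S 0 \<omega>) \<in> A \<and> S (t + s) \<omega> - S t \<omega> \<in> B} = {\<omega>\<in>space M. (\<lambda>j\<in>J. S j \<omega>) \<in> A \<and> S (t + s) \<omega> - S t \<omega> \<in> B}"
    "{\<omega>\<in>space M. (\<lambda>j\<in>J. S j \<omega> - S 0 \<omega>) \<in> A} = {\<omega>\<in>space M. (\<lambda>j\<in>J. S j \<omega>) \<in> A}"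
    by auto
  show ?thesis
    using prob_past_increment[OF inc J, of "t + s", OF _ _ A B] t unfolding eq by simp
qed

text \<open>Given the path of \<open>S\<close>, the values of \<open>X\<close> on \<open>J\<close>
  are values of \<open>W\<close> before time \<open>S t\<close>, and the increment of
  \<open>X\<close> is one of \<open>W\<close> over an interval of length
  \<open>S (t + s) - S t\<close>. Independence for \<open>W\<close> splits the two, and independence
  and stationarity for \<open>S\<close> finish the proof. The increment of \<open>S\<close> is
  carried along because stopping times are built from \<open>X\<close>, whereas
  quasi-left-continuity is proved for \<open>S\<close>.\<close>

lemma prob_X_past_increment:
  assumes J: "finite J" "J \<subseteq> {0..t}" and t: "0 \<le> t" "0 \<le> s"
    and A [measurable]: "A \<in> sets (PiM J (\<lambda>_. borel))"
    and B1 [measurable]: "B1 \<in> sets borel" and B2 [measurable]: "B2 \<in> sets borel"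
  shows "prob {\<omega>\<in>space M. (\<lambda>j\<in>J. X j \<omega>) \<in> A \<and> X (t + s) \<omega> - X t \<omega> \<in> B1 \<and> S (t + s) \<omega> - S t \<omega> \<in> B2} =
    prob {\<omega>\<in>space M. (\<lambda>j\<in>J. X j \<omega>) \<in> A} * prob {\<omega>\<in>space M. X s \<omega> \<in> B1 \<and> S s \<omega> \<in> B2}"
proof -
  have J0: "0 \<le> j" "j \<le> t" if "j \<in> J" for j
    using J that by auto
  \<comment> \<open>\<open>a\<close> and \<open>q\<close> are the conditional probabilities given
    \<open>S\<close> of the past event and of the event for the increment of \<open>X\<close>. The
    first depends on \<open>S\<close> through its values on \<open>J\<close>, the second through its
    increment only.\<close>
  define a where "a \<sigma> = (LINT \<omega>|M. indicator A (\<lambda>j\<in>J. path_eval (RW \<omega>) (\<sigma> j)) :: real)" for \<sigma>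
  define q where "q v = (LINT \<omega>|M. indicator B1 (path_eval (RW \<omega>) v) :: real)" for v
  have a_meas [measurable]: "a \<in> borel_measurable (PiM J (\<lambda>_. borel))"
    unfolding a_def by measurable
  have q_meas [measurable]: "q \<in> borel_measurable borel"
    unfolding q_def by measurable
  have ind_bound: "\<bar>LINT \<omega>|M. indicator Z (F \<omega>) :: real\<bar> \<le> 1" for Z :: "'z set" and F
  proof -
    have "\<bar>LINT \<omega>|M. indicator Z (F \<omega>) :: real\<bar> \<le> (LINT \<omega>|M. \<bar>indicator Z (F \<omega>) :: real\<bar>)"
      by (rule integral_abs_bound)
    also have "\<dots> \<le> 1"
    proof (cases "integrable M (\<lambda>\<omega>. \<bar>indicator Z (F \<omega>) :: real\<bar>)")
      case True
      then show ?thesis by (intro integral_le_const) (auto simp: indicator_def)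
    qed (simp add: not_integrable_integral_eq)
    finally show ?thesis .
  qed
  have S_J [measurable]: "(\<lambda>\<omega>. \<lambda>j\<in>J. S j \<omega>) \<in> M \<rightarrow>\<^sub>M PiM J (\<lambda>_. borel)"
    by (rule measurable_restrict) (use J0 in auto)
  have X_J [measurable]: "(\<lambda>\<omega>. \<lambda>j\<in>J. X j \<omega>) \<in> M \<rightarrow>\<^sub>M PiM J (\<lambda>_. borel)"
    by (rule measurable_restrict) (use J0 in auto)
  have [measurable]: "(\<lambda>\<sigma>. \<sigma> j) \<in> borel_measurable (PiM {0..} (\<lambda>_. borel))"
    if "0 \<le> j" for j :: real
    by (rule measurable_component_singleton) (use that in auto)
  have X_eval: "path_eval (RW \<omega>) (S r \<omega>) = X r \<omega>" if "\<omega> \<in> space M" "0 \<le> r" for \<omega> r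
    using that S_nonneg by (simp add: path_eval_RW X_def)
  have RS_eval: "RS \<omega> r = S r \<omega>" if "0 \<le> r" for \<omega> r
    using that by (simp add: RS_def)

  let ?f = "\<lambda>w \<sigma>. indicator A (\<lambda>j\<in>J. path_eval w (\<sigma> j)) * indicator B1 (path_eval w (\<sigma> (t + s)) - path_eval w (\<sigma> t))
    * indicator B2 (\<sigma> (t + s) - \<sigma> t) :: real"
  have ts: "0 \<le> t + s" using t by simp
  have "prob {\<omega>\<in>space M. (\<lambda>j\<in>J. X j \<omega>) \<in> A \<and> X (t + s) \<omega> - X t \<omega> \<in> B1 \<and> S (t + s) \<omega> - S t \<omega> \<in> B2}
      = (LINT \<omega>|M. indicator {\<omega>\<in>space M. (\<lambda>j\<in>J. X j \<omega>) \<in> A \<and> X (t + s) \<omega> - X t \<omega> \<in> B1 \<and> S (t + s) \<omega> - S t \<omega> \<in> B2} \<omega>)"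
    using t by (subst Bochner_Integration.integral_indicator) (auto simp: emeasure_eq_measure)
  also have "\<dots> = (LINT \<omega>|M. ?f (RW \<omega>) (RS \<omega>))"
    using ts t J0 by (intro Bochner_Integration.integral_cong)
      (auto simp: X_eval indicator_def RS_eval restrict_def cong: if_cong)
  also have "\<dots> = (LINT \<omega>'|M. LINT \<omega>|M. ?f (RW \<omega>) (RS \<omega>'))"
  proof (rule decouple[where C = 1])
    have [measurable]: "(\<lambda>x. \<lambda>j\<in>J. path_eval (fst x) (snd x j)) \<in>
        (PiM {0..} (\<lambda>_. borel) \<Otimes>\<^sub>M PiM {0..} (\<lambda>_. borel)) \<rightarrow>\<^sub>M PiM J (\<lambda>_. borel)"
      by (rule measurable_restrict) (use J0 in measurable)
    show "(\<lambda>(w, \<sigma>). ?f w \<sigma>) \<in> borel_measurable (PiM {0..} (\<lambda>_. borel) \<Otimes>\<^sub>M PiM {0..} (\<lambda>_. borel))"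
      unfolding split_beta' using ts t by measurable
  qed (auto simp: indicator_def)
  also have "\<dots> = (LINT \<omega>'|M. a (\<lambda>j\<in>J. S j \<omega>') * (q (S (t + s) \<omega>' - S t \<omega>') * indicator B2 (S (t + s) \<omega>' - S t \<omega>')))"
  proof (rule Bochner_Integration.integral_cong[OF refl])
    fix \<omega>' assume \<omega>': "\<omega>' \<in> space M"
    \<comment> \<open>\<open>S\<close> may take the same value at several times of \<open>J\<close>,
      so the past of \<open>W\<close> is indexed by the image \<open>K\<close>, and \<open>A\<close>
      is pulled back to \<open>A'\<close>.\<close>
    define K where "K = (\<lambda>j. S j \<omega>') ` J"
    define A' where "A' = {v \<in> space (PiM K (\<lambda>_. borel)). (\<lambda>j\<in>J. v (S j \<omega>')) \<in> A}"
    have "(\<lambda>v. \<lambda>j\<in>J. v (S j \<omega>')) \<in> PiM K (\<lambda>_. borel) \<rightarrow>\<^sub>M PiM J (\<lambda>_. borel :: (real^'d) measure)"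
      by (rule measurable_restrict, rule measurable_component_singleton) (auto simp: K_def)
    then have A' [measurable]: "A' \<in> sets (PiM K (\<lambda>_. borel))"
      unfolding A'_def by measurable
    have K: "finite K" "K \<subseteq> {0..S t \<omega>'}"
      using J J0 S_mono[OF \<omega>'] S_nonneg[OF \<omega>'] by (auto simp: K_def)
    have St: "0 \<le> S t \<omega>'" "S t \<omega>' \<le> S (t + s) \<omega>'" "0 \<le> S (t + s) \<omega>'"
      using S_nonneg[OF \<omega>'] S_mono[OF \<omega>'] t by auto
    have in_A': "(\<lambda>j\<in>K. W j \<omega>) \<in> A' \<longleftrightarrow> (\<lambda>j\<in>J. W (S j \<omega>') \<omega>) \<in> A" for \<omega>
    proof -
      have "(\<lambda>j\<in>J. (\<lambda>j\<in>K. W j \<omega>) (S j \<omega>')) = (\<lambda>j\<in>J. W (S j \<omega>') \<omega>)"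
        by (rule restrict_ext) (auto simp: K_def)
      then show ?thesis by (simp add: A'_def space_PiM)
    qed
    have mJ [measurable]: "(\<lambda>\<omega>. \<lambda>j\<in>J. W (S j \<omega>') \<omega>) \<in> M \<rightarrow>\<^sub>M PiM J (\<lambda>_. borel)"
      by (rule measurable_restrict) (use J0 S_nonneg[OF \<omega>'] in auto)
    have 1: "(LINT \<omega>|M. indicator A (\<lambda>j\<in>J. W (S j \<omega>') \<omega>) * indicator B1 (W (S (t + s) \<omega>') \<omega> - W (S t \<omega>') \<omega>) :: real)
      = prob {\<omega>\<in>space M. (\<lambda>j\<in>K. W j \<omega>) \<in> A' \<and> W (S (t + s) \<omega>') \<omega> - W (S t \<omega>') \<omega> \<in> B1}"
    proof -
      have "(LINT \<omega>|M. indicator A (\<lambda>j\<in>J. W (S j \<omega>') \<omega>) * indicator B1 (W (S (t + s) \<omega>') \<omega> - W (S t \<omega>') \<omega>) :: real)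
        = (LINT \<omega>|M. indicator {\<omega>\<in>space M. (\<lambda>j\<in>J. W (S j \<omega>') \<omega>) \<in> A \<and> W (S (t + s) \<omega>') \<omega> - W (S t \<omega>') \<omega> \<in> B1} \<omega>)"
        by (intro Bochner_Integration.integral_cong) (auto simp: indicator_def)
      also have "\<dots> = prob {\<omega>\<in>space M. (\<lambda>j\<in>J. W (S j \<omega>') \<omega>) \<in> A \<and> W (S (t + s) \<omega>') \<omega> - W (S t \<omega>') \<omega> \<in> B1}"
        using St by (subst Bochner_Integration.integral_indicator) (auto simp: emeasure_eq_measure)
      finally show ?thesis by (simp add: in_A')
    qed
    have 2: "a (\<lambda>j\<in>J. S j \<omega>') = prob {\<omega>\<in>space M. (\<lambda>j\<in>K. W j \<omega>) \<in> A'}"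
    proof -
      have "a (\<lambda>j\<in>J. S j \<omega>') = (LINT \<omega>|M. indicator {\<omega>\<in>space M. (\<lambda>j\<in>J. W (S j \<omega>') \<omega>) \<in> A} \<omega>)"
        unfolding a_def using J0 S_nonneg[OF \<omega>']
        by (intro Bochner_Integration.integral_cong)
          (auto simp: indicator_def path_eval_RW restrict_def cong: if_cong)
      also have "\<dots> = prob {\<omega>\<in>space M. (\<lambda>j\<in>J. W (S j \<omega>') \<omega>) \<in> A}"
        by (subst Bochner_Integration.integral_indicator) (auto simp: emeasure_eq_measure)
      finally show ?thesis by (simp add: in_A')
    qed
    have 3: "q (S (t + s) \<omega>' - S t \<omega>') = prob {\<omega>\<in>space M. W (S (t + s) \<omega>' - S t \<omega>') \<omega> \<in> B1}"
    proof -
      have "q (S (t + s) \<omega>' - S t \<omega>') = (LINT \<omega>|M. indicator {\<omega>\<in>space M. W (S (t + s) \<omega>' - S t \<omega>') \<omega> \<in> B1} \<omega>)"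
        unfolding q_def using St by (intro Bochner_Integration.integral_cong) (auto simp: indicator_def path_eval_RW)
      also have "\<dots> = prob {\<omega>\<in>space M. W (S (t + s) \<omega>' - S t \<omega>') \<omega> \<in> B1}"
        using St by (subst Bochner_Integration.integral_indicator) (auto simp: emeasure_eq_measure)
      finally show ?thesis .
    qed
    have "(LINT \<omega>|M. ?f (RW \<omega>) (RS \<omega>')) =
      (LINT \<omega>|M. indicator A (\<lambda>j\<in>J. W (S j \<omega>') \<omega>) * indicator B1 (W (S (t + s) \<omega>') \<omega> - W (S t \<omega>') \<omega>) *
        indicator B2 (S (t + s) \<omega>' - S t \<omega>'))"
      using J0 S_nonneg[OF \<omega>'] t St
      by (intro Bochner_Integration.integral_cong) (auto simp: RS_eval path_eval_RW restrict_def cong: if_cong)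
    also have "\<dots> = (LINT \<omega>|M. indicator A (\<lambda>j\<in>J. W (S j \<omega>') \<omega>) * indicator B1 (W (S (t + s) \<omega>') \<omega> - W (S t \<omega>') \<omega>)) *
        indicator B2 (S (t + s) \<omega>' - S t \<omega>')"
      by simp
    also have "\<dots> = a (\<lambda>j\<in>J. S j \<omega>') * q (S (t + s) \<omega>' - S t \<omega>') * indicator B2 (S (t + s) \<omega>' - S t \<omega>')"
      unfolding 1 2 3 using prob_W_past_increment[OF K St(1,2) A' B1] by simp
    finally show "(LINT \<omega>|M. ?f (RW \<omega>) (RS \<omega>')) =
      a (\<lambda>j\<in>J. S j \<omega>') * (q (S (t + s) \<omega>' - S t \<omega>') * indicator B2 (S (t + s) \<omega>' - S t \<omega>'))" by simp
  qed
  also have "\<dots> = (LINT \<omega>|M. LINT \<omega>'|M. a (\<lambda>j\<in>J. S j \<omega>) * (q (S (t + s) \<omega>' - S t \<omega>') * indicator B2 (S (t + s) \<omega>' - S t \<omega>')))"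
  proof (rule integral_indep_pair(2)[OF S_J, where f = "\<lambda>x y. a x * (q y * indicator B2 y)" and C = 1])
    show "(\<lambda>\<omega>'. S (t + s) \<omega>' - S t \<omega>') \<in> borel_measurable M" using ts t by measurable
    show "(\<lambda>(x, y). a x * (q y * indicator B2 y)) \<in> borel_measurable (Pi\<^sub>M J (\<lambda>_. borel) \<Otimes>\<^sub>M borel)"
      by measurable
    show "\<bar>a x * (q y * indicator B2 y)\<bar> \<le> 1" for x y
    proof -
      have "\<bar>a x\<bar> \<le> 1" "\<bar>q y\<bar> \<le> 1" unfolding a_def q_def by (rule ind_bound)+
      then show ?thesis by (auto simp: abs_mult indicator_def intro: mult_le_one)
    qed
  qed (rule prob_S_past_increment[OF J t])
  also have "\<dots> = (LINT \<omega>|M. a (\<lambda>j\<in>J. S j \<omega>)) * (LINT \<omega>'|M. q (S (t + s) \<omega>' - S t \<omega>') * indicator B2 (S (t + s) \<omega>' - S t \<omega>'))"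
    by simp
  also have "(LINT \<omega>'|M. q (S (t + s) \<omega>' - S t \<omega>') * indicator B2 (S (t + s) \<omega>' - S t \<omega>')) =
      (LINT v|distr M borel (\<lambda>\<omega>'. S (t + s) \<omega>' - S t \<omega>'). q v * indicator B2 v)"
    using ts t by (subst integral_distr) auto
  also have "\<dots> = (LINT \<omega>'|M. q (S s \<omega>') * indicator B2 (S s \<omega>'))"
    unfolding distr_S_increment[OF t] using t by (subst integral_distr) auto
  \<comment> \<open>The freezing is now undone, for the increment and for the past
    separately.\<close>
  also have "\<dots> = (LINT \<omega>'|M. LINT \<omega>|M. indicator B1 (path_eval (RW \<omega>) (RS \<omega>' s)) * indicator B2 (RS \<omega>' s))"
    using t by (intro Bochner_Integration.integral_cong) (auto simp: RS_eval q_def)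
  also have "\<dots> = (LINT \<omega>|M. indicator B1 (path_eval (RW \<omega>) (RS \<omega> s)) * indicator B2 (RS \<omega> s))"
  proof (rule decouple[where C = 1 and f = "\<lambda>w \<sigma>. indicator B1 (path_eval w (\<sigma> s)) * indicator B2 (\<sigma> s)", symmetric])
    show "(\<lambda>(w, \<sigma>). indicator B1 (path_eval w (\<sigma> s)) * indicator B2 (\<sigma> s) :: real)
        \<in> borel_measurable (PiM {0..} (\<lambda>_. borel) \<Otimes>\<^sub>M PiM {0..} (\<lambda>_. borel))"
      unfolding split_beta' using t by measurable
  qed (auto simp: indicator_def)
  also have "\<dots> = (LINT \<omega>|M. indicator {\<omega>\<in>space M. X s \<omega> \<in> B1 \<and> S s \<omega> \<in> B2} \<omega>)"
    using t by (intro Bochner_Integration.integral_cong) (auto simp: X_eval indicator_def RS_eval)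
  also have "\<dots> = prob {\<omega>\<in>space M. X s \<omega> \<in> B1 \<and> S s \<omega> \<in> B2}"
    using t by (subst Bochner_Integration.integral_indicator) (auto simp: emeasure_eq_measure)
  also have "(LINT \<omega>|M. a (\<lambda>j\<in>J. S j \<omega>)) = (LINT \<omega>'|M. LINT \<omega>|M. indicator A (\<lambda>j\<in>J. path_eval (RW \<omega>) (RS \<omega>' j)))"
    using J0 by (intro Bochner_Integration.integral_cong) (auto simp: RS_eval a_def restrict_def cong: if_cong)
  also have "\<dots> = (LINT \<omega>|M. indicator A (\<lambda>j\<in>J. path_eval (RW \<omega>) (RS \<omega> j)))"
  proof (rule decouple[where C = 1 and f = "\<lambda>w \<sigma>. indicator A (\<lambda>j\<in>J. path_eval w (\<sigma> j))", symmetric])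
    have [measurable]: "(\<lambda>x. \<lambda>j\<in>J. path_eval (fst x) (snd x j)) \<in>
        (PiM {0..} (\<lambda>_. borel) \<Otimes>\<^sub>M PiM {0..} (\<lambda>_. borel)) \<rightarrow>\<^sub>M PiM J (\<lambda>_. borel)"
      by (rule measurable_restrict) (use J0 in measurable)
    show "(\<lambda>(w, \<sigma>). indicator A (\<lambda>j\<in>J. path_eval w (\<sigma> j)) :: real)
        \<in> borel_measurable (PiM {0..} (\<lambda>_. borel) \<Otimes>\<^sub>M PiM {0..} (\<lambda>_. borel))"
      unfolding split_beta' by measurable
  qed (auto simp: indicator_def)
  also have "\<dots> = (LINT \<omega>|M. indicator {\<omega>\<in>space M. (\<lambda>j\<in>J. X j \<omega>) \<in> A} \<omega>)"
    using J0 by (intro Bochner_Integration.integral_cong) (auto simp: X_eval RS_eval indicator_def restrict_def cong: if_cong)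
  also have "\<dots> = prob {\<omega>\<in>space M. (\<lambda>j\<in>J. X j \<omega>) \<in> A}"
    by (subst Bochner_Integration.integral_indicator) (auto simp: emeasure_eq_measure)
  finally show ?thesis .
qed

end

section \<open>Stopping on a grid\<close>

text \<open>\<open>U\<close> is the set to be reached, later a neighbourhood of the complement of
  the domain. The bound \<open>m\<close> makes \<open>LEAST\<close> meaningful on sequences that
  never reach it.\<close>

definition grid_stop :: "(nat \<Rightarrow> 'b) \<Rightarrow> 'b set \<Rightarrow> nat \<Rightarrow> nat" where
  "grid_stop y U m = (LEAST i. m \<le> i \<or> y i \<in> U)"

lemma grid_stop_le: "grid_stop y U m \<le> m"
  unfolding grid_stop_def by (rule Least_le) simp

lemma grid_stop_cases: "grid_stop y U m = m \<or> y (grid_stop y U m) \<in> U"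
proof -
  have "m \<le> grid_stop y U m \<or> y (grid_stop y U m) \<in> U"
    unfolding grid_stop_def by (rule LeastI[of _ m]) simp
  then show ?thesis using grid_stop_le[of y U m] by auto
qed

lemma grid_stop_leI: "y i \<in> U \<Longrightarrow> grid_stop y U m \<le> i"
  unfolding grid_stop_def by (rule Least_le) simp

lemma grid_stop_eq_iff:
  "grid_stop y U m = i \<longleftrightarrow> (\<forall>j<i. y j \<notin> U) \<and> (i = m \<or> i < m \<and> y i \<in> U)"
proof
  assume *: "grid_stop y U m = i"
  then have "y j \<notin> U" if "j < i" for j
    using grid_stop_leI[of y j U m] that by auto
  then show "(\<forall>j<i. y j \<notin> U) \<and> (i = m \<or> i < m \<and> y i \<in> U)"
    using * grid_stop_le[of y U m] grid_stop_cases[of y U m] by auto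
next
  assume *: "(\<forall>j<i. y j \<notin> U) \<and> (i = m \<or> i < m \<and> y i \<in> U)"
  show "grid_stop y U m = i"
    unfolding grid_stop_def
    by (rule Least_equality) (use * in \<open>auto simp: not_less[symmetric]\<close>)
qed

text \<open>A discrete Dynkin formula. Whether step \<open>i\<close> is still taken is decided by
  the values up to \<open>i\<close>, so in expectation the increment can be integrated out
  first.\<close>

lemma grid_stop_telescope:
  fixes h :: "'b \<Rightarrow> real"
  shows "h (y (grid_stop y U m)) =
    h (y 0) + (\<Sum>i<m. of_bool (\<forall>j\<le>i. y j \<notin> U) * (h (y (Suc i)) - h (y i)))"
proof (induction m)
  case 0
  then show ?case using grid_stop_le[of y U 0] by simp
next
  case (Suc m)
  show ?case
  proof (cases "\<forall>j\<le>m. y j \<notin> U")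
    case True
    then have "grid_stop y U m = m" "grid_stop y U (Suc m) = Suc m"
      by (auto simp: grid_stop_eq_iff)
    then show ?thesis using Suc True by simp
  next
    case False
    define i where "i = grid_stop y U (Suc m)"
    have i: "(\<forall>j<i. y j \<notin> U) \<and> (i = Suc m \<or> i < Suc m \<and> y i \<in> U)"
      unfolding i_def using grid_stop_eq_iff by blast
    with False have "i < Suc m \<and> y i \<in> U" by (auto simp: less_Suc_eq_le)
    then have "grid_stop y U m = i"
      unfolding grid_stop_eq_iff using i by auto
    then show ?thesis using Suc False by (auto simp: i_def)
  qed
qed

text \<open>Inserting \<open>c\<close> keeps the set nonempty, so that the infimum is meaningful on
  paths that never reach \<open>U\<close>.\<close>

definition capped_hit :: "(real \<Rightarrow> 'b) \<Rightarrow> 'b set \<Rightarrow> real \<Rightarrow> real" where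
  "capped_hit y U c = Inf (insert c {t. 0 \<le> t \<and> y t \<in> U})"

lemma capped_hit_bdd: "bdd_below (insert c {t::real. 0 \<le> t \<and> y t \<in> U})"
  by (rule bdd_belowI[of _ "min 0 c"]) auto

lemma capped_hit_le: "capped_hit y U c \<le> c"
  unfolding capped_hit_def by (rule cInf_lower[OF _ capped_hit_bdd]) simp

lemma capped_hit_leI: "0 \<le> t \<Longrightarrow> y t \<in> U \<Longrightarrow> capped_hit y U c \<le> t"
  unfolding capped_hit_def by (rule cInf_lower[OF _ capped_hit_bdd]) simp

lemma capped_hit_nonneg: "0 \<le> c \<Longrightarrow> 0 \<le> capped_hit y U c"
  unfolding capped_hit_def by (rule cInf_greatest) auto

lemma capped_hit_mono:
  assumes "U \<subseteq> V" "c \<le> d"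
  shows "capped_hit y V c \<le> capped_hit y U d"
  unfolding capped_hit_def[of y U d]
proof (rule cInf_greatest)
  fix t assume "t \<in> insert d {t. 0 \<le> t \<and> y t \<in> U}"
  then consider "t = d" | "0 \<le> t" "y t \<in> U" by auto
  then show "capped_hit y V c \<le> t"
    by cases (use assms capped_hit_le[of y V c] capped_hit_leI[of t y V c] in auto)
qed simp

lemma capped_hit_approx:
  assumes "capped_hit y U c < c" "0 < e"
  obtains t where "capped_hit y U c \<le> t" "t < capped_hit y U c + e" "0 \<le> t" "y t \<in> U"
proof -
  have "Inf (insert c {t. 0 \<le> t \<and> y t \<in> U}) < min c (capped_hit y U c + e)"
    using assms by (simp add: capped_hit_def)
  then obtain t where "t \<in> insert c {t. 0 \<le> t \<and> y t \<in> U}" "t < min c (capped_hit y U c + e)"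
    by (subst (asm) cInf_less_iff[OF _ capped_hit_bdd]) auto
  then show ?thesis using that[of t] capped_hit_leI[of t y U c] by auto
qed

lemma tendsto_right_cont_seq:
  fixes y :: "real \<Rightarrow> 'b::topological_space"
  assumes y: "(y \<longlongrightarrow> y t) (at_right t)" and r: "r \<longlonglongrightarrow> t" "\<And>n. t \<le> r n"
  shows "(\<lambda>n. y (r n)) \<longlonglongrightarrow> y t"
proof -
  have "at t within {t..} = at_right t"
    by (simp add: at_within_Icc_at_right at_within_Ici_at_right)
  then have "continuous (at t within {t..}) y"
    using y by (simp add: continuous_within)
  then show ?thesis
    by (rule continuous_within_tendsto_compose') (use r in auto)
qed

text \<open>A right-continuous path that visits an open set stays there for a while, so a fine
  enough grid notices the visit. This fails for closed sets, which is why open neighbourhoods of the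
  complement of the domain are used and not the complement itself.\<close>

lemma grid_stop_tendsto_capped_hit:
  fixes y :: "real \<Rightarrow> 'b::topological_space" and c :: nat
  assumes y: "\<And>t. 0 \<le> t \<Longrightarrow> (y \<longlongrightarrow> y t) (at_right t)" and U: "open U"
  defines "\<rho> N \<equiv> real (grid_stop (\<lambda>i. y (real i / 2 ^ N)) U (c * 2 ^ N)) / 2 ^ N"
  shows "capped_hit y U (real c) \<le> \<rho> N" and "\<rho> \<longlonglongrightarrow> capped_hit y U (real c)"
proof -
  have ge: "capped_hit y U (real c) \<le> \<rho> N" for N
  proof -
    from grid_stop_cases[of "\<lambda>i. y (real i / 2 ^ N)" U "c * 2 ^ N"]
    consider "\<rho> N = real c" | "y (\<rho> N) \<in> U" by (auto simp: \<rho>_def)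
    then show ?thesis
      by cases (use capped_hit_le[of y U "real c"] capped_hit_leI[of "\<rho> N" y U "real c"] in \<open>auto simp: \<rho>_def\<close>)
  qed
  then show "capped_hit y U (real c) \<le> \<rho> N" .
  have le: "\<rho> N \<le> real c" for N
  proof -
    have "real (grid_stop (\<lambda>i. y (real i / 2 ^ N)) U (c * 2 ^ N)) \<le> real (c * 2 ^ N)"
      using grid_stop_le of_nat_le_iff by blast
    then show ?thesis by (simp add: \<rho>_def field_simps)
  qed
  show "\<rho> \<longlonglongrightarrow> capped_hit y U (real c)"
  proof (rule LIMSEQ_I)
    fix e :: real assume e: "0 < e"
    show "\<exists>N0. \<forall>N\<ge>N0. norm (\<rho> N - capped_hit y U (real c)) < e"
    proof (cases "capped_hit y U (real c) < real c")
      case False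
      then have "\<rho> N = capped_hit y U (real c)" for N
        using ge[of N] le[of N] by simp
      then show ?thesis using e by simp
    next
      case True
      from capped_hit_approx[OF True e] obtain t where
        t: "capped_hit y U (real c) \<le> t" "t < capped_hit y U (real c) + e" "0 \<le> t" "y t \<in> U" .
      have "eventually (\<lambda>s. y s \<in> U) (at_right t)"
        using topological_tendstoD[OF y[OF t(3)] U t(4)] .
      then obtain b where b: "t < b" "\<And>s. t < s \<Longrightarrow> s < b \<Longrightarrow> y s \<in> U"
        unfolding eventually_at_right_field by auto
      \<comment> \<open>Every grid point in the window of length \<open>d\<close> after
        \<open>t\<close> lies in \<open>U\<close> and less than \<open>e\<close> after the hitting
        time; a mesh below \<open>d\<close> has such a point.\<close>
      define d where "d = min b (capped_hit y U (real c) + e) - t"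
      have d: "0 < d" using b t by (simp add: d_def)
      have "(\<lambda>N. 1 / 2 ^ N :: real) \<longlonglongrightarrow> 0" by real_asymp
      then have "eventually (\<lambda>N. 1 / 2 ^ N < d) sequentially"
        by (rule order_tendstoD) (rule d)
      then obtain N0 where N0: "\<And>N. N \<ge> N0 \<Longrightarrow> 1 / 2 ^ N < d"
        unfolding eventually_sequentially by auto
      have lt: "\<rho> N < capped_hit y U (real c) + e" if N: "N \<ge> N0" for N
      proof -
        define i where "i = Suc (nat \<lfloor>t * 2 ^ N\<rfloor>)"
        have *: "real i = of_int \<lfloor>t * 2 ^ N\<rfloor> + 1" using t by (simp add: i_def)
        have "t * 2 ^ N < real i" "real i \<le> t * 2 ^ N + 1"
          unfolding * by linarith+
        then have i: "t < real i / 2 ^ N" "real i / 2 ^ N \<le> t + 1 / 2 ^ N"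
          by (auto simp: field_simps)
        then have "real i / 2 ^ N < t + d" using N0[OF N] by simp
        then have id: "real i / 2 ^ N < b" "real i / 2 ^ N < capped_hit y U (real c) + e"
          by (auto simp: d_def)
        then have "y (real i / 2 ^ N) \<in> U" using b(2) i by auto
        then have "grid_stop (\<lambda>i. y (real i / 2 ^ N)) U (c * 2 ^ N) \<le> i"
          by (rule grid_stop_leI)
        then have "\<rho> N \<le> real i / 2 ^ N" by (simp add: \<rho>_def divide_right_mono)
        then show ?thesis using id by simp
      qed
      show ?thesis
      proof (intro exI[of _ N0] allI impI)
        fix N assume "N0 \<le> N"
        then show "norm (\<rho> N - capped_hit y U (real c)) < e"
          using ge[of N] lt[of N] by simp
      qed
    qed
  qed
qed

context subordinated_bm begin

lemma distr_X_increment: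
  assumes t: "0 \<le> t" "0 \<le> s"
  shows "distr M borel (\<lambda>\<omega>. X (t + s) \<omega> - X t \<omega>) = distr M borel (X s)"
proof (rule measure_eqI)
  fix B assume "B \<in> sets (distr M borel (\<lambda>\<omega>. X (t + s) \<omega> - X t \<omega>))"
  then have B: "B \<in> sets borel" by simp
  have m [measurable]: "X (t + s) \<in> borel_measurable M" "X t \<in> borel_measurable M" "X s \<in> borel_measurable M"
    using t by auto
  have "prob {\<omega>\<in>space M. X (t + s) \<omega> - X t \<omega> \<in> B} = prob {\<omega>\<in>space M. X s \<omega> \<in> B}"
    using prob_X_past_increment[of "{}" t s "space (PiM {} (\<lambda>_. borel))" B UNIV, OF _ _ t sets.top B]
    by (simp add: space_PiM prob_space restrict_def)
  then show "emeasure (distr M borel (\<lambda>\<omega>. X (t + s) \<omega> - X t \<omega>)) B = emeasure (distr M borel (X s)) B"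
    using B by (simp add: emeasure_distr emeasure_eq_measure vimage_def Int_def conj_commute)
qed simp

lemma X_restrict_measurable:
  assumes "J \<subseteq> {0..}"
  shows "(\<lambda>\<omega>. \<lambda>j\<in>J. X j \<omega>) \<in> M \<rightarrow>\<^sub>M PiM J (\<lambda>_. borel)"
  by (rule measurable_restrict) (use assms in auto)

lemma integral_X_past_increment:
  fixes f :: "(real \<Rightarrow> real ^ 'd) \<Rightarrow> real ^ 'd \<Rightarrow> real"
  assumes J: "finite J" "J \<subseteq> {0..t}" and t: "0 \<le> t" "0 \<le> s"
    and f [measurable]: "case_prod f \<in> borel_measurable (PiM J (\<lambda>_. borel) \<Otimes>\<^sub>M borel)"
    and bound: "\<And>x y. \<bar>f x y\<bar> \<le> C"
  shows "(LINT \<omega>|M. f (\<lambda>j\<in>J. X j \<omega>) (X (t + s) \<omega> - X t \<omega>)) =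
    (LINT \<omega>|M. LINT \<omega>'|M. f (\<lambda>j\<in>J. X j \<omega>) (X s \<omega>'))"
proof -
  have J': "J \<subseteq> {0..}" using J by auto
  have m [measurable]: "X (t + s) \<in> borel_measurable M" "X t \<in> borel_measurable M" "X s \<in> borel_measurable M"
    using t by auto
  have XJ [measurable]: "(\<lambda>\<omega>. \<lambda>j\<in>J. X j \<omega>) \<in> M \<rightarrow>\<^sub>M PiM J (\<lambda>_. borel)"
    by (rule X_restrict_measurable[OF J'])
  have eq: "prob {\<omega>\<in>space M. X (t + s) \<omega> - X t \<omega> \<in> B} = prob {\<omega>\<in>space M. X s \<omega> \<in> B}"
    if B [measurable]: "B \<in> sets borel" for B
    using arg_cong[OF distr_X_increment[OF t], of "\<lambda>N. measure N B"]
    by (simp add: measure_distr vimage_def Int_def conj_commute)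
  have "(LINT \<omega>|M. f (\<lambda>j\<in>J. X j \<omega>) (X (t + s) \<omega> - X t \<omega>)) =
    (LINT \<omega>|M. LINT \<omega>'|M. f (\<lambda>j\<in>J. X j \<omega>) (X (t + s) \<omega>' - X t \<omega>'))"
  proof (rule integral_indep_pair(2)[OF XJ _ _ f bound])
    show "prob {\<omega>\<in>space M. (\<lambda>j\<in>J. X j \<omega>) \<in> A \<and> X (t + s) \<omega> - X t \<omega> \<in> B} =
      prob {\<omega>\<in>space M. (\<lambda>j\<in>J. X j \<omega>) \<in> A} * prob {\<omega>\<in>space M. X (t + s) \<omega> - X t \<omega> \<in> B}"
      if "A \<in> sets (PiM J (\<lambda>_. borel))" "B \<in> sets borel" for A B
      using prob_X_past_increment[OF J t that, of UNIV] eq[OF that(2)] by simp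
  qed measurable
  also have "\<dots> = (LINT \<omega>|M. LINT \<omega>'|M. f (\<lambda>j\<in>J. X j \<omega>) (X s \<omega>'))"
  proof (rule Bochner_Integration.integral_cong[OF refl])
    fix \<omega> assume "\<omega> \<in> space M"
    then have [measurable]: "(\<lambda>j\<in>J. X j \<omega>) \<in> space (PiM J (\<lambda>_. borel))"
      using measurable_space[OF XJ] by auto
    have fm [measurable]: "f (\<lambda>j\<in>J. X j \<omega>) \<in> borel_measurable borel" by measurable
    have "(LINT \<omega>'|M. f (\<lambda>j\<in>J. X j \<omega>) (X (t + s) \<omega>' - X t \<omega>')) =
      (LINT v|distr M borel (\<lambda>\<omega>. X (t + s) \<omega> - X t \<omega>). f (\<lambda>j\<in>J. X j \<omega>) v)"
      by (subst integral_distr) auto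
    also have "\<dots> = (LINT \<omega>'|M. f (\<lambda>j\<in>J. X j \<omega>) (X s \<omega>'))"
      unfolding distr_X_increment[OF t] by (subst integral_distr) auto
    finally show "(LINT \<omega>'|M. f (\<lambda>j\<in>J. X j \<omega>) (X (t + s) \<omega>' - X t \<omega>')) =
      (LINT \<omega>'|M. f (\<lambda>j\<in>J. X j \<omega>) (X s \<omega>'))" .
  qed
  finally show ?thesis .
qed

text \<open>Each step not yet stopped starts from a point outside \<open>U\<close>. The event of not
  being stopped belongs to the past, so conditioning on it leaves a one-step error of at most
  \<open>e\<close>, and there are \<open>m\<close> steps.\<close>

lemma integral_grid_stop:
  fixes h :: "real ^ 'd \<Rightarrow> real"
  assumes \<delta>: "0 \<le> \<delta>" and h [measurable]: "h \<in> borel_measurable borel" and bound: "\<And>z. \<bar>h z\<bar> \<le> C"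
    and U [measurable]: "U \<in> sets borel"
    and e: "\<And>z. z \<notin> U \<Longrightarrow> \<bar>(LINT \<omega>|M. h (z + X \<delta> \<omega>)) - h z\<bar> \<le> e" "0 \<le> e"
  shows "\<bar>(LINT \<omega>|M. h (x + X (real (grid_stop (\<lambda>i. x + X (real i * \<delta>) \<omega>) U m) * \<delta>) \<omega>)) - h x\<bar> \<le> real m * e"
proof -
  let ?A = "\<lambda>i \<omega>. \<forall>j\<le>i. x + X (real j * \<delta>) \<omega> \<notin> U"
  have X_m [measurable]: "X (real i * \<delta>) \<in> borel_measurable M" for i
    using \<delta> by simp
  have X_m' [measurable]: "X \<delta> \<in> borel_measurable M" "X 0 \<in> borel_measurable M"
    using \<delta> by auto
  have Cpos: "0 \<le> C" using bound[of 0] by linarith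
  have intg: "integrable M (\<lambda>\<omega>. of_bool (?A i \<omega>) * (h (x + X (real (Suc i) * \<delta>) \<omega>) - h (x + X (real i * \<delta>) \<omega>)))" for i
  proof (rule integrable_const_bound[where B = "2 * C"])
    have "\<bar>h z - h z'\<bar> \<le> 2 * C" for z z' using bound[of z] bound[of z'] by linarith
    then show "AE \<omega> in M. norm (of_bool (?A i \<omega>) * (h (x + X (real (Suc i) * \<delta>) \<omega>) - h (x + X (real i * \<delta>) \<omega>))) \<le> 2 * C"
      using Cpos by (intro AE_I2) (auto simp: abs_mult of_bool_def)
  qed measurable
  have intb: "integrable M (\<lambda>\<omega>. h (z + X \<delta> \<omega>))" for z
    by (rule integrable_const_bound[where B = C]) (use bound in auto)
  have step: "\<bar>LINT \<omega>|M. of_bool (?A i \<omega>) * (h (x + X (real (Suc i) * \<delta>) \<omega>) - h (x + X (real i * \<delta>) \<omega>))\<bar> \<le> e" for i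
  proof -
    define J where "J = (\<lambda>j. real j * \<delta>) ` {..i}"
    have J: "finite J" "J \<subseteq> {0..real i * \<delta>}" using \<delta> by (auto simp: J_def mult_right_mono)
    have iJ: "real j * \<delta> \<in> J" if "j \<le> i" for j using that by (auto simp: J_def)
    define f where "f v d = of_bool (\<forall>j\<le>i. x + v (real j * \<delta>) \<notin> U) * (h (x + v (real i * \<delta>) + d) - h (x + v (real i * \<delta>)))"
      for v :: "real \<Rightarrow> real ^ 'd" and d
    have [measurable]: "(\<lambda>v. v (real j * \<delta>)) \<in> borel_measurable (PiM J (\<lambda>_. borel :: (real^'d) measure))" if "j \<le> i" for j
      by (rule measurable_component_singleton) (rule iJ[OF that])
    have "(LINT \<omega>|M. of_bool (?A i \<omega>) * (h (x + X (real (Suc i) * \<delta>) \<omega>) - h (x + X (real i * \<delta>) \<omega>))) =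
      (LINT \<omega>|M. f (\<lambda>j\<in>J. X j \<omega>) (X (real i * \<delta> + \<delta>) \<omega> - X (real i * \<delta>) \<omega>))"
      unfolding f_def using iJ by (intro Bochner_Integration.integral_cong) (auto simp: algebra_simps)
    also have "\<dots> = (LINT \<omega>|M. LINT \<omega>'|M. f (\<lambda>j\<in>J. X j \<omega>) (X \<delta> \<omega>'))"
    proof (rule integral_X_past_increment[OF J, where C = "2 * C"])
      have [measurable]: "Measurable.pred (Pi\<^sub>M J (\<lambda>_. borel) \<Otimes>\<^sub>M borel) (\<lambda>p. \<forall>j\<le>i. x + fst p (real j * \<delta>) \<notin> U)"
      proof -
        have "Measurable.pred (Pi\<^sub>M J (\<lambda>_. borel) \<Otimes>\<^sub>M borel) (\<lambda>p. \<forall>j\<in>{..i}. x + fst p (real j * \<delta>) \<notin> U)"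
          by (rule pred_intros_finite) auto
        then show ?thesis by (simp add: Ball_def)
      qed
      show "case_prod f \<in> borel_measurable (Pi\<^sub>M J (\<lambda>_. borel) \<Otimes>\<^sub>M borel)"
        unfolding f_def split_beta' by measurable
      have "\<bar>h z - h z'\<bar> \<le> 2 * C" for z z' using bound[of z] bound[of z'] by linarith
      then show "\<bar>f v d\<bar> \<le> 2 * C" for v d using Cpos by (auto simp: f_def abs_mult of_bool_def)
    qed (use \<delta> in auto)
    also have "\<dots> = (LINT \<omega>|M. of_bool (?A i \<omega>) * ((LINT \<omega>'|M. h (x + X (real i * \<delta>) \<omega> + X \<delta> \<omega>')) - h (x + X (real i * \<delta>) \<omega>)))"
      unfolding f_def using iJ intb
      by (intro Bochner_Integration.integral_cong) (auto simp: prob_space)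
    also have "\<bar>\<dots>\<bar> \<le> (LINT \<omega>|M. \<bar>of_bool (?A i \<omega>) * ((LINT \<omega>'|M. h (x + X (real i * \<delta>) \<omega> + X \<delta> \<omega>')) - h (x + X (real i * \<delta>) \<omega>))\<bar>)"
      by (rule integral_abs_bound)
    also have "\<dots> \<le> e"
    proof (rule integral_le_const)
      show "AE \<omega> in M. \<bar>of_bool (?A i \<omega>) * ((LINT \<omega>'|M. h (x + X (real i * \<delta>) \<omega> + X \<delta> \<omega>')) - h (x + X (real i * \<delta>) \<omega>))\<bar> \<le> e"
        using e by (intro AE_I2) (auto simp: abs_mult of_bool_def)
      show "integrable M (\<lambda>\<omega>. \<bar>of_bool (?A i \<omega>) * ((LINT \<omega>'|M. h (x + X (real i * \<delta>) \<omega> + X \<delta> \<omega>')) - h (x + X (real i * \<delta>) \<omega>))\<bar>)"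
        by (rule integrable_const_bound[where B = e]) (use e in \<open>auto simp: abs_mult of_bool_def\<close>)
    qed
    finally show ?thesis .
  qed
  have "(LINT \<omega>|M. h (x + X (real (grid_stop (\<lambda>i. x + X (real i * \<delta>) \<omega>) U m) * \<delta>) \<omega>)) =
    (LINT \<omega>|M. h x + (\<Sum>i<m. of_bool (?A i \<omega>) * (h (x + X (real (Suc i) * \<delta>) \<omega>) - h (x + X (real i * \<delta>) \<omega>))))"
    using grid_stop_telescope[of h "\<lambda>i. x + X (real i * \<delta>) _" U m]
    by (intro Bochner_Integration.integral_cong) auto
  also have "\<dots> = h x + (\<Sum>i<m. LINT \<omega>|M. of_bool (?A i \<omega>) * (h (x + X (real (Suc i) * \<delta>) \<omega>) - h (x + X (real i * \<delta>) \<omega>)))"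
    using intg
    by (subst Bochner_Integration.integral_add) (auto simp: prob_space simp del: of_nat_Suc sum_of_bool_mult_eq sum_mult_of_bool_eq)
  finally have "\<bar>(LINT \<omega>|M. h (x + X (real (grid_stop (\<lambda>i. x + X (real i * \<delta>) \<omega>) U m) * \<delta>) \<omega>)) - h x\<bar> =
     \<bar>\<Sum>i<m. LINT \<omega>|M. of_bool (?A i \<omega>) * (h (x + X (real (Suc i) * \<delta>) \<omega>) - h (x + X (real i * \<delta>) \<omega>))\<bar>"
    by simp
  also have "\<dots> \<le> (\<Sum>i<m. e)"
    by (rule order_trans[OF sum_abs sum_mono]) (rule step)
  finally show ?thesis by simp
qed

lemma integral_X_past_S_increment:
  fixes G :: "real \<Rightarrow> real"
  assumes J: "finite J" "J \<subseteq> {0..t}" and t: "0 \<le> t" "0 \<le> s"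
    and A [measurable]: "A \<in> sets (PiM J (\<lambda>_. borel))"
    and G [measurable]: "G \<in> borel_measurable borel" and bound: "\<And>v. \<bar>G v\<bar> \<le> C"
  shows "(LINT \<omega>|M. indicator A (\<lambda>j\<in>J. X j \<omega>) * G (S (t + s) \<omega> - S t \<omega>)) =
    (LINT \<omega>|M. indicator A (\<lambda>j\<in>J. X j \<omega>)) * (LINT \<omega>|M. G (S s \<omega>))"
proof -
  have J': "J \<subseteq> {0..}" using J by auto
  have m [measurable]: "S (t + s) \<in> borel_measurable M" "S t \<in> borel_measurable M" "S s \<in> borel_measurable M" "X s \<in> borel_measurable M"
    using t by auto
  have XJ [measurable]: "(\<lambda>\<omega>. \<lambda>j\<in>J. X j \<omega>) \<in> M \<rightarrow>\<^sub>M PiM J (\<lambda>_. borel)"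
    by (rule X_restrict_measurable[OF J'])
  have eq: "prob {\<omega>\<in>space M. S (t + s) \<omega> - S t \<omega> \<in> B} = prob {\<omega>\<in>space M. S s \<omega> \<in> B}"
    if B [measurable]: "B \<in> sets borel" for B
    using arg_cong[OF distr_S_increment[OF t], of "\<lambda>N. measure N B"]
    by (simp add: measure_distr vimage_def Int_def conj_commute)
  have C: "0 \<le> C" using bound[of 0] by linarith
  have "(LINT \<omega>|M. indicator A (\<lambda>j\<in>J. X j \<omega>) * G (S (t + s) \<omega> - S t \<omega>)) =
    (LINT \<omega>|M. LINT \<omega>'|M. indicator A (\<lambda>j\<in>J. X j \<omega>) * G (S (t + s) \<omega>' - S t \<omega>'))"
  proof (rule integral_indep_pair(2)[OF XJ, where f = "\<lambda>v d. indicator A v * G d" and C = C])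
    show "prob {\<omega>\<in>space M. (\<lambda>j\<in>J. X j \<omega>) \<in> A \<and> S (t + s) \<omega> - S t \<omega> \<in> B} =
      prob {\<omega>\<in>space M. (\<lambda>j\<in>J. X j \<omega>) \<in> A} * prob {\<omega>\<in>space M. S (t + s) \<omega> - S t \<omega> \<in> B}"
      if "A \<in> sets (PiM J (\<lambda>_. borel))" "B \<in> sets borel" for A B
      using prob_X_past_increment[OF J t that(1) _ that(2), of UNIV] eq[OF that(2)] by simp
  qed (use bound C in \<open>auto simp: indicator_def\<close>)
  also have "\<dots> = (LINT \<omega>|M. indicator A (\<lambda>j\<in>J. X j \<omega>)) * (LINT \<omega>|M. G (S (t + s) \<omega> - S t \<omega>))"
    by simp
  also have "(LINT \<omega>|M. G (S (t + s) \<omega> - S t \<omega>)) = (LINT v|distr M borel (\<lambda>\<omega>. S (t + s) \<omega> - S t \<omega>). G v)"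
    by (subst integral_distr) auto
  also have "\<dots> = (LINT \<omega>|M. G (S s \<omega>))"
    unfolding distr_S_increment[OF t] by (subst integral_distr) auto
  finally show ?thesis .
qed

lemma grid_stop_measurable:
  assumes \<delta>: "0 \<le> \<delta>" and U [measurable]: "U \<in> sets borel"
  shows "(\<lambda>\<omega>. grid_stop (\<lambda>i. x + X (real i * \<delta>) \<omega>) U m) \<in> M \<rightarrow>\<^sub>M count_space UNIV"
proof (subst measurable_count_space_eq2_countable, safe)
  fix i
  have [measurable]: "X (real i * \<delta>) \<in> borel_measurable M" for i
    using \<delta> by simp
  have "(\<lambda>\<omega>. grid_stop (\<lambda>i. x + X (real i * \<delta>) \<omega>) U m) -` {i} \<inter> space M =
    {\<omega>\<in>space M. grid_stop (\<lambda>i. x + X (real i * \<delta>) \<omega>) U m = i}"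
    by auto
  also have "\<dots> = {\<omega>\<in>space M. (\<forall>j\<in>{..<i}. x + X (real j * \<delta>) \<omega> \<notin> U) \<and> (i = m \<or> i < m \<and> x + X (real i * \<delta>) \<omega> \<in> U)}"
    by (simp add: grid_stop_eq_iff Ball_def)
  also have "\<dots> \<in> sets M" by measurable
  finally show "(\<lambda>\<omega>. grid_stop (\<lambda>i. x + X (real i * \<delta>) \<omega>) U m) -` {i} \<inter> space M \<in> sets M" .
qed auto

lemma stopped_measurable:
  assumes \<delta>: "0 \<le> \<delta>" and U [measurable]: "U \<in> sets borel"
    and Y: "\<And>i. Y (real i * \<delta>) \<in> M \<rightarrow>\<^sub>M N"
  shows "(\<lambda>\<omega>. Y (real (grid_stop (\<lambda>i. x + X (real i * \<delta>) \<omega>) U m) * \<delta>) \<omega>) \<in> M \<rightarrow>\<^sub>M N"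
  by (rule measurable_compose_countable[OF Y grid_stop_measurable[OF \<delta> U]])

text \<open>The strong Markov property on a grid: the event \<open>T \<omega> = i\<close> is
  expressed by values of \<open>X\<close> up to the grid time \<open>i\<close>, which are
  independent of the increment of \<open>S\<close> after it.\<close>

lemma integral_grid_stop_S:
  fixes x :: "real ^ 'd" and m :: nat
  assumes \<delta>: "0 \<le> \<delta>" and s: "0 \<le> s" and U [measurable]: "U \<in> sets borel"
    and G [measurable]: "G \<in> borel_measurable borel" and bound: "\<And>v. \<bar>G v\<bar> \<le> (C :: real)"
  defines "T \<omega> \<equiv> grid_stop (\<lambda>i. x + X (real i * \<delta>) \<omega>) U m"
  shows "(LINT \<omega>|M. G (S (real (T \<omega>) * \<delta> + s) \<omega> - S (real (T \<omega>) * \<delta>) \<omega>)) = (LINT \<omega>|M. G (S s \<omega>))"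
proof -
  have Sm [measurable]: "S (real i * \<delta>) \<in> borel_measurable M" "S (real i * \<delta> + s) \<in> borel_measurable M" for i
    using \<delta> s by auto
  have T [measurable]: "T \<in> M \<rightarrow>\<^sub>M count_space UNIV"
    unfolding T_def by (rule grid_stop_measurable[OF \<delta> U])
  have C: "0 \<le> C" using bound[of 0] by linarith
  have int1: "integrable M (\<lambda>\<omega>. of_bool (T \<omega> = i) * G (S (real i * \<delta> + s) \<omega> - S (real i * \<delta>) \<omega>))" for i
    by (rule integrable_const_bound[where B = C]) (use bound C in \<open>auto simp: of_bool_def\<close>)
  have int2: "integrable M (\<lambda>\<omega>. of_bool (T \<omega> = i) :: real)" for i
    by (rule integrable_const_bound[where B = 1]) auto
  have step: "(LINT \<omega>|M. of_bool (T \<omega> = i) * G (S (real i * \<delta> + s) \<omega> - S (real i * \<delta>) \<omega>)) =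
     (LINT \<omega>|M. of_bool (T \<omega> = i)) * (LINT \<omega>|M. G (S s \<omega>))" for i
  proof -
    define J where "J = (\<lambda>j. real j * \<delta>) ` {..i}"
    have J: "finite J" "J \<subseteq> {0..real i * \<delta>}" using \<delta> by (auto simp: J_def mult_right_mono)
    have iJ: "real j * \<delta> \<in> J" if "j \<le> i" for j using that by (auto simp: J_def)
    define A where "A = {v \<in> space (PiM J (\<lambda>_. borel)). (\<forall>j\<in>{..<i}. x + v (real j * \<delta>) \<notin> U) \<and>
      (i = m \<or> i < m \<and> x + v (real i * \<delta>) \<in> U)}"
    have [measurable]: "(\<lambda>v. v (real j * \<delta>)) \<in> borel_measurable (PiM J (\<lambda>_. borel :: (real^'d) measure))" if "j \<le> i" for j
      by (rule measurable_component_singleton) (rule iJ[OF that])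
    have A: "A \<in> sets (PiM J (\<lambda>_. borel))"
      unfolding A_def by measurable auto
    have TA: "indicator A (\<lambda>j\<in>J. X j \<omega>) = (of_bool (T \<omega> = i) :: real)" for \<omega>
      using iJ by (auto simp: A_def T_def grid_stop_eq_iff space_PiM indicator_def)
    from integral_X_past_S_increment[OF J _ s A G bound] \<delta>
    show ?thesis unfolding TA by simp
  qed
  have T_le: "T \<omega> \<in> {..m}" for \<omega> using grid_stop_le by (auto simp: T_def)
  have sum_T: "(\<Sum>i\<le>m. of_bool (T \<omega> = i) * f i) = f (T \<omega>)" for \<omega> and f :: "nat \<Rightarrow> real"
  proof -
    have "(\<Sum>i\<le>m. of_bool (T \<omega> = i) * f i) = (\<Sum>i\<le>m. if T \<omega> = i then f i else 0)"
      by (intro sum.cong) auto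
    also have "\<dots> = f (T \<omega>)" using T_le by simp
    finally show ?thesis .
  qed
  have "(LINT \<omega>|M. G (S (real (T \<omega>) * \<delta> + s) \<omega> - S (real (T \<omega>) * \<delta>) \<omega>)) =
    (LINT \<omega>|M. (\<Sum>i\<le>m. of_bool (T \<omega> = i) * G (S (real i * \<delta> + s) \<omega> - S (real i * \<delta>) \<omega>)))"
    by (subst sum_T) simp
  also have "\<dots> = (\<Sum>i\<le>m. (LINT \<omega>|M. of_bool (T \<omega> = i) * G (S (real i * \<delta> + s) \<omega> - S (real i * \<delta>) \<omega>)))"
    by (rule Bochner_Integration.integral_sum) (rule int1)
  also have "\<dots> = (\<Sum>i\<le>m. (LINT \<omega>|M. of_bool (T \<omega> = i))) * (LINT \<omega>|M. G (S s \<omega>))"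
    by (simp only: step sum_distrib_right)
  also have "(\<Sum>i\<le>m. (LINT \<omega>|M. of_bool (T \<omega> = i))) = (LINT \<omega>|M. (\<Sum>i\<le>m. of_bool (T \<omega> = i) * (1::real)))"
    using int2 by (subst Bochner_Integration.integral_sum) (auto simp del: sum_of_bool_eq)
  also have "\<dots> = 1"
    by (subst sum_T) (simp add: prob_space)
  finally show ?thesis by simp
qed

section \<open>Stopping times as limits of grid times\<close>

lemma right_cont_shift:
  assumes "\<omega> \<in> space M" "0 \<le> t" "r \<longlonglongrightarrow> t" "\<And>n. t \<le> r n"
  shows "(\<lambda>n. S (r n) \<omega>) \<longlonglongrightarrow> S t \<omega>" "(\<lambda>n. X (r n) \<omega>) \<longlonglongrightarrow> X t \<omega>"
  using tendsto_right_cont_seq[OF S_right_cont[OF assms(1,2)] assms(3,4)]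
    tendsto_right_cont_seq[OF X_right_cont[OF assms(1,2)] assms(3,4)] by auto

definition stop_time :: "real ^ 'd \<Rightarrow> (real ^ 'd) set \<Rightarrow> nat \<Rightarrow> 'w \<Rightarrow> real" where
  "stop_time x U c \<omega> = capped_hit (\<lambda>t. x + X t \<omega>) U (real c)"

definition grid_time :: "real ^ 'd \<Rightarrow> (real ^ 'd) set \<Rightarrow> nat \<Rightarrow> nat \<Rightarrow> 'w \<Rightarrow> real" where
  "grid_time x U c N \<omega> = real (grid_stop (\<lambda>i. x + X (real i * (1 / 2 ^ N)) \<omega>) U (c * 2 ^ N)) * (1 / 2 ^ N)"

lemma stop_time_nonneg: "0 \<le> stop_time x U c \<omega>"
  unfolding stop_time_def by (rule capped_hit_nonneg) simp

lemma grid_time_tendsto: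
  assumes "\<omega> \<in> space M" "open U"
  shows "stop_time x U c \<omega> \<le> grid_time x U c N \<omega>"
    "(\<lambda>N. grid_time x U c N \<omega>) \<longlonglongrightarrow> stop_time x U c \<omega>"
proof -
  have "((\<lambda>t. x + X t \<omega>) \<longlongrightarrow> x + X t \<omega>) (at_right t)" if "0 \<le> t" for t
    by (intro tendsto_intros X_right_cont assms that)
  from grid_stop_tendsto_capped_hit[OF this assms(2), where c = c]
  show "stop_time x U c \<omega> \<le> grid_time x U c N \<omega>"
    "(\<lambda>N. grid_time x U c N \<omega>) \<longlonglongrightarrow> stop_time x U c \<omega>"
    by (simp_all add: stop_time_def grid_time_def)
qed

lemma S_stop_time_tendsto:
  assumes \<omega>: "\<omega> \<in> space M" and "open U" and "0 \<le> s"
  shows "(\<lambda>N. S (grid_time x U c N \<omega> + s) \<omega>) \<longlonglongrightarrow> S (stop_time x U c \<omega> + s) \<omega>"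
  using grid_time_tendsto[OF \<omega> \<open>open U\<close>, of x c] stop_time_nonneg[of x U c \<omega>] \<open>0 \<le> s\<close>
  by (intro right_cont_shift[OF \<omega>] tendsto_add) auto

lemma X_stop_time_tendsto:
  assumes \<omega>: "\<omega> \<in> space M" and "open U"
  shows "(\<lambda>N. X (grid_time x U c N \<omega>) \<omega>) \<longlonglongrightarrow> X (stop_time x U c \<omega>) \<omega>"
  using grid_time_tendsto[OF \<omega> \<open>open U\<close>, of x c] stop_time_nonneg[of x U c \<omega>]
  by (intro right_cont_shift[OF \<omega>]) auto

lemma grid_time_measurable:
  assumes [measurable]: "U \<in> sets borel" and s: "0 \<le> s"
  shows "(\<lambda>\<omega>. S (grid_time x U c N \<omega> + s) \<omega>) \<in> borel_measurable M"
    "(\<lambda>\<omega>. X (grid_time x U c N \<omega>) \<omega>) \<in> borel_measurable M"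
  unfolding grid_time_def
  by (rule stopped_measurable[where Y = "\<lambda>t. S (t + s)"] stopped_measurable[where Y = X]; use s in simp)+

lemma stop_time_measurable:
  assumes "open U" and "0 \<le> s"
  shows "(\<lambda>\<omega>. S (stop_time x U c \<omega> + s) \<omega>) \<in> borel_measurable M"
    "(\<lambda>\<omega>. X (stop_time x U c \<omega>) \<omega>) \<in> borel_measurable M"
proof -
  have U: "U \<in> sets borel" using \<open>open U\<close> by simp
  show "(\<lambda>\<omega>. S (stop_time x U c \<omega> + s) \<omega>) \<in> borel_measurable M"
    by (rule borel_measurable_LIMSEQ_metric[OF _ S_stop_time_tendsto])
      (use grid_time_measurable[OF U] assms in auto)
  show "(\<lambda>\<omega>. X (stop_time x U c \<omega>) \<omega>) \<in> borel_measurable M"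
    by (rule borel_measurable_LIMSEQ_metric[OF _ X_stop_time_tendsto])
      (use grid_time_measurable[OF U] assms in auto)
qed

text \<open>Grid times approach the stopping time from the right, so right-continuity of
  \<open>S\<close> and dominated convergence carry the grid statement over.\<close>

lemma integral_stop_time_S:
  assumes U: "open U" and s: "0 \<le> s"
  shows "(LINT \<omega>|M. min 1 (S (stop_time x U c \<omega> + s) \<omega> - S (stop_time x U c \<omega>) \<omega>)) = (LINT \<omega>|M. min 1 (S s \<omega>))"
proof -
  \<comment> \<open>The clamp from below makes the function bounded on the whole line; on increments
    of \<open>S\<close>, which are nonnegative, it changes nothing.\<close>
  let ?G = "\<lambda>v::real. max 0 (min 1 v)"
  have Ub: "U \<in> sets borel" using U by simp
  have "(\<lambda>N. LINT \<omega>|M. ?G (S (grid_time x U c N \<omega> + s) \<omega> - S (grid_time x U c N \<omega>) \<omega>)) \<longlonglongrightarrow>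
     (LINT \<omega>|M. ?G (S (stop_time x U c \<omega> + s) \<omega> - S (stop_time x U c \<omega>) \<omega>))"
  proof (rule integral_dominated_convergence[where w = "\<lambda>_. 1"])
    show "(\<lambda>\<omega>. ?G (S (stop_time x U c \<omega> + s) \<omega> - S (stop_time x U c \<omega>) \<omega>)) \<in> borel_measurable M"
      using stop_time_measurable(1)[OF U s, of x c] stop_time_measurable(1)[OF U order_refl, of x c] by simp
    show "(\<lambda>\<omega>. ?G (S (grid_time x U c N \<omega> + s) \<omega> - S (grid_time x U c N \<omega>) \<omega>)) \<in> borel_measurable M" for N
      using grid_time_measurable(1)[OF Ub s, of x c N] grid_time_measurable(1)[OF Ub order_refl, of x c N] by simp
    show "AE \<omega> in M. (\<lambda>N. ?G (S (grid_time x U c N \<omega> + s) \<omega> - S (grid_time x U c N \<omega>) \<omega>)) \<longlonglongrightarrow>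
       ?G (S (stop_time x U c \<omega> + s) \<omega> - S (stop_time x U c \<omega>) \<omega>)"
    proof (rule AE_I2)
      fix \<omega> assume \<omega>: "\<omega> \<in> space M"
      show "(\<lambda>N. ?G (S (grid_time x U c N \<omega> + s) \<omega> - S (grid_time x U c N \<omega>) \<omega>)) \<longlonglongrightarrow>
       ?G (S (stop_time x U c \<omega> + s) \<omega> - S (stop_time x U c \<omega>) \<omega>)"
        using S_stop_time_tendsto[OF \<omega> U s, of x c] S_stop_time_tendsto[OF \<omega> U order_refl, of x c]
        by (intro tendsto_intros) auto
    qed
  qed auto
  moreover have "(LINT \<omega>|M. ?G (S (grid_time x U c N \<omega> + s) \<omega> - S (grid_time x U c N \<omega>) \<omega>)) = (LINT \<omega>|M. ?G (S s \<omega>))" for N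
    unfolding grid_time_def by (rule integral_grid_stop_S[where C = 1]) (use s U in auto)
  ultimately have "(LINT \<omega>|M. ?G (S (stop_time x U c \<omega> + s) \<omega> - S (stop_time x U c \<omega>) \<omega>)) = (LINT \<omega>|M. ?G (S s \<omega>))"
    using LIMSEQ_unique[OF tendsto_const] by force
  moreover have "(LINT \<omega>|M. ?G (S (stop_time x U c \<omega> + s) \<omega> - S (stop_time x U c \<omega>) \<omega>)) =
      (LINT \<omega>|M. min 1 (S (stop_time x U c \<omega> + s) \<omega> - S (stop_time x U c \<omega>) \<omega>))"
  proof (rule Bochner_Integration.integral_cong[OF refl])
    fix \<omega> assume "\<omega> \<in> space M"
    then have "S (stop_time x U c \<omega>) \<omega> \<le> S (stop_time x U c \<omega> + s) \<omega>"
      by (rule S_mono) (use s stop_time_nonneg in auto)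
    then show "?G (S (stop_time x U c \<omega> + s) \<omega> - S (stop_time x U c \<omega>) \<omega>) =
      min 1 (S (stop_time x U c \<omega> + s) \<omega> - S (stop_time x U c \<omega>) \<omega>)" by simp
  qed
  moreover have "(LINT \<omega>|M. ?G (S s \<omega>)) = (LINT \<omega>|M. min 1 (S s \<omega>))"
    using S_nonneg s by (intro Bochner_Integration.integral_cong) auto
  ultimately show ?thesis by simp
qed

lemma S_small_time: "(\<lambda>k. LINT \<omega>|M. min 1 (S (1 / real (Suc k)) \<omega>)) \<longlonglongrightarrow> 0"
proof -
  have "(\<lambda>k. LINT \<omega>|M. min 1 (S (1 / real (Suc k)) \<omega>)) \<longlonglongrightarrow> (LINT \<omega>|M. (0::real))"
  proof (rule integral_dominated_convergence[where w = "\<lambda>_. 1"])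
    show "AE \<omega> in M. (\<lambda>k. min 1 (S (1 / real (Suc k)) \<omega>)) \<longlonglongrightarrow> 0"
    proof (rule AE_I2)
      fix \<omega> assume \<omega>: "\<omega> \<in> space M"
      have "(\<lambda>k. 1 / real (Suc k)) \<longlonglongrightarrow> 0" by real_asymp
      then have "(\<lambda>k. S (1 / real (Suc k)) \<omega>) \<longlonglongrightarrow> S 0 \<omega>"
        by (intro right_cont_shift[OF \<omega>]) auto
      then have "(\<lambda>k. min 1 (S (1 / real (Suc k)) \<omega>)) \<longlonglongrightarrow> min 1 (S 0 \<omega>)"
        by (intro tendsto_intros)
      then show "(\<lambda>k. min 1 (S (1 / real (Suc k)) \<omega>)) \<longlonglongrightarrow> 0" using \<omega> by simp
    qed
    show "AE \<omega> in M. norm (min 1 (S (1 / real (Suc k)) \<omega>)) \<le> 1" for k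
    proof (rule AE_I2)
      fix \<omega> assume "\<omega> \<in> space M"
      then have "0 \<le> S (1 / real (Suc k)) \<omega>" by (rule S_nonneg) simp
      then show "norm (min 1 (S (1 / real (Suc k)) \<omega>)) \<le> 1" by simp
    qed
  qed auto
  then show ?thesis by simp
qed

section \<open>Quasi-left-continuity and harmonic functions\<close>

lemma stop_time_mono:
  assumes "V \<subseteq> U" "c \<le> d"
  shows "stop_time x U c \<omega> \<le> stop_time x V d \<omega>"
  unfolding stop_time_def by (rule capped_hit_mono) (use assms in auto)

text \<open>If \<open>S\<close> jumped at the limit \<open>\<sigma>\<close> of the stopping times \<open>s\<^sub>n\<close>, then for every \<open>e > 0\<close> the jump
  would be at most \<open>S (s\<^sub>n + e) - S s\<^sub>n\<close> for large \<open>n\<close>, but this is distributed as \<open>S e\<close>. Monotonicity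
  of \<open>S\<close> is why the argument is carried out for \<open>S\<close> instead of \<open>X\<close>.\<close>

lemma S_quasi_left_continuous:
  assumes U: "\<And>n. open (U n)" "\<And>n. U (Suc n) \<subseteq> U n"
  shows "AE \<omega> in M. \<forall>\<sigma>. (\<lambda>n. stop_time x (U n) n \<omega>) \<longlonglongrightarrow> \<sigma> \<longrightarrow>
    (\<lambda>n. S (stop_time x (U n) n \<omega>) \<omega>) \<longlonglongrightarrow> S \<sigma> \<omega>"
proof -
  let ?st = "\<lambda>n \<omega>. stop_time x (U n) n \<omega>"
  let ?u = "\<lambda>k n \<omega>. ennreal (min 1 (S (?st n \<omega> + 1 / real (Suc k)) \<omega> - S (?st n \<omega>) \<omega>))"
  have m [measurable]: "(\<lambda>\<omega>. S (?st n \<omega> + s) \<omega>) \<in> borel_measurable M" if "0 \<le> s" for n s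
    by (rule stop_time_measurable(1)[OF U(1) that])
  have m0 [measurable]: "(\<lambda>\<omega>. S (?st n \<omega>) \<omega>) \<in> borel_measurable M" for n
    using m[of 0 n] by simp
  define V where "V k \<omega> = liminf (\<lambda>n. ?u k n \<omega>)" for k \<omega>
  define Z where "Z \<omega> = (INF k. V k \<omega>)" for \<omega>
  have Vm [measurable]: "V k \<in> borel_measurable M" for k
    unfolding V_def by measurable
  have Zm [measurable]: "Z \<in> borel_measurable M"
    unfolding Z_def by measurable
  have diff: "0 \<le> S (?st n \<omega> + s) \<omega> - S (?st n \<omega>) \<omega>" if "\<omega> \<in> space M" "0 \<le> s" for n \<omega> s
    using S_mono[OF that(1), of "?st n \<omega>" "?st n \<omega> + s"] that(2) stop_time_nonneg[of x "U n" n \<omega>] by simp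
  have int_u: "(\<integral>\<^sup>+\<omega>. ?u k n \<omega> \<partial>M) = ennreal (LINT \<omega>|M. min 1 (S (1 / real (Suc k)) \<omega>))" for k n
  proof -
    have "(\<integral>\<^sup>+\<omega>. ?u k n \<omega> \<partial>M) = ennreal (LINT \<omega>|M. min 1 (S (?st n \<omega> + 1 / real (Suc k)) \<omega> - S (?st n \<omega>) \<omega>))"
    proof (rule nn_integral_eq_integral)
      show "integrable M (\<lambda>\<omega>. min 1 (S (?st n \<omega> + 1 / real (Suc k)) \<omega> - S (?st n \<omega>) \<omega>))"
      proof (rule integrable_const_bound[where B = 1])
        show "AE \<omega> in M. norm (min 1 (S (?st n \<omega> + 1 / real (Suc k)) \<omega> - S (?st n \<omega>) \<omega>)) \<le> 1"
          using diff[of _ "1 / real (Suc k)" n] by (intro AE_I2) (simp del: of_nat_Suc)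
        show "(\<lambda>\<omega>. min 1 (S (?st n \<omega> + 1 / real (Suc k)) \<omega> - S (?st n \<omega>) \<omega>)) \<in> borel_measurable M"
          using m[of "1 / real (Suc k)" n] by simp
      qed
      show "AE \<omega> in M. 0 \<le> min 1 (S (?st n \<omega> + 1 / real (Suc k)) \<omega> - S (?st n \<omega>) \<omega>)"
        using diff[of _ "1 / real (Suc k)" n] by (intro AE_I2) auto
    qed
    also have "(LINT \<omega>|M. min 1 (S (?st n \<omega> + 1 / real (Suc k)) \<omega> - S (?st n \<omega>) \<omega>)) =
      (LINT \<omega>|M. min 1 (S (1 / real (Suc k)) \<omega>))"
      by (rule integral_stop_time_S[OF U(1)]) simp
    finally show ?thesis .
  qed
  \<comment> \<open>\<open>Z\<close> will dominate the truncated jump of \<open>S\<close> at the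
    limit time. By Fatou its integral is at most the mean of \<open>S\<close> truncated at 1, at
    arbitrarily small times.\<close>
  have int_Z: "(\<integral>\<^sup>+\<omega>. Z \<omega> \<partial>M) \<le> ennreal (LINT \<omega>|M. min 1 (S (1 / real (Suc k)) \<omega>))" for k
  proof -
    have "(\<integral>\<^sup>+\<omega>. Z \<omega> \<partial>M) \<le> (\<integral>\<^sup>+\<omega>. V k \<omega> \<partial>M)"
      by (rule nn_integral_mono) (auto simp: Z_def intro: INF_lower)
    also have "\<dots> \<le> liminf (\<lambda>n. \<integral>\<^sup>+\<omega>. ?u k n \<omega> \<partial>M)"
      unfolding V_def
    proof (rule nn_integral_liminf)
      show "?u k n \<in> borel_measurable M" for n
        using m[of "1 / real (Suc k)" n] by simp
    qed
    also have "\<dots> = ennreal (LINT \<omega>|M. min 1 (S (1 / real (Suc k)) \<omega>))"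
      by (simp only: int_u Liminf_const trivial_limit_sequentially not_False_eq_True)
    finally show ?thesis .
  qed
  have "(\<integral>\<^sup>+\<omega>. Z \<omega> \<partial>M) \<le> 0"
  proof (rule LIMSEQ_le_const)
    show "(\<lambda>k. ennreal (LINT \<omega>|M. min 1 (S (1 / real (Suc k)) \<omega>))) \<longlonglongrightarrow> 0"
      using tendsto_ennrealI[OF S_small_time] by simp
  qed (use int_Z in auto)
  then have "AE \<omega> in M. Z \<omega> = 0"
    using nn_integral_0_iff_AE[OF Zm] by simp
  then show ?thesis
    using AE_space
  proof eventually_elim
    case (elim \<omega>)
    show "\<forall>\<sigma>. (\<lambda>n. ?st n \<omega>) \<longlonglongrightarrow> \<sigma> \<longrightarrow> (\<lambda>n. S (?st n \<omega>) \<omega>) \<longlonglongrightarrow> S \<sigma> \<omega>"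
    proof (intro allI impI)
      fix \<sigma> assume \<sigma>: "(\<lambda>n. ?st n \<omega>) \<longlonglongrightarrow> \<sigma>"
      have inc: "incseq (\<lambda>n. ?st n \<omega>)"
        by (rule incseq_SucI, rule stop_time_mono) (use U(2) in auto)
      have st_le: "?st n \<omega> \<le> \<sigma>" for n by (rule incseq_le[OF inc \<sigma>])
      have incS: "incseq (\<lambda>n. S (?st n \<omega>) \<omega>)"
        by (rule monoI, rule S_mono[OF elim(2)]) (use stop_time_nonneg monoD[OF inc] in auto)
      have le_\<sigma>: "S (?st n \<omega>) \<omega> \<le> S \<sigma> \<omega>" for n
        by (rule S_mono[OF elim(2)]) (use stop_time_nonneg st_le in auto)
      then obtain l where l: "(\<lambda>n. S (?st n \<omega>) \<omega>) \<longlonglongrightarrow> l" "\<And>n. S (?st n \<omega>) \<omega> \<le> l"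
        using incseq_convergent[OF incS, of "S \<sigma> \<omega>"] by blast
      have "l \<le> S \<sigma> \<omega>" by (rule LIMSEQ_le_const2[OF l(1)]) (use le_\<sigma> in auto)
      moreover have "\<not> l < S \<sigma> \<omega>"
      proof
        assume less: "l < S \<sigma> \<omega>"
        have "ennreal (min 1 (S \<sigma> \<omega> - l)) \<le> V k \<omega>" for k
          unfolding V_def
        proof (rule Liminf_bounded)
          have "eventually (\<lambda>n. \<sigma> - 1 / real (Suc k) < ?st n \<omega>) sequentially"
            by (rule order_tendstoD(1)[OF \<sigma>]) simp
          then show "eventually (\<lambda>n. ennreal (min 1 (S \<sigma> \<omega> - l)) \<le> ?u k n \<omega>) sequentially"
          proof eventually_elim
            fix n assume n: "\<sigma> - 1 / real (Suc k) < ?st n \<omega>"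
            have "0 \<le> \<sigma>" using st_le[of n] stop_time_nonneg[of x "U n" n \<omega>] by linarith
            then have "S \<sigma> \<omega> \<le> S (?st n \<omega> + 1 / real (Suc k)) \<omega>"
              by (rule S_mono[OF elim(2)]) (use n in linarith)
            then have "S \<sigma> \<omega> - l \<le> S (?st n \<omega> + 1 / real (Suc k)) \<omega> - S (?st n \<omega>) \<omega>"
              using l(2)[of n] by linarith
            then show "ennreal (min 1 (S \<sigma> \<omega> - l)) \<le> ?u k n \<omega>"
              by (intro ennreal_leI min.mono) auto
          qed
        qed
        then have "ennreal (min 1 (S \<sigma> \<omega> - l)) \<le> Z \<omega>"
          unfolding Z_def by (rule INF_greatest)
        then show False using elim(1) less by (auto simp: ennreal_eq_0_iff)
      qed
      ultimately show "(\<lambda>n. S (?st n \<omega>) \<omega>) \<longlonglongrightarrow> S \<sigma> \<omega>" using l(1) by simp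
    qed
  qed
qed

text \<open>The hitting times of the shrinking neighbourhoods increase to some \<sigma> no later
  than the exit. Quasi-left-continuity of \<open>S\<close> and continuity of \<open>W\<close> make
  the positions converge to the position at \<sigma>. Their distance to the complement tends to 0,
  so \<sigma> is the exit time. The index \<open>n\<close> is also the cap, which thereby disappears
  in the limit.\<close>

lemma exit_value_tendsto:
  fixes h :: "real ^ 'd \<Rightarrow> real"
  assumes \<omega>: "\<omega> \<in> space M" and E: "open E" and exits: "0 \<le> t" "x + X t \<omega> \<notin> E"
    and h: "continuous_on UNIV h"
  defines "U n \<equiv> {z. infdist z (- E) < 1 / real (Suc n)}"
  assumes qlc: "\<And>\<sigma>. (\<lambda>n. stop_time x (U n) n \<omega>) \<longlonglongrightarrow> \<sigma> \<Longrightarrow>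
    (\<lambda>n. S (stop_time x (U n) n \<omega>) \<omega>) \<longlonglongrightarrow> S \<sigma> \<omega>"
  shows "(\<lambda>n. h (x + X (stop_time x (U n) n \<omega>) \<omega>)) \<longlonglongrightarrow> exit_value h E (\<lambda>t. x + X t \<omega>)"
proof -
  let ?st = "\<lambda>n. stop_time x (U n) n \<omega>"
  have U_open: "open (U n)" for n
    unfolding U_def by (intro open_Collect_less continuous_intros)
  have E_U: "z \<in> U n" if "z \<notin> E" for z n
    using that by (simp add: U_def)
  have st_le: "?st n \<le> s" if "0 \<le> s" "x + X s \<omega> \<notin> E" for n s
    unfolding stop_time_def by (rule capped_hit_leI) (use that E_U in auto)
  have "incseq ?st"
  proof (rule incseq_SucI, rule stop_time_mono)
    fix n
    have "1 / real (Suc (Suc n)) \<le> 1 / real (Suc n)" by (simp add: field_simps)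
    then show "U (Suc n) \<subseteq> U n" by (auto simp: U_def simp del: of_nat_Suc)
  qed simp
  then obtain \<sigma> where \<sigma>: "?st \<longlonglongrightarrow> \<sigma>" "\<And>n. ?st n \<le> \<sigma>"
    using incseq_convergent[of ?st t] st_le[OF exits] by auto
  have \<sigma>0: "0 \<le> \<sigma>" using \<sigma>(2)[of 0] stop_time_nonneg[of x "U 0" 0 \<omega>] by linarith
  have "(\<lambda>n. W (S (?st n) \<omega>) \<omega>) \<longlonglongrightarrow> W (S \<sigma> \<omega>) \<omega>"
    by (rule W_tendsto[OF \<omega> qlc[OF \<sigma>(1)]]) (use S_nonneg[OF \<omega>] \<sigma>0 stop_time_nonneg in auto)
  then have X_lim: "(\<lambda>n. x + X (?st n) \<omega>) \<longlonglongrightarrow> x + X \<sigma> \<omega>"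
    unfolding X_def by (intro tendsto_intros)
  \<comment> \<open>For \<open>n\<close> beyond \<sigma> the cap is inactive, so \<open>U n\<close>
    is visited arbitrarily soon after the stopping time; right-continuity leaves the position within
    the stated distance.\<close>
  have dist_le: "infdist (x + X (?st n) \<omega>) (- E) \<le> 1 / real (Suc n)" if n: "\<sigma> < real n" for n
  proof (rule ccontr)
    assume "\<not> ?thesis"
    then have gt: "1 / real (Suc n) < infdist (x + X (?st n) \<omega>) (- E)" by simp
    have "((\<lambda>s. infdist (x + X s \<omega>) (- E)) \<longlongrightarrow> infdist (x + X (?st n) \<omega>) (- E)) (at_right (?st n))"
      by (intro tendsto_intros tendsto_infdist X_right_cont \<omega> stop_time_nonneg)
    from order_tendstoD(1)[OF this gt] obtain b where b: "?st n < b"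
      "\<And>s. ?st n < s \<Longrightarrow> s < b \<Longrightarrow> 1 / real (Suc n) < infdist (x + X s \<omega>) (- E)"
      unfolding eventually_at_right_field by auto
    have "?st n < real n" using \<sigma>(2)[of n] n by simp
    then obtain s where s: "?st n \<le> s" "s < ?st n + (b - ?st n)" "0 \<le> s" "x + X s \<omega> \<in> U n"
      unfolding stop_time_def using capped_hit_approx[of "\<lambda>t. x + X t \<omega>" "U n" "real n" "b - ?st n"] b(1)
      unfolding stop_time_def by auto
    then show False
      using b(2)[of s] gt by (cases "s = ?st n") (auto simp: U_def)
  qed
  have "infdist (x + X \<sigma> \<omega>) (- E) \<le> 0"
  proof (rule LIMSEQ_le)
    show "(\<lambda>n. infdist (x + X (?st n) \<omega>) (- E)) \<longlonglongrightarrow> infdist (x + X \<sigma> \<omega>) (- E)"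
      by (rule tendsto_infdist[OF X_lim])
    show "(\<lambda>n. 1 / real (Suc n)) \<longlonglongrightarrow> 0" by real_asymp
    obtain n0 where n0: "\<sigma> < real n0" using reals_Archimedean2 by blast
    show "\<exists>N. \<forall>n\<ge>N. infdist (x + X (?st n) \<omega>) (- E) \<le> 1 / real (Suc n)"
      using n0 by (intro exI[of _ n0]) (auto intro!: dist_le simp del: of_nat_Suc)
  qed
  then have "infdist (x + X \<sigma> \<omega>) (- E) = 0"
    using infdist_nonneg[of "x + X \<sigma> \<omega>" "- E"] by simp
  moreover have "closed (- E)" "- E \<noteq> {}" using E exits by auto
  ultimately have out: "x + X \<sigma> \<omega> \<notin> E"
    by (subst (asm) in_closed_iff_infdist_zero[symmetric]) auto
  have "exit_time E (\<lambda>t. x + X t \<omega>) = ereal \<sigma>"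
    unfolding exit_time_def
  proof (rule antisym)
    show "(INF s\<in>{s. 0 \<le> s \<and> x + X s \<omega> \<notin> E}. ereal s) \<le> ereal \<sigma>"
      by (rule INF_lower) (use out \<sigma>0 in simp)
    show "ereal \<sigma> \<le> (INF s\<in>{s. 0 \<le> s \<and> x + X s \<omega> \<notin> E}. ereal s)"
    proof (rule INF_greatest)
      fix s assume s: "s \<in> {s. 0 \<le> s \<and> x + X s \<omega> \<notin> E}"
      then have "\<sigma> \<le> s" by (intro LIMSEQ_le_const2[OF \<sigma>(1)]) (use st_le in auto)
      then show "ereal \<sigma> \<le> ereal s" by simp
    qed
  qed
  then have "exit_value h E (\<lambda>t. x + X t \<omega>) = h (x + X \<sigma> \<omega>)"
    by (simp add: exit_value_def)
  moreover have "(\<lambda>n. h (x + X (?st n) \<omega>)) \<longlonglongrightarrow> h (x + X \<sigma> \<omega>)"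
    using continuous_on_tendsto_compose[OF h X_lim] by simp
  ultimately show ?thesis by simp
qed

text \<open>Up to time \<open>c\<close> there are \<open>c * 2 ^ N\<close> grid steps, each with an
  error of at most \<open>e' / 2 ^ N\<close>. The total \<open>c * e'\<close> does not depend on
  \<open>N\<close>, so it survives the limit and can then be made arbitrarily small.\<close>

lemma integral_stop_time:
  fixes h :: "real ^ 'd \<Rightarrow> real"
  assumes U: "open U" and h: "continuous_on UNIV h" and bound: "\<And>z. \<bar>h z\<bar> \<le> C"
    and gen: "\<And>e. 0 < e \<Longrightarrow> \<exists>d>0. \<forall>t z. 0 < t \<and> t < d \<and> z \<notin> U \<longrightarrow> \<bar>(LINT \<omega>|M. h (z + X t \<omega>)) - h z\<bar> \<le> e * t"
  shows "(LINT \<omega>|M. h (x + X (stop_time x U c \<omega>) \<omega>)) = h x"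
proof -
  let ?I = "LINT \<omega>|M. h (x + X (stop_time x U c \<omega>) \<omega>)"
  have Ub: "U \<in> sets borel" using U by simp
  have hm [measurable]: "h \<in> borel_measurable borel" using h by (rule borel_measurable_continuous_onI)
  have lim: "(\<lambda>N. LINT \<omega>|M. h (x + X (grid_time x U c N \<omega>) \<omega>)) \<longlonglongrightarrow> ?I"
  proof (rule integral_dominated_convergence[where w = "\<lambda>_. C"])
    show "(\<lambda>\<omega>. h (x + X (stop_time x U c \<omega>) \<omega>)) \<in> borel_measurable M"
      using stop_time_measurable(2)[OF U order_refl, of x c] by simp
    show "(\<lambda>\<omega>. h (x + X (grid_time x U c N \<omega>) \<omega>)) \<in> borel_measurable M" for N
      using grid_time_measurable(2)[OF Ub order_refl, of x c N] by simp
    show "AE \<omega> in M. (\<lambda>N. h (x + X (grid_time x U c N \<omega>) \<omega>)) \<longlonglongrightarrow> h (x + X (stop_time x U c \<omega>) \<omega>)"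
      by (intro AE_I2 continuous_on_tendsto_compose[OF h] tendsto_add tendsto_const X_stop_time_tendsto[OF _ U]) auto
  qed (use bound in auto)
  have "\<bar>?I - h x\<bar> \<le> e" if e: "0 < e" for e
  proof -
    define e' where "e' = e / (real c + 1)"
    have e': "0 < e'" "real c * e' \<le> e" using e by (auto simp: e'_def field_simps)
    from gen[OF e'(1)] obtain d where d: "0 < d"
      "\<And>t z. 0 < t \<Longrightarrow> t < d \<Longrightarrow> z \<notin> U \<Longrightarrow> \<bar>(LINT \<omega>|M. h (z + X t \<omega>)) - h z\<bar> \<le> e' * t"
      by blast
    have "(\<lambda>N. 1 / 2 ^ N :: real) \<longlonglongrightarrow> 0" by real_asymp
    from order_tendstoD(2)[OF this d(1)] obtain N0 where N0: "\<And>N. N \<ge> N0 \<Longrightarrow> 1 / 2 ^ N < d"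
      unfolding eventually_sequentially by auto
    have "\<bar>(LINT \<omega>|M. h (x + X (grid_time x U c N \<omega>) \<omega>)) - h x\<bar> \<le> e" if N: "N \<ge> N0" for N
    proof -
      have "\<bar>(LINT \<omega>|M. h (x + X (grid_time x U c N \<omega>) \<omega>)) - h x\<bar> \<le> real (c * 2 ^ N) * (e' * (1 / 2 ^ N))"
        unfolding grid_time_def
      proof (rule integral_grid_stop[OF _ hm bound Ub])
        show "\<bar>(LINT \<omega>|M. h (z + X (1 / 2 ^ N) \<omega>)) - h z\<bar> \<le> e' * (1 / 2 ^ N)" if "z \<notin> U" for z
          by (rule d(2)) (use N0[OF N] that in auto)
      qed (use e' in auto)
      also have "\<dots> = real c * e'" by simp
      finally show ?thesis using e' by linarith
    qed
    then show ?thesis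
      by (intro LIMSEQ_le_const2[OF tendsto_rabs[OF tendsto_diff[OF lim tendsto_const]]]) auto
  qed
  then have "\<bar>?I - h x\<bar> \<le> 0" by (rule field_le_epsilon[of _ 0, simplified])
  then show ?thesis by simp
qed

text \<open>The complement of every neighbourhood \<open>U n\<close> lies in \<open>E\<close>, so
  the generator estimate on \<open>E\<close> makes \<open>h\<close> a martingale up to each
  approximating time; boundedness lets these times tend to the exit. \<open>exits\<close> excludes,
  up to a null set, the paths on which \<open>exit_value\<close> takes its default 0.\<close>

lemma harmonic_onI:
  fixes h :: "real ^ 'd \<Rightarrow> real"
  assumes h: "continuous_on UNIV h" and bound: "\<And>z. \<bar>h z\<bar> \<le> C"
    and gen: "\<And>E e. open E \<Longrightarrow> compact (closure E) \<Longrightarrow> closure E \<subseteq> D \<Longrightarrow> 0 < e \<Longrightarrow>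
      \<exists>d>0. \<forall>t z. 0 < t \<and> t < d \<and> z \<in> E \<longrightarrow> \<bar>(LINT \<omega>|M. h (z + X t \<omega>)) - h z\<bar> \<le> e * t"
    and exits: "\<And>E x. bounded E \<Longrightarrow> AE \<omega> in M. \<exists>t\<ge>0. x + X t \<omega> \<notin> E"
  shows "harmonic_on M X D h"
  unfolding harmonic_on_def
proof (intro conjI allI impI ballI)
  show "h \<in> borel_measurable borel" using h by (rule borel_measurable_continuous_onI)
next
  fix E x assume E: "open E \<and> compact (closure E) \<and> closure E \<subseteq> D" and x: "x \<in> E"
  have hm [measurable]: "h \<in> borel_measurable borel" using h by (rule borel_measurable_continuous_onI)
  define U where "U n = {z. infdist z (- E) < 1 / real (Suc n)}" for n
  let ?Y = "\<lambda>n \<omega>. h (x + X (stop_time x (U n) n \<omega>) \<omega>)"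
  let ?V = "\<lambda>\<omega>. exit_value h E (\<lambda>t. x + X t \<omega>)"
  have U_open: "open (U n)" for n
    unfolding U_def by (intro open_Collect_less continuous_intros)
  have U_Suc: "U (Suc n) \<subseteq> U n" for n
  proof -
    have "1 / real (Suc (Suc n)) \<le> 1 / real (Suc n)" by (simp add: field_simps)
    then show ?thesis by (auto simp: U_def simp del: of_nat_Suc)
  qed
  have Y_meas [measurable]: "?Y n \<in> borel_measurable M" for n
    using stop_time_measurable(2)[OF U_open order_refl, of x n n] by simp
  have bnd: "bounded E"
    using E compact_imp_bounded closure_subset bounded_subset by metis
  have lim: "AE \<omega> in M. (\<lambda>n. ?Y n \<omega>) \<longlonglongrightarrow> ?V \<omega>"
    using S_quasi_left_continuous[of U x, OF U_open U_Suc] exits[OF bnd, of x] AE_space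
  proof eventually_elim
    case (elim \<omega>)
    then obtain t where "0 \<le> t" "x + X t \<omega> \<notin> E" by auto
    from exit_value_tendsto[OF elim(3) _ this h, folded U_def] E elim(1)
    show ?case by auto
  qed
  have eq: "(LINT \<omega>|M. ?Y n \<omega>) = h x" for n
  proof (rule integral_stop_time[OF U_open h bound])
    fix e :: real assume e: "0 < e"
    have "z \<in> E" if "z \<notin> U n" for z
      using that by (rule contrapos_np) (simp add: U_def)
    then show "\<exists>d>0. \<forall>t z. 0 < t \<and> t < d \<and> z \<notin> U n \<longrightarrow> \<bar>(LINT \<omega>|M. h (z + X t \<omega>)) - h z\<bar> \<le> e * t"
      using gen[of E e] E e by blast
  qed
  \<comment> \<open>The exit value agrees with the measurable limit \<open>g\<close> only almost
    surely, hence is measurable for the completion.\<close>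
  have V_meas: "?V \<in> borel_measurable (completion M)"
  proof -
    define g where "g \<omega> = lim (\<lambda>n. ?Y n \<omega>)" for \<omega>
    have g: "g \<in> borel_measurable M" unfolding g_def by (rule borel_measurable_lim_metric) measurable
    have "AE \<omega> in M. ?V \<omega> = g \<omega>"
      using lim by eventually_elim (simp add: g_def limI)
    then have ae: "AE \<omega> in completion M. ?V \<omega> = g \<omega>" by (rule AE_completion)
    show ?thesis
    proof (rule measurableI)
      fix B :: "real set" assume B: "B \<in> sets borel"
      show "?V -` B \<inter> space (completion M) \<in> sets (completion M)"
      proof (rule completion.in_sets_AE)
        show "AE \<omega> in completion M. \<omega> \<in> g -` B \<inter> space M \<longleftrightarrow> \<omega> \<in> ?V -` B \<inter> space (completion M)"
          using ae by eventually_elim simp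
        show "g -` B \<inter> space M \<in> sets (completion M)"
          using measurable_sets[OF g B] by simp
      qed simp
    qed simp
  qed
  have Y_meas': "?Y n \<in> borel_measurable (completion M)" for n
    by (rule measurable_completion) measurable
  have lim': "AE \<omega> in completion M. (\<lambda>n. ?Y n \<omega>) \<longlonglongrightarrow> ?V \<omega>"
    using lim by (rule AE_completion)
  interpret c: prob_space "completion M" by (rule prob_space_completion)
  have dom: "integrable (completion M) (\<lambda>_. C)" "\<And>n. AE \<omega> in completion M. norm (?Y n \<omega>) \<le> C"
    using bound by auto
  show "integrable (completion M) ?V"
    by (rule integrable_dominated_convergence[OF V_meas Y_meas' dom(1) lim' dom(2)])
  have "(\<lambda>n. LINT \<omega>|completion M. ?Y n \<omega>) \<longlonglongrightarrow> (LINT \<omega>|completion M. ?V \<omega>)"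
    by (rule integral_dominated_convergence[OF V_meas Y_meas' dom(1) lim' dom(2)])
  moreover have "(LINT \<omega>|completion M. ?Y n \<omega>) = h x" for n
    using integral_completion[OF Y_meas] eq by simp
  ultimately show "h x = (LINT \<omega>|completion M. ?V \<omega>)"
    using LIMSEQ_unique[OF tendsto_const] by force
qed

end

section \<open>The resolvent of one coordinate\<close>

lemma normal_density_cos:
  assumes "0 < \<sigma>"
  shows "has_bochner_integral lborel (\<lambda>x. normal_density 0 \<sigma> x * cos (y * x)) (exp (- (\<sigma>\<^sup>2 * y\<^sup>2) / 2))"
proof -
  have int: "integrable lborel (\<lambda>x. normal_density 0 \<sigma> x * cos (y * x))"
    by (rule Bochner_Integration.integrable_bound[OF integrable_normal_density[OF assms, of 0]])
      (auto simp: abs_mult intro!: mult_left_le)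
  have std: "(LINT x|lborel. std_normal_density x * cos (t * x)) = exp (- t\<^sup>2 / 2)" for t
  proof -
    have "exp (- t\<^sup>2 / 2) = Re (char std_normal_distribution t)"
      by (simp only: char_std_normal_distribution Re_complex_of_real)
    also have "\<dots> = (LINT x|std_normal_distribution. Re (iexp (t * x)))"
      unfolding char_def
    proof (rule integral_Re[symmetric])
      interpret prob_space std_normal_distribution by (rule prob_space_normal_density) simp
      show "integrable std_normal_distribution (\<lambda>x. iexp (t * x))"
        by (rule integrable_const_bound[where B = 1]) auto
    qed
    also have "\<dots> = (LINT x|lborel. std_normal_density x * cos (t * x))"
      by (subst integral_density) (auto simp: Re_exp)
    finally show ?thesis by simp
  qed
  have "(LINT x|lborel. normal_density 0 \<sigma> x * cos (y * x)) =
    \<sigma> * (LINT x|lborel. normal_density 0 \<sigma> (\<sigma> * x) * cos (y * (\<sigma> * x)))"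
    using lborel_integral_real_affine[of \<sigma> "\<lambda>x. normal_density 0 \<sigma> x * cos (y * x)" 0] assms by simp
  also have "\<dots> = (LINT x|lborel. std_normal_density x * cos ((\<sigma> * y) * x))"
    unfolding Bochner_Integration.integral_mult_right_zero[symmetric]
    using assms by (intro Bochner_Integration.integral_cong)
      (auto simp: normal_density_def real_sqrt_mult power_mult_distrib field_simps)
  also have "\<dots> = exp (- (\<sigma>\<^sup>2 * y\<^sup>2) / 2)"
    by (simp add: std power_mult_distrib)
  finally show ?thesis
    using int by (simp add: has_bochner_integral_iff)
qed

text \<open>In the addition theorem for the cosine the sine part integrates to 0 by
  symmetry.\<close>

lemma normal_density_shifted_cos:
  assumes "0 < \<sigma>"
  shows "has_bochner_integral lborel (\<lambda>x. normal_density 0 \<sigma> x * cos (\<theta> * (y + x)))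
    (cos (\<theta> * y) * exp (- (\<sigma>\<^sup>2 * \<theta>\<^sup>2) / 2))"
proof -
  have int: "integrable lborel (\<lambda>x. normal_density 0 \<sigma> x * sin (\<theta> * x))"
    by (rule Bochner_Integration.integrable_bound[OF integrable_normal_density[OF assms, of 0]])
      (auto simp: abs_mult intro!: mult_left_le)
  have "(LINT x|lborel. normal_density 0 \<sigma> x * sin (\<theta> * x)) = - (LINT x|lborel. normal_density 0 \<sigma> x * sin (\<theta> * x))"
    using lborel_integral_real_affine[of "-1" "\<lambda>x. normal_density 0 \<sigma> x * sin (\<theta> * x)" 0]
    by (simp add: normal_density_def)
  then have "has_bochner_integral lborel (\<lambda>x. normal_density 0 \<sigma> x * sin (\<theta> * x)) 0"
    using int by (simp add: has_bochner_integral_iff)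
  from has_bochner_integral_diff[OF
      has_bochner_integral_mult_right[OF normal_density_cos[OF assms, of \<theta>], of "cos (\<theta> * y)"]
      has_bochner_integral_mult_right[OF this, of "sin (\<theta> * y)"]]
  show ?thesis
    by (simp add: cos_add algebra_simps)
qed

lemma gaussian_cos:
  assumes "0 < \<beta>"
  shows "has_bochner_integral lborel (\<lambda>\<theta>. exp (- (\<beta> * \<theta>\<^sup>2 / 2)) * cos (\<theta> * y)) (sqrt (2 * pi / \<beta>) * exp (- (y\<^sup>2 / (2 * \<beta>))))"
proof -
  from has_bochner_integral_mult_right[OF normal_density_cos[of "1 / sqrt \<beta>" y], of "sqrt (2 * pi / \<beta>)"]
  have "has_bochner_integral lborel (\<lambda>x. sqrt (2 * pi / \<beta>) * (normal_density 0 (1 / sqrt \<beta>) x * cos (y * x)))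
     (sqrt (2 * pi / \<beta>) * exp (- ((1 / sqrt \<beta>)\<^sup>2 * y\<^sup>2) / 2))"
    using assms by simp
  also have "(\<lambda>x. sqrt (2 * pi / \<beta>) * (normal_density 0 (1 / sqrt \<beta>) x * cos (y * x))) =
      (\<lambda>\<theta>. exp (- (\<beta> * \<theta>\<^sup>2 / 2)) * cos (\<theta> * y))"
    using assms by (simp add: normal_density_def power_divide mult_ac)
  finally show ?thesis using assms by (simp add: power_divide mult_ac)
qed

lemma gaussian_second_moment:
  assumes "0 < \<beta>"
  shows "has_bochner_integral lborel (\<lambda>\<theta>. exp (- (\<beta> * \<theta>\<^sup>2 / 2)) * \<theta>\<^sup>2) (sqrt (2 * pi / \<beta>) / \<beta>)"
proof -
  from has_bochner_integral_mult_right[OF normal_moment_even[of "1 / sqrt \<beta>" 0 1], of "sqrt (2 * pi / \<beta>)"]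
  have "has_bochner_integral lborel (\<lambda>x. sqrt (2 * pi / \<beta>) * (normal_density 0 (1 / sqrt \<beta>) x * x\<^sup>2))
     (sqrt (2 * pi / \<beta>) * (1 / \<beta>))"
    using assms by (simp add: power_divide fact_numeral)
  also have "(\<lambda>x. sqrt (2 * pi / \<beta>) * (normal_density 0 (1 / sqrt \<beta>) x * x\<^sup>2)) =
      (\<lambda>\<theta>. exp (- (\<beta> * \<theta>\<^sup>2 / 2)) * \<theta>\<^sup>2)"
    using assms by (simp add: normal_density_def power_divide mult_ac)
  finally show ?thesis by simp
qed

lemma integral_lborel_prod:
  fixes f :: "'a::euclidean_space \<Rightarrow> real \<Rightarrow> real"
  assumes f: "\<And>b. b \<in> Basis \<Longrightarrow> integrable lborel (f b)"
  shows "(LINT x|lborel. (\<Prod>b\<in>Basis. f b (x \<bullet> b))) = (\<Prod>b\<in>Basis. (LINT x|lborel. f b x))"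
proof -
  interpret product_sigma_finite "\<lambda>_::'a. lborel :: real measure" ..
  have [measurable]: "\<And>b. b \<in> Basis \<Longrightarrow> f b \<in> borel_measurable borel"
    using borel_measurable_integrable[OF f] by simp
  have "(LINT x|lborel. (\<Prod>b\<in>Basis. f b (x \<bullet> b))) =
    (LINT v|Pi\<^sub>M Basis (\<lambda>_. lborel). (\<Prod>b\<in>Basis. f b ((\<Sum>c\<in>Basis. v c *\<^sub>R c) \<bullet> b)))"
    by (subst lborel_eq, subst integral_distr) auto
  also have "\<dots> = (LINT v|Pi\<^sub>M Basis (\<lambda>_. lborel). (\<Prod>b\<in>Basis. f b (v b)))"
    by (intro Bochner_Integration.integral_cong prod.cong) auto
  also have "\<dots> = (\<Prod>b\<in>Basis. (LINT x|lborel. f b x))"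
    by (rule product_integral_prod) (use f in auto)
  finally show ?thesis .
qed

lemma borel_measurable_vec_nth [measurable (raw)]:
  fixes f :: "'a \<Rightarrow> real ^ 'd"
  assumes "f \<in> borel_measurable N"
  shows "(\<lambda>x. f x $ k) \<in> borel_measurable N"
  unfolding cart_eq_inner_axis using assms by measurable

lemma laplace_exponent_jump_measure:
  assumes "0 \<le> l"
  shows "(\<lambda>j. 1 - exp (- (l * jump_size j))) sums laplace_exponent 0 jump_measure l"
proof -
  have pos: "0 < jump_size j" for j by (simp add: jump_size_def)
  have le: "1 - exp (- (l * jump_size j)) \<le> l * (2 * (1 / 2) ^ j)" for j
  proof -
    have "1 - exp (- (l * jump_size j)) \<le> l * jump_size j"
      using exp_ge_add_one_self[of "- (l * jump_size j)"] by linarith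
    also have "\<dots> \<le> l * (2 * (1 / 2) ^ j)"
      by (rule mult_left_mono[OF jump_size_le assms])
    finally show ?thesis .
  qed
  have summ: "summable (\<lambda>j. norm (1 - exp (- (l * jump_size j))))"
  proof (rule summable_comparison_test)
    show "\<exists>N. \<forall>n\<ge>N. norm (norm (1 - exp (- (l * jump_size n)))) \<le> l * (2 * (1 / 2) ^ n)"
      using le assms pos by (auto simp: less_imp_le)
    show "summable (\<lambda>n. l * (2 * (1 / 2) ^ n))"
      by (intro summable_mult summable_geometric) simp
  qed
  have "laplace_exponent 0 jump_measure l = (LINT x|jump_measure. indicator {0<..} x *\<^sub>R (1 - exp (- l * x)))"
    by (simp add: laplace_exponent_def set_lebesgue_integral_def)
  also have "\<dots> = (LINT j|count_space UNIV. 1 - exp (- (l * jump_size j)))"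
    unfolding jump_measure_altdef
    by (subst integral_distr) (auto simp: integral_density jump_rate_def pos density_1)
  finally show ?thesis
    using sums_integral_count_space_nat[of "\<lambda>j. 1 - exp (- (l * jump_size j))"] summ
    by (simp add: integrable_count_space_nat_iff)
qed

section \<open>Characteristic functions of the coordinates\<close>

context subordinated_bm begin

lemma integral_cos_W:
  assumes "0 \<le> u"
  shows "(LINT \<omega>|M. cos (\<theta> * (y + W u \<omega> $ k))) = cos (\<theta> * y) * exp (- (u * \<theta>\<^sup>2) / 2)"
proof (cases "u = 0")
  case True
  have "(LINT \<omega>|M. cos (\<theta> * (y + W 0 \<omega> $ k))) = (LINT \<omega>|M. cos (\<theta> * y))"
    by (intro Bochner_Integration.integral_cong) auto
  then show ?thesis using True by (simp add: prob_space)
next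
  case False
  with assms have u: "0 < u" by simp
  have "\<forall>s t. 0 \<le> s \<and> s < t \<longrightarrow> distributed M lborel (\<lambda>\<omega>. W t \<omega> - W s \<omega>)
      (\<lambda>x. ennreal (\<Prod>i\<in>UNIV. normal_density 0 (sqrt (t - s)) (x $ i)))"
    using bm by (simp add: standard_brownian_motion_def)
  from this[rule_format, of 0 u]
  have d: "distributed M lborel (\<lambda>\<omega>. W u \<omega> - W 0 \<omega>)
      (\<lambda>x. ennreal (\<Prod>i\<in>UNIV. normal_density 0 (sqrt u) (x $ i)))"
    using u by simp
  \<comment> \<open>The joint density is a product, and only the factor in direction
    \<open>k\<close> carries the cosine.\<close>
  define F where "F b x = normal_density 0 (sqrt u) x * (if b = (axis k 1 :: real ^ 'd) then cos (\<theta> * (y + x)) else 1)" for b x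
  have F1: "has_bochner_integral lborel (F b) (if b = axis k 1 then cos (\<theta> * y) * exp (- (u * \<theta>\<^sup>2) / 2) else 1)" for b
    using normal_density_shifted_cos[of "sqrt u" \<theta> y] u integrable_normal_density[of "sqrt u" 0] integral_normal_density[of "sqrt u" 0]
    by (auto simp: F_def[abs_def] has_bochner_integral_iff)
  have prod_Basis: "(\<Prod>b\<in>Basis. g b) = (\<Prod>i\<in>UNIV. g (axis i 1))" for g :: "real ^ 'd \<Rightarrow> real"
  proof -
    have "(Basis :: (real ^ 'd) set) = range (\<lambda>i. axis i 1)"
      by (auto simp: Basis_vec_def)
    then have "(\<Prod>b\<in>Basis. g b) = (\<Prod>b\<in>range (\<lambda>i. axis i 1). g b)" by simp
    also have "\<dots> = (\<Prod>i\<in>UNIV. g (axis i 1))"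
      by (subst prod.reindex) (auto simp: inj_on_def axis_eq_axis)
    finally show ?thesis .
  qed
  have "(LINT \<omega>|M. cos (\<theta> * (y + W u \<omega> $ k))) = (LINT \<omega>|M. cos (\<theta> * (y + (W u \<omega> - W 0 \<omega>) $ k)))"
    by (intro Bochner_Integration.integral_cong) auto
  also have "\<dots> = (LINT x|lborel. (\<Prod>i\<in>UNIV. normal_density 0 (sqrt u) (x $ i)) * cos (\<theta> * (y + x $ k)))"
    by (rule distributed_integral[OF d, symmetric]) (auto intro!: prod_nonneg)
  also have "\<dots> = (LINT x|lborel. (\<Prod>b\<in>Basis. F b (x \<bullet> b)))"
  proof (rule Bochner_Integration.integral_cong[OF refl])
    fix x :: "real ^ 'd"
    have "(\<Prod>b\<in>Basis. F b (x \<bullet> b)) = (\<Prod>i\<in>UNIV. normal_density 0 (sqrt u) (x $ i) * (if i = k then cos (\<theta> * (y + x $ i)) else 1))"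
      unfolding prod_Basis by (intro prod.cong) (auto simp: F_def inner_axis axis_eq_axis)
    also have "\<dots> = (\<Prod>i\<in>UNIV. normal_density 0 (sqrt u) (x $ i)) * cos (\<theta> * (y + x $ k))"
      by (simp add: prod.distrib)
    finally show "(\<Prod>i\<in>UNIV. normal_density 0 (sqrt u) (x $ i)) * cos (\<theta> * (y + x $ k)) = (\<Prod>b\<in>Basis. F b (x \<bullet> b))" by simp
  qed
  also have "\<dots> = (\<Prod>b\<in>Basis. (LINT x|lborel. F b x))"
    by (rule integral_lborel_prod) (use F1 in \<open>auto simp: has_bochner_integral_iff\<close>)
  also have "\<dots> = (\<Prod>b\<in>Basis. if b = (axis k 1 :: real ^ 'd) then cos (\<theta> * y) * exp (- (u * \<theta>\<^sup>2) / 2) else 1)"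
    by (simp only: F1[THEN has_bochner_integral_integral_eq])
  also have "\<dots> = cos (\<theta> * y) * exp (- (u * \<theta>\<^sup>2) / 2)"
    by (simp add: prod.delta')
  finally show ?thesis .
qed

text \<open>Given \<open>S\<close>, the coordinate is Gaussian with variance \<open>S t\<close>, so
  integrating over \<open>W\<close> leaves the Laplace transform of \<open>S t\<close> at
  \<open>\<theta>\<^sup>2 / 2\<close>.\<close>

lemma integral_cos_X:
  assumes t: "0 \<le> t"
  shows "(LINT \<omega>|M. cos (\<theta> * (y + X t \<omega> $ k))) = cos (\<theta> * y) * exp (- (t * laplace_exponent 0 jump_measure (\<theta>\<^sup>2 / 2)))"
proof -
  have [measurable]: "(\<lambda>\<sigma>. \<sigma> t) \<in> borel_measurable (PiM {0..} (\<lambda>_. borel))"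
    by (rule measurable_component_singleton) (use t in auto)
  have "(LINT \<omega>|M. cos (\<theta> * (y + X t \<omega> $ k))) = (LINT \<omega>|M. cos (\<theta> * (y + path_eval (RW \<omega>) (RS \<omega> t) $ k)))"
    using t by (intro Bochner_Integration.integral_cong) (auto simp: RS_def path_eval_RW S_nonneg X_def)
  also have "\<dots> = (LINT \<omega>'|M. LINT \<omega>|M. cos (\<theta> * (y + path_eval (RW \<omega>) (RS \<omega>' t) $ k)))"
  proof (rule decouple[where f = "\<lambda>w \<sigma>. cos (\<theta> * (y + path_eval w (\<sigma> t) $ k))" and C = 1])
    show "(\<lambda>(w, \<sigma>). cos (\<theta> * (y + path_eval w (\<sigma> t) $ k)))
      \<in> borel_measurable (PiM {0..} (\<lambda>_. borel) \<Otimes>\<^sub>M PiM {0..} (\<lambda>_. borel))"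
      unfolding split_beta' by measurable
  qed simp
  also have "\<dots> = (LINT \<omega>'|M. LINT \<omega>|M. cos (\<theta> * (y + W (S t \<omega>') \<omega> $ k)))"
    using t by (intro Bochner_Integration.integral_cong) (auto simp: RS_def path_eval_RW S_nonneg)
  also have "\<dots> = (LINT \<omega>'|M. cos (\<theta> * y) * exp (- (\<theta>\<^sup>2 / 2) * S t \<omega>'))"
    using t S_nonneg by (intro Bochner_Integration.integral_cong) (auto simp: integral_cos_W mult_ac)
  also have "\<dots> = cos (\<theta> * y) * exp (- t * laplace_exponent 0 jump_measure (\<theta>\<^sup>2 / 2))"
  proof -
    have "\<forall>t\<ge>0. \<forall>l\<ge>0. (LINT \<omega>|M. exp (- l * S t \<omega>)) = exp (- t * laplace_exponent 0 jump_measure l)"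
      using sub unfolding subordinator_def by blast
    from this[rule_format, OF t, of "\<theta>\<^sup>2 / 2"] show ?thesis by simp
  qed
  finally show ?thesis by simp
qed

end

lemma laplace_exponent_jump_measure_pos:
  assumes "0 < l"
  shows "0 < laplace_exponent 0 jump_measure l"
proof -
  have pos: "0 < 1 - exp (- (l * jump_size j))" for j
    using assms by (simp add: jump_size_def)
  show ?thesis
    using suminf_pos[OF sums_summable[OF laplace_exponent_jump_measure] pos]
      sums_unique[OF laplace_exponent_jump_measure] assms by simp
qed

lemma laplace_exponent_jump_measure_nonneg:
  assumes "0 \<le> l"
  shows "0 \<le> laplace_exponent 0 jump_measure l"
  using laplace_exponent_jump_measure_pos[of l] assms
  by (cases "l = 0") (auto simp: laplace_exponent_def)

lemma integral_exponential_density: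
  assumes "0 < l"
  shows "has_bochner_integral lborel (exponential_density l) 1"
proof -
  interpret prob_space "density lborel (exponential_density l)"
    by (rule prob_space_exponential_density[OF assms])
  have "integrable (density lborel (exponential_density l)) (\<lambda>_. 1 :: real)" by simp
  then have "integrable lborel (exponential_density l)"
    by (subst (asm) integrable_density) (use assms in \<open>auto simp: exponential_density_nonneg\<close>)
  moreover have "(LINT x|density lborel (exponential_density l). 1 :: real) = 1"
    using prob_space by simp
  then have "(LINT x|lborel. exponential_density l x) = 1"
    by (subst (asm) integral_density) (use assms in \<open>auto simp: exponential_density_nonneg\<close>)
  ultimately show ?thesis by (simp add: has_bochner_integral_iff)
qed

context subordinated_bm begin

lemma X_joint_measurable [measurable]:
  "(\<lambda>p. X (max 0 (fst p)) (snd p)) \<in> borel_measurable (borel \<Otimes>\<^sub>M M)"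
proof (rule borel_measurable_LIMSEQ_metric)
  fix n
  have [measurable]: "(\<lambda>p. X ((real i + 1) / 2 ^ n) (snd p)) \<in> borel_measurable (borel \<Otimes>\<^sub>M M)" for i
    by (rule measurable_compose[OF measurable_snd X_measurable]) simp
  show "(\<lambda>p. X (dyadic_above n (max 0 (fst p))) (snd p)) \<in> borel_measurable (borel \<Otimes>\<^sub>M M)"
    unfolding dyadic_above_def
    by (rule measurable_compose_countable[where g = "\<lambda>p. nat \<lfloor>2 ^ n * max 0 (fst p)\<rfloor>"]) measurable
next
  fix p :: "real \<times> 'w" assume "p \<in> space (borel \<Otimes>\<^sub>M M)"
  then have "snd p \<in> space M" by (auto simp: space_pair_measure)
  then show "(\<lambda>n. X (dyadic_above n (max 0 (fst p))) (snd p)) \<longlonglongrightarrow> X (max 0 (fst p)) (snd p)"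
    by (intro right_cont_shift dyadic_above_tendsto less_imp_le[OF dyadic_above(1)]) auto
qed

lemma X_joint_measurable' [measurable (raw)]:
  assumes [measurable]: "f \<in> borel_measurable N" "g \<in> N \<rightarrow>\<^sub>M M"
  shows "(\<lambda>x. X (max 0 (f x)) (g x)) \<in> borel_measurable N"
  using measurable_compose[OF measurable_Pair[OF assms] X_joint_measurable] by simp

text \<open>The exponent is recovered as minus the logarithm of the characteristic function of a
  coordinate at time 1, which depends measurably on its argument.\<close>

lemma laplace_exponent_measurable:
  "(\<lambda>z. laplace_exponent 0 jump_measure (z\<^sup>2 / 2)) \<in> borel_measurable borel"
proof -
  obtain k :: 'd where True by simp
  have "(\<lambda>z. laplace_exponent 0 jump_measure (z\<^sup>2 / 2)) = (\<lambda>z. - ln (LINT \<omega>|M. cos (z * (0 + X 1 \<omega> $ k))))"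
    by (subst integral_cos_X) (auto simp: fun_eq_iff)
  moreover have "(\<lambda>z. - ln (LINT \<omega>|M. cos (z * (0 + X 1 \<omega> $ k)))) \<in> borel_measurable borel"
    by measurable
  ultimately show ?thesis by simp
qed

text \<open>The indicator of \<open>[-R, R]\<close> is at most \<open>exp (1/2)\<close> times an
  unnormalised Gaussian of variance \<open>R\<^sup>2\<close>. By Fourier inversion the mean of that
  Gaussian at time \<open>n\<close> is an integral of cosines damped by
  \<open>exp (- n * \<phi> z)\<close>, which tends to 0 because the exponent is positive off 0. Thus
  one coordinate, watched at integer times, already leaves the interval almost surely.\<close>

lemma exits_bounded:
  assumes "bounded E"
  shows "AE \<omega> in M. \<exists>t\<ge>0. x + X t \<omega> \<notin> E"
proof -
  obtain R where R: "0 < R" "\<And>z. z \<in> E \<Longrightarrow> norm z \<le> R"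
    using assms unfolding bounded_pos by blast
  define \<sigma> where "\<sigma> = 1 / R"
  have \<sigma>: "0 < \<sigma>" using R by (simp add: \<sigma>_def)
  obtain k :: 'd where True by simp
  define \<phi> where "\<phi> z = laplace_exponent 0 jump_measure (z\<^sup>2 / 2)" for z
  have \<phi>m [measurable]: "\<phi> \<in> borel_measurable borel"
    unfolding \<phi>_def by (rule laplace_exponent_measurable)
  define N where "N = density lborel (normal_density 0 \<sigma>)"
  interpret N: prob_space N unfolding N_def by (rule prob_space_normal_density[OF \<sigma>])
  interpret NM: pair_prob_space M N ..
  have N_sets [measurable_cong]: "sets N = sets borel" by (simp add: N_def)
  define p where "p n = prob {\<omega>\<in>space M. norm ((x + X (real n) \<omega>) $ k) \<le> R}" for n :: nat
  have X_n [measurable]: "X (real n) \<in> borel_measurable M" for n by simp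
  have p_le: "p n \<le> exp (1/2) * (LINT z|N. cos (z * x $ k) * exp (- (real n * \<phi> z)))" for n
  proof -
    have gauss: "exp (- (\<sigma>\<^sup>2 * v\<^sup>2) / 2) = (LINT z|N. cos (z * v))" for v
      unfolding N_def using normal_density_cos[OF \<sigma>, of v]
      by (subst integral_density) (auto simp: has_bochner_integral_iff mult.commute)
    have "p n = (LINT \<omega>|M. indicator {\<omega>\<in>space M. norm ((x + X (real n) \<omega>) $ k) \<le> R} \<omega>)"
      unfolding p_def by (subst Bochner_Integration.integral_indicator) (auto simp: emeasure_eq_measure)
    also have "\<dots> \<le> (LINT \<omega>|M. exp (1/2) * exp (- (\<sigma>\<^sup>2 * (x $ k + X (real n) \<omega> $ k)\<^sup>2) / 2))"
    proof (rule integral_mono)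
      show "integrable M (\<lambda>\<omega>. exp (1/2) * exp (- (\<sigma>\<^sup>2 * (x $ k + X (real n) \<omega> $ k)\<^sup>2) / 2))"
        by (rule integrable_const_bound[where B = "exp (1/2)"]) auto
      show "indicator {\<omega>\<in>space M. norm ((x + X (real n) \<omega>) $ k) \<le> R} \<omega> \<le>
        exp (1/2) * exp (- (\<sigma>\<^sup>2 * (x $ k + X (real n) \<omega> $ k)\<^sup>2) / 2)" for \<omega>
      proof (cases "norm ((x + X (real n) \<omega>) $ k) \<le> R")
        case True
        define v where "v = x $ k + X (real n) \<omega> $ k"
        have "\<bar>\<sigma> * v\<bar> \<le> 1" using True R by (simp add: \<sigma>_def abs_mult v_def field_simps)
        then have "\<sigma>\<^sup>2 * v\<^sup>2 \<le> 1"
          by (simp add: power_mult_distrib[symmetric] abs_square_le_1)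
        then have "1 \<le> exp (1/2 + - (\<sigma>\<^sup>2 * v\<^sup>2) / 2)" by simp
        then show ?thesis unfolding exp_add v_def by (simp add: indicator_def)
      qed (simp add: indicator_def)
    qed (rule integrable_const_bound[where B = 1], auto)
    also have "\<dots> = exp (1/2) * (LINT \<omega>|M. LINT z|N. cos (z * (x $ k + X (real n) \<omega> $ k)))"
      by (simp only: gauss Bochner_Integration.integral_mult_right_zero)
    also have "(LINT \<omega>|M. LINT z|N. cos (z * (x $ k + X (real n) \<omega> $ k))) =
      (LINT z|N. LINT \<omega>|M. cos (z * (x $ k + X (real n) \<omega> $ k)))"
      by (rule NM.Fubini_integral[symmetric], rule NM.P.integrable_const_bound[where B = 1]) (auto simp: split_beta')
    also have "\<dots> = (LINT z|N. cos (z * x $ k) * exp (- (real n * \<phi> z)))"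
      by (simp add: integral_cos_X \<phi>_def)
    finally show ?thesis .
  qed
  have "(\<lambda>n. LINT z|N. cos (z * x $ k) * exp (- (real n * \<phi> z))) \<longlonglongrightarrow> (LINT z|N. (0::real))"
  proof (rule integral_dominated_convergence[where w = "\<lambda>_. 1"])
    have "AE z in lborel. z \<noteq> (0::real)" by (rule AE_lborel_singleton)
    then have "AE z in N. z \<noteq> 0"
      unfolding N_def by (subst AE_density) auto
    then show "AE z in N. (\<lambda>n. cos (z * x $ k) * exp (- (real n * \<phi> z))) \<longlonglongrightarrow> 0"
    proof eventually_elim
      fix z :: real assume "z \<noteq> 0"
      then have "0 < \<phi> z" unfolding \<phi>_def by (intro laplace_exponent_jump_measure_pos) simp
      then have "(\<lambda>n. exp (- (real n * \<phi> z))) \<longlonglongrightarrow> 0" by real_asymp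
      then show "(\<lambda>n. cos (z * x $ k) * exp (- (real n * \<phi> z))) \<longlonglongrightarrow> 0"
        by (rule tendsto_mult_right_zero)
    qed
    show "AE z in N. norm (cos (z * x $ k) * exp (- (real n * \<phi> z))) \<le> 1" for n
    proof (rule AE_I2)
      fix z
      have "0 \<le> \<phi> z" unfolding \<phi>_def by (rule laplace_exponent_jump_measure_nonneg) simp
      then show "norm (cos (z * x $ k) * exp (- (real n * \<phi> z))) \<le> 1"
        by (auto simp: abs_mult intro!: mult_le_one)
    qed
  qed auto
  from tendsto_mult_left[OF this, of "exp (1/2)"]
  have lim: "(\<lambda>n. exp (1/2) * (LINT z|N. cos (z * x $ k) * exp (- (real n * \<phi> z)))) \<longlonglongrightarrow> 0" by simp
  define A where "A = {\<omega>\<in>space M. \<forall>n::nat. norm ((x + X (real n) \<omega>) $ k) \<le> R}"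
  have A [measurable]: "A \<in> sets M" unfolding A_def by measurable
  have "prob A \<le> p n" for n
    unfolding p_def by (rule finite_measure_mono) (auto simp: A_def)
  then have "prob A \<le> 0"
    by (intro LIMSEQ_le_const[OF lim]) (use p_le order_trans in blast)
  then have "prob A = 0" using measure_nonneg[of M A] by linarith
  then have "AE \<omega> in M. \<omega> \<notin> A"
    using A by (simp add: AE_iff_measurable[OF _ refl] emeasure_eq_measure A_def)
  then show ?thesis
    using AE_space
  proof eventually_elim
    case (elim \<omega>)
    then obtain n :: nat where n: "\<not> norm ((x + X (real n) \<omega>) $ k) \<le> R" by (auto simp: A_def)
    have "x + X (real n) \<omega> \<notin> E"
      using n R(2)[of "x + X (real n) \<omega>"] component_le_norm_cart[of "x + X (real n) \<omega>" k] by fastforce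
    then show ?case by (intro exI[of _ "real n"]) auto
  qed
qed

section \<open>Semigroup of a coordinate and its value at an exponential time\<close>

definition semi :: "'d \<Rightarrow> real \<Rightarrow> (real \<Rightarrow> real) \<Rightarrow> real \<Rightarrow> real" where
  "semi k t f z = (LINT \<omega>|M. f (z + X t \<omega> $ k))"

text \<open>The law of a coordinate at an independent exponential time of rate \<open>l\<close>;
  integrating shifts of \<open>f\<close> against it is \<open>l\<close> times the
  \<open>l\<close>-resolvent. \<open>max 0\<close> turns the real sample into a legal time.\<close>

definition resolvent_measure :: "real \<Rightarrow> 'd \<Rightarrow> real measure" where
  "resolvent_measure l k =
    distr (density lborel (exponential_density l) \<Otimes>\<^sub>M M) borel (\<lambda>p. X (max 0 (fst p)) (snd p) $ k)"

lemma sets_resolvent_measure [simp, measurable_cong]: "sets (resolvent_measure l k) = sets borel"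
  and space_resolvent_measure [simp]: "space (resolvent_measure l k) = UNIV"
  by (simp_all add: resolvent_measure_def)

lemma
  assumes l: "0 < l"
  shows prob_space_resolvent_measure: "prob_space (resolvent_measure l k)"
    and integral_resolvent_measure: "f \<in> borel_measurable borel \<Longrightarrow> (\<And>z. \<bar>f z\<bar> \<le> C) \<Longrightarrow>
      (LINT v|resolvent_measure l k. f (x + v)) =
      (LINT t|lborel. exponential_density l t * semi k (max 0 t) f x)"
proof -
  define N where "N = density lborel (exponential_density l)"
  have N_sets [measurable_cong]: "sets N = sets borel" by (simp add: N_def)
  interpret N: prob_space N unfolding N_def by (rule prob_space_exponential_density[OF l])
  interpret NM: pair_prob_space N M ..
  have res: "resolvent_measure l k = distr (N \<Otimes>\<^sub>M M) borel (\<lambda>p. X (max 0 (fst p)) (snd p) $ k)"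
    by (simp add: resolvent_measure_def N_def)
  show "prob_space (resolvent_measure l k)"
    unfolding res by (rule NM.P.prob_space_distr) measurable
  assume f [measurable]: "f \<in> borel_measurable borel" and C: "\<And>z. \<bar>f z\<bar> \<le> C"
  have "(LINT v|resolvent_measure l k. f (x + v)) = (LINT p|(N \<Otimes>\<^sub>M M). f (x + X (max 0 (fst p)) (snd p) $ k))"
    unfolding res by (subst integral_distr) auto
  also have "\<dots> = (LINT t|N. LINT \<omega>|M. f (x + X (max 0 t) \<omega> $ k))"
  proof -
    have "integrable (N \<Otimes>\<^sub>M M) (\<lambda>p. f (x + X (max 0 (fst p)) (snd p) $ k))"
      by (rule NM.P.integrable_const_bound[where B = C]) (use C in auto)
    from NM.integral_fst'[OF this] show ?thesis by simp
  qed
  also have "\<dots> = (LINT t|lborel. exponential_density l t * semi k (max 0 t) f x)"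
    unfolding N_def semi_def
    by (subst integral_density) (use l in \<open>auto simp: exponential_density_nonneg\<close>)
  finally show "(LINT v|resolvent_measure l k. f (x + v)) =
      (LINT t|lborel. exponential_density l t * semi k (max 0 t) f x)" .
qed

lemma cos_resolvent_measure:
  assumes l: "0 < l"
  shows "(LINT v|resolvent_measure l k. cos (\<theta> * (x + v))) =
    cos (\<theta> * x) * (l / (l + laplace_exponent 0 jump_measure (\<theta>\<^sup>2 / 2)))"
proof -
  define q where "q = laplace_exponent 0 jump_measure (\<theta>\<^sup>2 / 2)"
  have q: "0 \<le> q" unfolding q_def by (rule laplace_exponent_jump_measure_nonneg) simp
  have "(LINT v|resolvent_measure l k. cos (\<theta> * (x + v))) =
    (LINT t|lborel. exponential_density l t * semi k (max 0 t) (\<lambda>z. cos (\<theta> * z)) x)"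
    by (rule integral_resolvent_measure[OF l, where C = 1]) auto
  also have "\<dots> = (LINT t|lborel. (cos (\<theta> * x) * (l / (l + q))) * exponential_density (l + q) t)"
  proof (rule Bochner_Integration.integral_cong[OF refl])
    fix t :: real
    have "semi k (max 0 t) (\<lambda>z. cos (\<theta> * z)) x = cos (\<theta> * x) * exp (- (max 0 t * q))"
      by (simp add: semi_def integral_cos_X q_def)
    then show "exponential_density l t * semi k (max 0 t) (\<lambda>z. cos (\<theta> * z)) x =
        (cos (\<theta> * x) * (l / (l + q))) * exponential_density (l + q) t"
    proof (cases "t < 0")
      case False
      have "exp (- t * (l + q)) = exp (- t * l) * exp (- (t * q))"
        by (simp add: exp_add[symmetric] algebra_simps)
      moreover have "l + q \<noteq> 0" using l q by linarith
      ultimately show ?thesis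
        using \<open>semi k (max 0 t) _ x = _\<close> False by (simp add: exponential_density_def)
    qed (simp add: exponential_density_def)
  qed
  also have "\<dots> = cos (\<theta> * x) * (l / (l + q))"
    using integral_exponential_density[of "l + q"] l q by (simp add: has_bochner_integral_iff)
  finally show ?thesis by (simp add: q_def)
qed

lemma semi_bound:
  assumes "\<And>z. \<bar>f z\<bar> \<le> C"
  shows "\<bar>semi k t f z\<bar> \<le> C"
proof -
  have C: "0 \<le> C" using assms[of 0] by linarith
  show ?thesis
  proof (cases "integrable M (\<lambda>\<omega>. f (z + X t \<omega> $ k))")
    case True
    have "\<bar>semi k t f z\<bar> \<le> (LINT \<omega>|M. \<bar>f (z + X t \<omega> $ k)\<bar>)"
      unfolding semi_def by (rule integral_abs_bound)
    also have "\<dots> \<le> C"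
      by (rule integral_le_const) (use True assms in auto)
    finally show ?thesis .
  qed (use C in \<open>simp add: semi_def not_integrable_integral_eq\<close>)
qed

lemma semi_measurable [measurable (raw)]:
  assumes [measurable]: "f \<in> borel_measurable borel" "g \<in> borel_measurable N" "z \<in> borel_measurable N"
  shows "(\<lambda>x. semi k (max 0 (g x)) f (z x)) \<in> borel_measurable N"
  unfolding semi_def by measurable

lemma semi_semigroup:
  assumes [measurable]: "f \<in> borel_measurable borel" and C: "\<And>z. \<bar>f z\<bar> \<le> C" and t: "0 \<le> t" "0 \<le> s"
  shows "(LINT \<omega>|M. semi k s f (z + X t \<omega> $ k)) = semi k (t + s) f z"
proof -
  define F where "F v d = f (z + v t $ k + d $ k)" for v :: "real \<Rightarrow> real ^ 'd" and d :: "real ^ 'd"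
  have [measurable]: "(\<lambda>v. v t) \<in> borel_measurable (PiM {t} (\<lambda>_. borel))"
    by (rule measurable_component_singleton) simp
  have "semi k (t + s) f z = (LINT \<omega>|M. F (\<lambda>j\<in>{t}. X j \<omega>) (X (t + s) \<omega> - X t \<omega>))"
    unfolding semi_def F_def by (intro Bochner_Integration.integral_cong) (auto simp: algebra_simps)
  also have "\<dots> = (LINT \<omega>|M. LINT \<omega>'|M. F (\<lambda>j\<in>{t}. X j \<omega>) (X s \<omega>'))"
  proof (rule integral_X_past_increment[where C = C])
    show "case_prod F \<in> borel_measurable (Pi\<^sub>M {t} (\<lambda>_. borel) \<Otimes>\<^sub>M borel)"
      unfolding F_def split_beta' by measurable
  qed (use t C in \<open>auto simp: F_def\<close>)
  also have "\<dots> = (LINT \<omega>|M. semi k s f (z + X t \<omega> $ k))"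
    by (simp add: F_def semi_def)
  finally show ?thesis by simp
qed

text \<open>Running the process for time \<open>t\<close> before the exponential time shifts the
  exponential density by \<open>t\<close>: this cuts off the part before \<open>t\<close> and, by
  lack of memory, multiplies the rest by \<open>exp (l * t)\<close>.\<close>

lemma semi_resolvent:
  assumes l: "0 < l" and t: "0 \<le> t"
    and f [measurable]: "f \<in> borel_measurable borel" and C: "\<And>z. \<bar>f z\<bar> \<le> C"
    and h: "\<And>x. h x = (LINT v|resolvent_measure l k. f (x + v))"
  shows "semi k t h z =
    exp (l * t) * (h z - (LINT r|lborel. indicator {..<t} r * (exponential_density l r * semi k (max 0 r) f z)))"
proof -
  define N where "N = density lborel (exponential_density l)"
  have N_sets [measurable_cong]: "sets N = sets borel" by (simp add: N_def)
  interpret N: prob_space N unfolding N_def by (rule prob_space_exponential_density[OF l])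
  interpret NM: pair_prob_space M N ..
  have X_t [measurable]: "X t \<in> borel_measurable M" using t by simp
  have int: "integrable lborel (\<lambda>r. exponential_density l r * semi k (max 0 r) f x)" for x
  proof (rule Bochner_Integration.integrable_bound)
    show "integrable lborel (\<lambda>r. C * exponential_density l r)"
      using integral_exponential_density[OF l] by (simp add: has_bochner_integral_iff)
    show "AE r in lborel. norm (exponential_density l r * semi k (max 0 r) f x) \<le> norm (C * exponential_density l r)"
    proof (rule AE_I2)
      fix r
      have "\<bar>semi k (max 0 r) f x\<bar> \<le> \<bar>C\<bar>"
        using semi_bound[where f = f and C = C and k = k and t = "max 0 r" and z = x] C by force
      then have "\<bar>exponential_density l r\<bar> * \<bar>semi k (max 0 r) f x\<bar> \<le> \<bar>exponential_density l r\<bar> * \<bar>C\<bar>"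
        by (rule mult_left_mono) simp
      then show "norm (exponential_density l r * semi k (max 0 r) f x) \<le> norm (C * exponential_density l r)"
        by (simp add: abs_mult mult.commute)
    qed
  qed measurable
  have h': "h x = (LINT r|N. semi k (max 0 r) f x)" for x
    unfolding h integral_resolvent_measure[OF l f C] N_def
    by (subst integral_density) (use l in \<open>auto simp: exponential_density_nonneg\<close>)
  have "semi k t h z = (LINT \<omega>|M. LINT r|N. semi k (max 0 r) f (z + X t \<omega> $ k))"
    by (simp add: semi_def h')
  also have "\<dots> = (LINT r|N. LINT \<omega>|M. semi k (max 0 r) f (z + X t \<omega> $ k))"
    by (rule NM.Fubini_integral[symmetric], rule NM.P.integrable_const_bound[where B = C])
      (auto simp: split_beta' intro!: semi_bound C)
  also have "\<dots> = (LINT r|N. semi k (max 0 (t + max 0 r)) f z)"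
    using t by (subst semi_semigroup[OF f C]) (auto simp: max_def)
  also have "\<dots> = (LINT r|lborel. exponential_density l r * semi k (max 0 (t + max 0 r)) f z)"
    unfolding N_def by (subst integral_density) (use l in \<open>auto simp: exponential_density_nonneg\<close>)
  also have "\<dots> = (LINT r|lborel. exponential_density l (- t + r) * semi k (max 0 (t + max 0 (- t + r))) f z)"
    using lborel_integral_real_affine[of 1 "\<lambda>r. exponential_density l r * semi k (max 0 (t + max 0 r)) f z" "- t"] by simp
  also have "\<dots> = (LINT r|lborel. exp (l * t) * (exponential_density l r * semi k (max 0 r) f z -
      indicator {..<t} r * (exponential_density l r * semi k (max 0 r) f z)))"
  proof (rule Bochner_Integration.integral_cong[OF refl])
    fix r
    have "exponential_density l (- t + r) = exp (l * t) * exponential_density l r" if "t \<le> r"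
      using that t by (auto simp: exponential_density_def exp_add[symmetric] algebra_simps)
    moreover have "t + max 0 (- t + r) = r" if "t \<le> r" using that t by simp
    moreover have "exponential_density l (- t + r) = 0" if "r < t" using that by (simp add: exponential_density_def)
    ultimately show "exponential_density l (- t + r) * semi k (max 0 (t + max 0 (- t + r))) f z =
      exp (l * t) * (exponential_density l r * semi k (max 0 r) f z -
      indicator {..<t} r * (exponential_density l r * semi k (max 0 r) f z))"
      by (cases "r < t") (auto simp: indicator_def)
  qed
  also have "\<dots> = exp (l * t) * ((LINT r|lborel. exponential_density l r * semi k (max 0 r) f z) -
      (LINT r|lborel. indicator {..<t} r * (exponential_density l r * semi k (max 0 r) f z)))"
  proof -
    have "integrable lborel (\<lambda>r. indicator {..<t} r * (exponential_density l r * semi k (max 0 r) f z))"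
      using integrable_mult_indicator[OF _ int[of z], of "{..<t}"] by simp
    then show ?thesis using int[of z] by simp
  qed
  finally show ?thesis
    unfolding h integral_resolvent_measure[OF l f C] .
qed

text \<open>The formula of \<open>semi_resolvent\<close> is compared with \<open>h z\<close> times
  its instance for the constant 1. What remains is an integral of \<open>h z - semi k r f z\<close>
  over \<open>r < t\<close>, of total weight \<open>exp (l * t) - 1\<close>.\<close>

lemma semi_resolvent_diff:
  assumes l: "0 < l" and t: "0 \<le> t"
    and f [measurable]: "f \<in> borel_measurable borel" and C: "\<And>z. \<bar>f z\<bar> \<le> C"
    and h: "\<And>x. h x = (LINT v|resolvent_measure l k. f (x + v))"
    and e: "\<And>r. 0 \<le> r \<Longrightarrow> r < t \<Longrightarrow> \<bar>h z - semi k r f z\<bar> \<le> e"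
  shows "\<bar>semi k t h z - h z\<bar> \<le> e * (exp (l * t) - 1)"
proof -
  let ?I = "\<lambda>g. LINT r|lborel. indicator {..<t} r * (exponential_density l r * g r)"
  have int1: "integrable lborel (\<lambda>r. indicator {..<t} r * (exponential_density l r * g r))"
    if g: "g \<in> borel_measurable borel" "\<And>r. \<bar>g r\<bar> \<le> B" for g B
  proof (rule Bochner_Integration.integrable_bound)
    show "integrable lborel (\<lambda>r. B * exponential_density l r)"
      using integral_exponential_density[OF l] by (simp add: has_bochner_integral_iff)
    show "AE r in lborel. norm (indicator {..<t} r * (exponential_density l r * g r)) \<le> norm (B * exponential_density l r)"
    proof (rule AE_I2)
      fix r
      have "\<bar>g r\<bar> \<le> \<bar>B\<bar>" using g(2)[of r] by linarith
      then show "norm (indicator {..<t} r * (exponential_density l r * g r)) \<le> norm (B * exponential_density l r)"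
        by (simp add: abs_mult indicator_def mult.commute mult_right_mono)
    qed
  qed (use g(1) in measurable)
  \<comment> \<open>The instance for the constant function 1, which is its own resolvent.\<close>
  have one: "1 = exp (l * t) * (1 - ?I (\<lambda>_. 1))"
  proof -
    interpret R: prob_space "resolvent_measure l k" by (rule prob_space_resolvent_measure[OF l])
    have "semi k t (\<lambda>_. 1) z = exp (l * t) * (1 - ?I (\<lambda>r. semi k (max 0 r) (\<lambda>_. 1) z))"
      by (rule semi_resolvent[OF l t, where C = 1]) (use R.prob_space in auto)
    then show ?thesis by (simp add: semi_def prob_space)
  qed
  have I1: "?I (\<lambda>_. h z) = h z * ?I (\<lambda>_. 1)" for z
    by (subst Bochner_Integration.integral_mult_right_zero[symmetric]) (simp add: mult_ac)
  have sb: "\<bar>semi k (max 0 r) f z\<bar> \<le> C" for r by (rule semi_bound[OF C])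
  have "semi k t h z - h z * (exp (l * t) * (1 - ?I (\<lambda>_. 1))) = exp (l * t) * (?I (\<lambda>_. h z) - ?I (\<lambda>r. semi k (max 0 r) f z))"
    unfolding I1 semi_resolvent[OF l t f C h] by (simp only: algebra_simps)
  then have "semi k t h z - h z = exp (l * t) * (?I (\<lambda>_. h z) - ?I (\<lambda>r. semi k (max 0 r) f z))"
    unfolding one[symmetric] by simp
  also have "?I (\<lambda>_. h z) - ?I (\<lambda>r. semi k (max 0 r) f z) = ?I (\<lambda>r. h z - semi k (max 0 r) f z)"
    by (subst Bochner_Integration.integral_diff[symmetric])
      (auto intro!: int1[of _ "\<bar>h z\<bar>"] int1[OF _ sb] simp: right_diff_distrib)
  finally have eq: "semi k t h z - h z = exp (l * t) * ?I (\<lambda>r. h z - semi k (max 0 r) f z)" by simp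
  have "\<bar>?I (\<lambda>r. h z - semi k (max 0 r) f z)\<bar> \<le> (LINT r|lborel. \<bar>indicator {..<t} r * (exponential_density l r * (h z - semi k (max 0 r) f z))\<bar>)"
    by (rule integral_abs_bound)
  also have "\<dots> \<le> ?I (\<lambda>_. e)"
  proof (rule integral_mono)
    have "\<bar>h z - semi k (max 0 r) f z\<bar> \<le> \<bar>h z\<bar> + C" for r using sb[of r] by linarith
    then show "integrable lborel (\<lambda>r. \<bar>indicator {..<t} r * (exponential_density l r * (h z - semi k (max 0 r) f z))\<bar>)"
      by (intro integrable_abs int1) auto
    show "integrable lborel (\<lambda>r. indicator {..<t} r * (exponential_density l r * e))"
      by (rule int1[of _ "\<bar>e\<bar>"]) auto
    show "\<bar>indicator {..<t} r * (exponential_density l r * (h z - semi k (max 0 r) f z))\<bar> \<le>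
        indicator {..<t} r * (exponential_density l r * e)" for r
    proof (cases "0 \<le> r \<and> r < t")
      case True
      then show ?thesis using e[of r] l
        by (auto simp: abs_mult indicator_def exponential_density_def max_def intro!: mult_left_mono)
    qed (auto simp: indicator_def exponential_density_def)
  qed
  also have "\<dots> = e * ?I (\<lambda>_. 1)"
    by (subst Bochner_Integration.integral_mult_right_zero[symmetric]) (simp add: mult_ac)
  finally have "\<bar>semi k t h z - h z\<bar> \<le> exp (l * t) * (e * ?I (\<lambda>_. 1))"
    unfolding eq by (simp add: abs_mult)
  also have "\<dots> = e * (exp (l * t) - 1)"
  proof -
    have "exp (l * t) * ?I (\<lambda>_. 1) = exp (l * t) - 1"
      using one by (simp only: right_diff_distrib mult_1_right)
    then show ?thesis by (simp only: mult.left_commute[of "exp (l * t)"])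
  qed
  finally show ?thesis .
qed

lemma X_small_time:
  assumes "0 < \<epsilon>" "0 < e"
  shows "\<exists>d>0. \<forall>r. 0 \<le> r \<and> r < d \<longrightarrow> prob {\<omega>\<in>space M. \<epsilon> \<le> \<bar>X r \<omega> $ k\<bar>} < e"
proof -
  define A where "A r = {\<omega>\<in>space M. \<epsilon> \<le> \<bar>X (max 0 r) \<omega> $ k\<bar>}" for r
  have A [measurable]: "A r \<in> sets M" for r unfolding A_def by measurable
  have "((\<lambda>r. LINT \<omega>|M. indicator (A r) \<omega> :: real) \<longlongrightarrow> (LINT \<omega>|M. (0::real))) (at_right 0)"
  proof (rule tendsto_at_right_sequentially[of 0 1], simp, rule integral_dominated_convergence[where w = "\<lambda>_. 1"])
    fix r :: "nat \<Rightarrow> real" assume r: "\<And>n. 0 < r n" "r \<longlonglongrightarrow> 0"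
    then have r': "filterlim r (at_right 0) sequentially"
      by (auto simp: filterlim_at intro!: always_eventually less_imp_neq[symmetric])
    show "AE \<omega> in M. (\<lambda>n. indicator (A (r n)) \<omega> :: real) \<longlonglongrightarrow> 0"
    proof (rule AE_I2)
      fix \<omega> assume \<omega>: "\<omega> \<in> space M"
      have "((\<lambda>r. \<bar>X r \<omega> $ k\<bar>) \<longlongrightarrow> \<bar>X 0 \<omega> $ k\<bar>) (at_right 0)"
        by (intro tendsto_intros X_right_cont \<omega>) simp
      then have "eventually (\<lambda>r. \<bar>X r \<omega> $ k\<bar> < \<epsilon>) (at_right 0)"
        using assms \<omega> by (intro order_tendstoD(2)) auto
      then have "eventually (\<lambda>r. indicator (A r) \<omega> = (0::real)) (at_right 0)"
        using eventually_at_right_less[of "0::real"]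
        by eventually_elim (auto simp: A_def indicator_def max_def)
      then have "((\<lambda>r. indicator (A r) \<omega> :: real) \<longlongrightarrow> 0) (at_right 0)"
        by (rule tendsto_eventually)
      then show "(\<lambda>n. indicator (A (r n)) \<omega> :: real) \<longlonglongrightarrow> 0"
        by (rule filterlim_compose[OF _ r'])
    qed
  qed (auto simp: indicator_def)
  then have "((\<lambda>r. prob (A r)) \<longlongrightarrow> 0) (at_right 0)"
    by (simp add: emeasure_eq_measure)
  from order_tendstoD(2)[OF this assms(2)] obtain d where d: "0 < d" "\<And>r. 0 < r \<Longrightarrow> r < d \<Longrightarrow> prob (A r) < e"
    unfolding eventually_at_right_field by auto
  have "prob (A 0) = 0" using assms by (simp add: A_def cong: conj_cong)
  then have "prob (A r) < e" if "0 \<le> r" "r < d" for r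
    using d(2)[of r] that assms by (cases "r = 0") auto
  then show ?thesis using d(1) by (intro exI[of _ d]) (auto simp: A_def max_def)
qed

text \<open>Formally the generator of \<open>h\<close> is \<open>l * (h - f)\<close>, which vanishes
  where \<open>f = h\<close>. Quantitatively, \<open>h z - semi k r f z\<close> is the change of
  \<open>h\<close> under the semigroup plus the mean of \<open>h - f\<close>; the latter is only
  seen when the coordinate moves by at least \<epsilon> within time \<open>r\<close>.\<close>

lemma resolvent_generator_small:
  assumes l: "0 < l"
    and f [measurable]: "f \<in> borel_measurable borel" and C: "\<And>z. \<bar>f z\<bar> \<le> C"
    and h: "\<And>x. h x = (LINT v|resolvent_measure l k. f (x + v))"
    and hm [measurable]: "h \<in> borel_measurable borel" and hC: "\<And>z. \<bar>h z\<bar> \<le> C"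
    and eq: "\<And>v. \<bar>v\<bar> < \<rho> \<Longrightarrow> f v = h v"
    and \<epsilon>: "0 < \<epsilon>" and e: "0 < e"
  shows "\<exists>d>0. \<forall>t z. 0 < t \<and> t < d \<and> \<bar>z\<bar> \<le> \<rho> - \<epsilon> \<longrightarrow> \<bar>semi k t h z - h z\<bar> \<le> e * t"
proof -
  have C0: "0 \<le> C" using C[of 0] by linarith
  \<comment> \<open>\<open>e1\<close> absorbs the bound \<open>2 * (l * t)\<close> for
    \<open>exp (l * t) - 1\<close>. \<open>e2\<close> is so small that two errors of size
    \<open>2 * C * e2\<close> fit into \<open>e1\<close>.\<close>
  define e1 where "e1 = e / (2 * l)"
  define e2 where "e2 = e1 / (4 * C + 1)"
  have e1: "0 < e1" using e l by (simp add: e1_def)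
  have e2: "0 < e2" "4 * C * e2 \<le> e1"
    using e1 C0 by (auto simp: e2_def field_simps)
  have exp_le: "exp (l * t) - 1 \<le> 2 * (l * t)" if "0 \<le> t" "l * t \<le> 1" for t
  proof -
    have "exp (l * t) \<le> 1 + l * t + (l * t)\<^sup>2" by (rule exp_bound) (use that l in auto)
    moreover have "(l * t)\<^sup>2 \<le> l * t" using that l by (simp add: power2_eq_square mult_left_le)
    ultimately show ?thesis by linarith
  qed
  obtain d0 where d0: "0 < d0" "\<And>r. 0 \<le> r \<Longrightarrow> r < d0 \<Longrightarrow> prob {\<omega>\<in>space M. \<epsilon> \<le> \<bar>X r \<omega> $ k\<bar>} < e2"
    using X_small_time[OF \<epsilon> e2(1)] by blast
  define d where "d = min d0 (min (1 / l) (e2 / (2 * l)))"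
  have d: "0 < d" using d0 l e2 by (simp add: d_def)
  have "\<bar>semi k t h z - h z\<bar> \<le> e * t" if t: "0 < t" "t < d" and z: "\<bar>z\<bar> \<le> \<rho> - \<epsilon>" for t z
  proof -
    have lt: "l * t \<le> 1" "2 * (l * t) \<le> e2" "t < d0"
      using t l by (auto simp: d_def field_simps)
    \<comment> \<open>A first application with only the trivial bound \<open>2 * C\<close> shows
      that \<open>semi k r h z\<close> is close to \<open>h z\<close>; this is fed into the second,
      sharp application.\<close>
    have crude: "\<bar>semi k r h z - h z\<bar> \<le> 2 * C * e2" if r: "0 \<le> r" "r < t" for r
    proof -
      have lr: "l * r \<le> l * t" by (rule mult_left_mono) (use r l in auto)
      have "\<bar>semi k r h z - h z\<bar> \<le> 2 * C * (exp (l * r) - 1)"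
      proof (rule semi_resolvent_diff[OF l r(1) f C h])
        show "\<bar>h z - semi k q f z\<bar> \<le> 2 * C" for q
          using hC[of z] semi_bound[where f = f and C = C and k = k and t = q and z = z] C by force
      qed
      also have "exp (l * r) - 1 \<le> 2 * (l * r)"
        using exp_le[of r] r lt lr by linarith
      also have "2 * (l * r) \<le> e2"
        using lt lr by linarith
      finally show ?thesis using C0 by (simp add: mult_left_mono)
    qed
    have "\<bar>semi k t h z - h z\<bar> \<le> e1 * (exp (l * t) - 1)"
    proof (rule semi_resolvent_diff[OF l _ f C h])
      fix r assume r: "0 \<le> r" "r < t"
      have Xr [measurable]: "X r \<in> borel_measurable M" using r by simp
      let ?A = "{\<omega>\<in>space M. \<epsilon> \<le> \<bar>X r \<omega> $ k\<bar>}"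
      have "\<bar>semi k r h z - semi k r f z\<bar> = \<bar>LINT \<omega>|M. h (z + X r \<omega> $ k) - f (z + X r \<omega> $ k)\<bar>"
        unfolding semi_def
        by (subst Bochner_Integration.integral_diff)
          (auto intro!: integrable_const_bound[where B = C] simp: C hC)
      also have "\<dots> \<le> (LINT \<omega>|M. \<bar>h (z + X r \<omega> $ k) - f (z + X r \<omega> $ k)\<bar>)"
        by (rule integral_abs_bound)
      also have "\<dots> \<le> (LINT \<omega>|M. 2 * C * indicator ?A \<omega>)"
      proof (rule integral_mono)
        have diff: "\<bar>h v - f v\<bar> \<le> 2 * C" for v using hC[of v] C[of v] by linarith
        then show "integrable M (\<lambda>\<omega>. \<bar>h (z + X r \<omega> $ k) - f (z + X r \<omega> $ k)\<bar>)"
          by (intro integrable_const_bound[where B = "2 * C"]) auto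
        show "integrable M (\<lambda>\<omega>. 2 * C * indicator ?A \<omega>)"
          by (rule integrable_const_bound[where B = "2 * C"]) (use C0 in \<open>auto simp: indicator_def\<close>)
        show "\<bar>h (z + X r \<omega> $ k) - f (z + X r \<omega> $ k)\<bar> \<le> 2 * C * indicator ?A \<omega>" if "\<omega> \<in> space M" for \<omega>
        proof (cases "\<epsilon> \<le> \<bar>X r \<omega> $ k\<bar>")
          case True
          then show ?thesis using diff that by simp
        next
          case False
          then have "\<bar>z + X r \<omega> $ k\<bar> < \<rho>" using z by linarith
          then show ?thesis using eq C0 by simp
        qed
      qed
      also have "\<dots> = 2 * C * prob ?A" by (simp add: emeasure_eq_measure)
      also have "\<dots> \<le> 2 * C * e2"
        by (rule mult_left_mono) (use d0(2)[of r] r lt C0 in auto)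
      finally show "\<bar>h z - semi k r f z\<bar> \<le> e1"
        using crude[OF r] e2(2) by linarith
    qed (use t in simp)
    also have "\<dots> \<le> e1 * (2 * (l * t))"
      using exp_le[of t] t lt e1 by simp
    also have "\<dots> = e * t" using l by (simp add: e1_def)
    finally show ?thesis .
  qed
  then show ?thesis using d by blast
qed

end

section \<open>The fixed point equation\<close>

lemma continuous_on_shift_integral:
  fixes f :: "real \<Rightarrow> real"
  assumes "prob_space Q" and Q [measurable_cong]: "sets Q = sets borel"
    and f: "continuous_on UNIV f" and C: "\<And>x. \<bar>f x\<bar> \<le> C"
  shows "continuous_on UNIV (\<lambda>x. LINT v|Q. f (x + v))"
proof (rule continuous_on_sequentiallyI)
  interpret prob_space Q by fact
  have [measurable]: "f \<in> borel_measurable borel" using f by (rule borel_measurable_continuous_onI)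
  fix u :: "nat \<Rightarrow> real" and a assume u: "u \<longlonglongrightarrow> a"
  show "(\<lambda>n. LINT v|Q. f (u n + v)) \<longlonglongrightarrow> (LINT v|Q. f (a + v))"
  proof (rule integral_dominated_convergence[where w = "\<lambda>_. C"])
    have "(\<lambda>n. f (u n + v)) \<longlonglongrightarrow> f (a + v)" for v
      by (rule continuous_on_tendsto_compose[OF f tendsto_add[OF u tendsto_const]]) auto
    then show "AE v in Q. (\<lambda>n. f (u n + v)) \<longlonglongrightarrow> f (a + v)" by simp
  qed (use C in auto)
qed

text \<open>The solution is the Neumann series of \<open>T (\<psi> \<cdot>)\<close>, where \<open>T\<close> is convolution with \<open>Q\<close>;
  it converges because \<open>T (\<psi> \<cdot>)\<close> contracts the norm weighted by the barrier \<open>w\<close>.\<close>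

lemma obtain_barrier_fixed_point:
  fixes \<psi> g w :: "real \<Rightarrow> real"
  assumes "prob_space Q" and Q [measurable_cong]: "sets Q = sets borel"
    and \<psi>: "continuous_on UNIV \<psi>" "\<And>x. 0 \<le> \<psi> x" "\<And>x. \<psi> x \<le> 1"
    and g: "continuous_on UNIV g" "\<And>x. 0 \<le> g x" "\<And>x. g x \<le> B"
    and w: "continuous_on UNIV w" "\<And>x. \<epsilon> \<le> w x" "\<And>x. w x \<le> B" "0 < \<epsilon>"
    and \<rho>: "0 \<le> \<rho>" "\<rho> < 1"
    and contr: "\<And>x. (LINT v|Q. \<psi> (x + v) * w (x + v)) \<le> \<rho> * w x"
    and super: "\<And>x. (LINT v|Q. \<psi> (x + v) * w (x + v) + g (x + v)) \<le> w x"
  obtains h where "continuous_on UNIV h" "\<And>x. 0 \<le> h x" "\<And>x. h x \<le> w x"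
    "\<And>x. h x = (LINT v|Q. \<psi> (x + v) * h (x + v) + g (x + v))"
    "\<And>u c x. continuous_on UNIV u \<Longrightarrow> (\<And>x. \<bar>u x\<bar> \<le> c) \<Longrightarrow>
      (\<And>x. u x \<le> (LINT v|Q. \<psi> (x + v) * u (x + v) + g (x + v))) \<Longrightarrow> u x \<le> h x"
proof -
  interpret prob_space Q by fact
  \<comment> \<open>The terms of the Neumann series. They start with the convolution of
    \<open>g\<close>, so that no fixed point has to be known beforehand.\<close>
  define d where "d = rec_nat (\<lambda>x. LINT v|Q. g (x + v)) (\<lambda>_ f x. LINT v|Q. \<psi> (x + v) * f (x + v))"
  have d0: "d 0 x = (LINT v|Q. g (x + v))" for x by (simp add: d_def)
  have dSuc: "d (Suc n) x = (LINT v|Q. \<psi> (x + v) * d n (x + v))" for n x by (simp add: d_def)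
  have w0: "0 \<le> w x" for x using w(2)[of x] w(4) by linarith
  have B: "0 \<le> B" using g(2)[of 0] g(3)[of 0] by linarith
  have [measurable]: "\<psi> \<in> borel_measurable borel" "g \<in> borel_measurable borel" "w \<in> borel_measurable borel"
    using \<psi>(1) g(1) w(1) by (auto intro: borel_measurable_continuous_onI)
  have int: "integrable Q f" if "f \<in> borel_measurable borel" "\<And>x. \<bar>f x\<bar> \<le> c" for f :: "real \<Rightarrow> real" and c
    by (rule integrable_const_bound[where B = c]) (use that in auto)
  have abs_\<psi>: "\<bar>\<psi> x * y\<bar> \<le> \<bar>y\<bar>" for x y
    using \<psi>(2,3)[of x] by (simp add: abs_mult mult_left_le_one_le)
  have int_g: "integrable Q (\<lambda>v. g (x + v))" for x
    by (rule int[of _ B]) (use g in auto)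
  have int_\<psi>: "integrable Q (\<lambda>v. \<psi> (x + v) * f (x + v))"
    if f: "continuous_on UNIV f" "\<And>x. \<bar>f x\<bar> \<le> c" for f c x
  proof (rule int[of _ c])
    have [measurable]: "f \<in> borel_measurable borel" using f(1) by (rule borel_measurable_continuous_onI)
    show "(\<lambda>v. \<psi> (x + v) * f (x + v)) \<in> borel_measurable borel" by measurable
    show "\<bar>\<psi> (x + v) * f (x + v)\<bar> \<le> c" for v using abs_\<psi>[of "x + v" "f (x + v)"] f(2)[of "x + v"] by linarith
  qed
  have w_abs: "\<bar>w x\<bar> \<le> B" for x using w0 w(3) by simp
  have d: "continuous_on UNIV (d n) \<and> (\<forall>x. 0 \<le> d n x \<and> d n x \<le> \<rho> ^ n * w x)" for n
  proof (induction n)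
    case 0
    have "continuous_on UNIV (d 0)"
      unfolding d0[abs_def] by (rule continuous_on_shift_integral[OF assms(1,2) g(1), of B]) (use g in auto)
    moreover have "0 \<le> d 0 x" for x
      unfolding d0 by (rule Bochner_Integration.integral_nonneg) (use g in auto)
    moreover have "d 0 x \<le> w x" for x
    proof -
      have "d 0 x \<le> (LINT v|Q. \<psi> (x + v) * w (x + v) + g (x + v))"
        unfolding d0 using \<psi> w0 int_g int_\<psi>[OF w(1) w_abs] by (intro integral_mono) auto
      then show ?thesis using super[of x] by linarith
    qed
    ultimately show ?case by simp
  next
    case (Suc n)
    have "\<rho> ^ n * w x \<le> 1 * B" for x
      using \<rho> B w0 w(3) by (intro mult_mono power_le_one) auto
    then have bd: "\<bar>d n x\<bar> \<le> B" for x
      using Suc by (metis abs_of_nonneg mult_1 order_trans)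
    have "continuous_on UNIV (d (Suc n))"
      unfolding dSuc[abs_def]
    proof (rule continuous_on_shift_integral[OF assms(1,2), where f = "\<lambda>x. \<psi> x * d n x" and C = B])
      show "continuous_on UNIV (\<lambda>x. \<psi> x * d n x)" using \<psi>(1) Suc by (intro continuous_intros) auto
      show "\<bar>\<psi> x * d n x\<bar> \<le> B" for x using abs_\<psi>[of x "d n x"] bd[of x] by linarith
    qed
    moreover have "0 \<le> d (Suc n) x" for x
      unfolding dSuc by (rule Bochner_Integration.integral_nonneg) (use \<psi> Suc in auto)
    moreover have "d (Suc n) x \<le> \<rho> ^ Suc n * w x" for x
    proof -
      have "d (Suc n) x \<le> (LINT v|Q. \<rho> ^ n * (\<psi> (x + v) * w (x + v)))"
        unfolding dSuc
      proof (rule integral_mono)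
        show "integrable Q (\<lambda>v. \<psi> (x + v) * d n (x + v))" using int_\<psi>[OF _ bd] Suc by auto
        show "integrable Q (\<lambda>v. \<rho> ^ n * (\<psi> (x + v) * w (x + v)))"
          by (rule integrable_mult_right) (rule int_\<psi>[OF w(1) w_abs])
        show "\<psi> (x + v) * d n (x + v) \<le> \<rho> ^ n * (\<psi> (x + v) * w (x + v))" for v
          using mult_left_mono[of "d n (x + v)" "\<rho> ^ n * w (x + v)" "\<psi> (x + v)"] Suc \<psi> by (simp add: mult_ac)
      qed
      also have "\<dots> = \<rho> ^ n * (LINT v|Q. \<psi> (x + v) * w (x + v))" by simp
      also have "\<dots> \<le> \<rho> ^ n * (\<rho> * w x)"
        by (rule mult_left_mono[OF contr]) (use \<rho> in simp)
      finally show ?thesis by (simp add: mult_ac)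
    qed
    ultimately show ?case by auto
  qed
  have d_cont: "continuous_on UNIV (d n)" and d_nonneg: "0 \<le> d n x" and d_le: "d n x \<le> \<rho> ^ n * w x" for n x
    using d by auto
  have d_abs: "\<bar>d n x\<bar> \<le> \<rho> ^ n * B" for n x
    using d_nonneg[of n x] d_le[of n x] mult_left_mono[OF w(3)[of x], of "\<rho> ^ n"] \<rho> by simp
  have d_abs1: "\<bar>d n x\<bar> \<le> B" for n x
    using d_abs[of n x] mult_right_mono[OF power_le_one[of \<rho> n] B] \<rho> by simp
  define H where "H n x = (\<Sum>i<n. d i x)" for n x
  define h where "h x = suminf (\<lambda>i. d i x)" for x
  have unif: "uniform_limit UNIV H h sequentially"
    unfolding H_def[abs_def] h_def[abs_def]
  proof (rule Weierstrass_m_test)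
    show "summable (\<lambda>n. \<rho> ^ n * B)" using \<rho> by (intro summable_mult2 summable_geometric) simp
  qed (use d_abs in auto)
  have H_cont: "continuous_on UNIV (H n)" for n
    unfolding H_def[abs_def] by (intro continuous_on_sum d_cont)
  have h_cont: "continuous_on UNIV h"
    by (rule uniform_limit_theorem[OF _ unif]) (auto intro: H_cont always_eventually)
  have lim: "(\<lambda>n. H n x) \<longlonglongrightarrow> h x" for x
    using unif by (rule tendsto_uniform_limitI) simp
  have H_bound: "\<bar>H n x\<bar> \<le> real n * B" for n x
  proof -
    have "\<bar>H n x\<bar> \<le> (\<Sum>i<n. \<bar>d i x\<bar>)" unfolding H_def by (rule sum_abs)
    also have "\<dots> \<le> (\<Sum>i<n. B)" by (rule sum_mono) (rule d_abs1)
    finally show ?thesis by simp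
  qed
  \<comment> \<open>The partial sums are the Picard iterates starting from 0. This form gives both
    the bound by \<open>w\<close> and the equation in the limit.\<close>
  have H_Suc: "H (Suc n) x = (LINT v|Q. \<psi> (x + v) * H n (x + v) + g (x + v))" for n x
  proof -
    have "H (Suc n) x = d 0 x + (\<Sum>i<n. d (Suc i) x)"
      unfolding H_def by (rule sum.lessThan_Suc_shift)
    also have "(\<Sum>i<n. d (Suc i) x) = (LINT v|Q. (\<Sum>i<n. \<psi> (x + v) * d i (x + v)))"
      unfolding dSuc by (rule Bochner_Integration.integral_sum[symmetric]) (rule int_\<psi>[OF d_cont d_abs1])
    also have "d 0 x + \<dots> = (LINT v|Q. (\<Sum>i<n. \<psi> (x + v) * d i (x + v)) + g (x + v))"
      unfolding d0 by (subst Bochner_Integration.integral_add) (auto intro!: int_\<psi>[OF d_cont d_abs1] int_g)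
    finally show ?thesis by (simp add: H_def sum_distrib_left)
  qed
  have H_nonneg: "0 \<le> H n x" for n x unfolding H_def by (intro sum_nonneg d_nonneg)
  have H_le: "H n x \<le> w x" for n x
  proof (induction n arbitrary: x)
    case 0
    then show ?case using w0 by (simp add: H_def)
  next
    case (Suc n)
    have "H (Suc n) x \<le> (LINT v|Q. \<psi> (x + v) * w (x + v) + g (x + v))"
      unfolding H_Suc using \<psi> Suc
      by (intro integral_mono Bochner_Integration.integrable_add int_g int_\<psi>[OF H_cont H_bound] int_\<psi>[OF w(1) w_abs])
        (auto intro: mult_left_mono)
    then show ?case using super[of x] by linarith
  qed
  have h_nonneg: "0 \<le> h x" for x by (rule LIMSEQ_le_const[OF lim]) (use H_nonneg in auto)
  have h_le: "h x \<le> w x" for x by (rule LIMSEQ_le_const2[OF lim]) (use H_le in auto)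
  have H_B: "\<bar>H n x\<bar> \<le> B" for n x using H_nonneg[of n x] H_le[of n x] w(3)[of x] by linarith
  have h_B: "\<bar>h x\<bar> \<le> B" for x using h_nonneg[of x] h_le[of x] w(3)[of x] by linarith
  have h_eq: "h x = (LINT v|Q. \<psi> (x + v) * h (x + v) + g (x + v))" for x
  proof (rule LIMSEQ_unique)
    show "(\<lambda>n. H (Suc n) x) \<longlonglongrightarrow> h x" using lim by (rule LIMSEQ_Suc)
    show "(\<lambda>n. H (Suc n) x) \<longlonglongrightarrow> (LINT v|Q. \<psi> (x + v) * h (x + v) + g (x + v))"
      unfolding H_Suc
    proof (rule integral_dominated_convergence[where w = "\<lambda>_. 2 * B"])
      show "AE v in Q. (\<lambda>n. \<psi> (x + v) * H n (x + v) + g (x + v)) \<longlonglongrightarrow> \<psi> (x + v) * h (x + v) + g (x + v)"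
        by (intro AE_I2 tendsto_intros lim)
      show "AE v in Q. norm (\<psi> (x + v) * H n (x + v) + g (x + v)) \<le> 2 * B" for n
      proof (rule AE_I2)
        fix v
        show "norm (\<psi> (x + v) * H n (x + v) + g (x + v)) \<le> 2 * B"
          using abs_\<psi>[of "x + v" "H n (x + v)"] H_B[of n "x + v"] g(2,3)[of "x + v"] by simp
      qed
      show "(\<lambda>v. \<psi> (x + v) * h (x + v) + g (x + v)) \<in> borel_measurable Q"
        by (rule borel_measurable_integrable, intro Bochner_Integration.integrable_add int_g int_\<psi>[OF h_cont h_B])
      show "(\<lambda>v. \<psi> (x + v) * H n (x + v) + g (x + v)) \<in> borel_measurable Q" for n
        by (rule borel_measurable_integrable, intro Bochner_Integration.integrable_add int_g int_\<psi>[OF H_cont H_B])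
    qed simp
  qed
  have "u x \<le> h x" if u: "continuous_on UNIV u" "\<And>x. \<bar>u x\<bar> \<le> c"
    "\<And>x. u x \<le> (LINT v|Q. \<psi> (x + v) * u (x + v) + g (x + v))" for u c x
  proof -
    \<comment> \<open>As \<open>w\<close> is at least \<epsilon>, the multiple \<open>a * w\<close>
      dominates \<open>u\<close>. Each iteration contracts this excess by \<rho>, so in the limit it
      is gone.\<close>
    define a where "a = c / \<epsilon>"
    have c: "0 \<le> c" using u(2)[of 0] by linarith
    have a: "0 \<le> a" "u x \<le> a * w x" for x
    proof -
      show "0 \<le> a" using c w(4) by (simp add: a_def)
      have "c = a * \<epsilon>" using w(4) by (simp add: a_def)
      also have "\<dots> \<le> a * w x" using w(2)[of x] \<open>0 \<le> a\<close> by (rule mult_left_mono)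
      finally show "u x \<le> a * w x" using u(2)[of x] by linarith
    qed
    have ge: "u x - \<rho> ^ n * a * w x \<le> H n x" for n x
    proof (induction n arbitrary: x)
      case 0
      then show ?case using a(2)[of x] by (simp add: H_def)
    next
      case (Suc n)
      have "u x - \<rho> ^ Suc n * a * w x \<le>
        (LINT v|Q. \<psi> (x + v) * u (x + v) + g (x + v)) - \<rho> ^ n * a * (LINT v|Q. \<psi> (x + v) * w (x + v))"
        using u(3)[of x] mult_left_mono[OF contr[of x], of "\<rho> ^ n * a"] \<rho> a(1) by (simp add: mult_ac)
      also have "\<dots> = (LINT v|Q. \<psi> (x + v) * u (x + v) + g (x + v) - \<rho> ^ n * a * (\<psi> (x + v) * w (x + v)))"
        by (subst Bochner_Integration.integral_diff)
          (auto intro!: int_g int_\<psi>[OF u(1,2)] int_\<psi>[OF w(1) w_abs])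
      also have "\<dots> \<le> H (Suc n) x"
        unfolding H_Suc
      proof (rule integral_mono)
        show "\<psi> (x + v) * u (x + v) + g (x + v) - \<rho> ^ n * a * (\<psi> (x + v) * w (x + v)) \<le>
          \<psi> (x + v) * H n (x + v) + g (x + v)" for v
          using mult_left_mono[OF Suc[of "x + v"] \<psi>(2)[of "x + v"]] by (simp add: algebra_simps)
      qed (intro Bochner_Integration.integrable_diff Bochner_Integration.integrable_add integrable_mult_right
          int_g int_\<psi>[OF u(1,2)] int_\<psi>[OF w(1) w_abs] int_\<psi>[OF H_cont H_B])+
      finally show ?case .
    qed
    have "(\<lambda>n. \<rho> ^ n) \<longlonglongrightarrow> 0" using \<rho> by (intro LIMSEQ_power_zero) simp
    then have "(\<lambda>n. u x - \<rho> ^ n * a * w x) \<longlonglongrightarrow> u x - 0 * a * w x"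
      by (intro tendsto_intros) (use \<rho> in auto)
    then have "(\<lambda>n. u x - \<rho> ^ n * a * w x) \<longlonglongrightarrow> u x" by simp
    then show ?thesis by (rule LIMSEQ_le[OF _ lim]) (use ge in auto)
  qed
  then show ?thesis using h_cont h_nonneg h_le h_eq that by blast
qed

section \<open>The generator on Gaussians\<close>

text \<open>The normal density of variance \<open>b\<close> times \<open>sqrt (2 * pi)\<close>. With
  this factor \<open>b\<close> enters the Fourier transform through the exponential only, and
  multiplying by the transform of a jump of variance \<open>a\<close> just replaces \<open>b\<close>
  by \<open>b + a\<close>.\<close>

definition gauss :: "real \<Rightarrow> real \<Rightarrow> real" where
  "gauss b y = exp (- (y\<^sup>2 / (2 * b))) / sqrt b"

lemma gauss_fourier:
  assumes "0 < b"
  shows "has_bochner_integral lborel (\<lambda>\<theta>. 1 / sqrt (2 * pi) * (exp (- (b * \<theta>\<^sup>2 / 2)) * cos (\<theta> * y))) (gauss b y)"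
proof -
  have eq: "1 / sqrt (2 * pi) * (sqrt (2 * pi / b) * exp (- (y\<^sup>2 / (2 * b)))) = gauss b y"
    using assms by (simp add: gauss_def real_sqrt_divide)
  show ?thesis
    using has_bochner_integral_mult_right[OF gaussian_cos[OF assms, of y], of "1 / sqrt (2 * pi)"]
    unfolding eq by simp
qed

text \<open>This bounds the contribution of the tail of \<Phi>, which is at most quadratic in
  \<theta>.\<close>

lemma gauss_second_moment:
  assumes "0 < b"
  shows "has_bochner_integral lborel (\<lambda>\<theta>. 1 / sqrt (2 * pi) * (exp (- (b * \<theta>\<^sup>2 / 2)) * \<theta>\<^sup>2)) (1 / (b * sqrt b))"
proof -
  have eq: "1 / sqrt (2 * pi) * (sqrt (2 * pi / b) / b) = 1 / (b * sqrt b)"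
    using assms by (simp add: real_sqrt_divide)
  show ?thesis
    using has_bochner_integral_mult_right[OF gaussian_second_moment[OF assms], of "1 / sqrt (2 * pi)"]
    unfolding eq by simp
qed

text \<open>\<open>Q\<close> is the law of a symmetric Levy process with exponent \<open>\<Phi>\<close> at an independent
  exponential time of rate \<open>l\<close>, i.e. convolution with \<open>Q\<close> is \<open>l (l - L)\<^sup>-\<^sup>1\<close> for the generator
  \<open>L\<close>; the jumps of \<open>\<Phi>\<close> outside the finite set \<open>J\<close> have total variance at most \<open>\<alpha>\<close>.\<close>

locale jump_kernel = prob_space Q for Q :: "real measure" +
  fixes l :: real and \<Phi> :: "real \<Rightarrow> real" and J :: "nat set" and a :: "nat \<Rightarrow> real" and \<alpha> :: real
  assumes sets_Q [measurable_cong]: "sets Q = sets borel"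
    and l: "0 < l"
    and \<Phi>_measurable [measurable]: "\<Phi> \<in> borel_measurable borel"
    and \<Phi>_nonneg: "\<And>\<theta>. 0 \<le> \<Phi> \<theta>"
    and J: "finite J" and a: "\<And>j. j \<in> J \<Longrightarrow> 0 \<le> a j" and \<alpha>: "0 \<le> \<alpha>"
    and \<Phi>_lower: "\<And>\<theta>. (\<Sum>j\<in>J. 1 - exp (- (a j * \<theta>\<^sup>2 / 2))) \<le> \<Phi> \<theta>"
    and \<Phi>_upper: "\<And>\<theta>. \<Phi> \<theta> \<le> (\<Sum>j\<in>J. 1 - exp (- (a j * \<theta>\<^sup>2 / 2))) + \<alpha> * \<theta>\<^sup>2 / 2"
    and cos_Q: "\<And>\<theta> x. (LINT v|Q. cos (\<theta> * (x + v))) = cos (\<theta> * x) * (l / (l + \<Phi> \<theta>))"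
begin

text \<open>The generator has Fourier multiplier \<open>- \<Phi>\<close>, and this is its action on
  \<open>gauss b\<close>.\<close>

definition Lgauss :: "real \<Rightarrow> real \<Rightarrow> real" where
  "Lgauss b y = (LINT \<theta>|lborel. - (1 / sqrt (2 * pi) * (\<Phi> \<theta> * exp (- (b * \<theta>\<^sup>2 / 2)) * cos (\<theta> * y))))"

lemma Lgauss_measurable [measurable]: "Lgauss b \<in> borel_measurable borel"
  unfolding Lgauss_def[abs_def] by measurable

lemma integrable_\<Phi>_gauss:
  assumes "0 < b"
  shows "integrable lborel (\<lambda>\<theta>. 1 / sqrt (2 * pi) * (\<Phi> \<theta> * exp (- (b * \<theta>\<^sup>2 / 2))))"
proof (rule Bochner_Integration.integrable_bound)
  show "integrable lborel (\<lambda>\<theta>. real (card J) * (1 / sqrt (2 * pi) * (exp (- (b * \<theta>\<^sup>2 / 2)) * cos (\<theta> * 0))) +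
      \<alpha> / 2 * (1 / sqrt (2 * pi) * (exp (- (b * \<theta>\<^sup>2 / 2)) * \<theta>\<^sup>2)))"
    by (intro Bochner_Integration.integrable_add integrable_mult_right
        integrable.intros[OF gauss_fourier[OF assms]] integrable.intros[OF gauss_second_moment[OF assms]])
  show "AE \<theta> in lborel. norm (1 / sqrt (2 * pi) * (\<Phi> \<theta> * exp (- (b * \<theta>\<^sup>2 / 2)))) \<le>
    norm (real (card J) * (1 / sqrt (2 * pi) * (exp (- (b * \<theta>\<^sup>2 / 2)) * cos (\<theta> * 0))) +
      \<alpha> / 2 * (1 / sqrt (2 * pi) * (exp (- (b * \<theta>\<^sup>2 / 2)) * \<theta>\<^sup>2)))"
  proof (rule AE_I2)
    fix \<theta> :: real
    have "(\<Sum>j\<in>J. 1 - exp (- (a j * \<theta>\<^sup>2 / 2))) \<le> (\<Sum>j\<in>J. 1)"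
      by (rule sum_mono) simp
    then have "\<Phi> \<theta> \<le> real (card J) + \<alpha> * \<theta>\<^sup>2 / 2" using \<Phi>_upper[of \<theta>] by simp
    then have "1 / sqrt (2 * pi) * (\<Phi> \<theta> * exp (- (b * \<theta>\<^sup>2 / 2))) \<le>
      1 / sqrt (2 * pi) * ((real (card J) + \<alpha> * \<theta>\<^sup>2 / 2) * exp (- (b * \<theta>\<^sup>2 / 2)))"
      by (intro mult_left_mono mult_right_mono) auto
    also have "\<dots> = real (card J) * (1 / sqrt (2 * pi) * (exp (- (b * \<theta>\<^sup>2 / 2)) * cos (\<theta> * 0))) +
      \<alpha> / 2 * (1 / sqrt (2 * pi) * (exp (- (b * \<theta>\<^sup>2 / 2)) * \<theta>\<^sup>2))"
      by (simp add: field_simps)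
    finally show "norm (1 / sqrt (2 * pi) * (\<Phi> \<theta> * exp (- (b * \<theta>\<^sup>2 / 2)))) \<le>
    norm (real (card J) * (1 / sqrt (2 * pi) * (exp (- (b * \<theta>\<^sup>2 / 2)) * cos (\<theta> * 0))) +
      \<alpha> / 2 * (1 / sqrt (2 * pi) * (exp (- (b * \<theta>\<^sup>2 / 2)) * \<theta>\<^sup>2)))"
      using \<Phi>_nonneg[of \<theta>] by (simp add: abs_mult)
  qed
qed measurable

lemma integrable_\<Phi>_gauss_cos:
  assumes "0 < b"
  shows "integrable lborel (\<lambda>\<theta>. 1 / sqrt (2 * pi) * (\<Phi> \<theta> * exp (- (b * \<theta>\<^sup>2 / 2)) * cos (\<theta> * y)))"
  by (rule Bochner_Integration.integrable_bound[OF integrable_\<Phi>_gauss[OF assms]])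
    (auto simp: abs_mult \<Phi>_nonneg intro!: AE_I2 divide_right_mono mult_left_le)

text \<open>On the Fourier side each jump in \<open>J\<close> contributes a difference of two
  Gaussians exactly. The rest of \<Phi> is between 0 and
  \<open>\<alpha> * \<theta>\<^sup>2 / 2\<close>, so the second moment bounds the error uniformly in
  \<open>y\<close>.\<close>

lemma Lgauss_approx:
  assumes b: "0 < b"
  shows "\<bar>Lgauss b y - (\<Sum>j\<in>J. gauss (b + a j) y - gauss b y)\<bar> \<le> \<alpha> / (2 * (b * sqrt b))"
proof -
  let ?c = "1 / sqrt (2 * pi)"
  define E where "E c \<theta> = ?c * (exp (- (c * \<theta>\<^sup>2 / 2)) * cos (\<theta> * y))" for c \<theta>
  define R where "R \<theta> = (\<Sum>j\<in>J. 1 - exp (- (a j * \<theta>\<^sup>2 / 2))) - \<Phi> \<theta>" for \<theta>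
  have hE: "has_bochner_integral lborel (E c) (gauss c y)" if "0 < c" for c
    using gauss_fourier[OF that] by (simp add: E_def[abs_def])
  have ba: "0 < b + a j" if "j \<in> J" for j using a[OF that] b by simp
  have h1: "has_bochner_integral lborel (\<lambda>\<theta>. \<Sum>j\<in>J. E (b + a j) \<theta> - E b \<theta>) (\<Sum>j\<in>J. gauss (b + a j) y - gauss b y)"
    by (intro has_bochner_integral_sum has_bochner_integral_diff hE ba b)
  have h2: "has_bochner_integral lborel (\<lambda>\<theta>. - (?c * (\<Phi> \<theta> * exp (- (b * \<theta>\<^sup>2 / 2)) * cos (\<theta> * y)))) (Lgauss b y)"
    unfolding Lgauss_def using integrable_\<Phi>_gauss_cos[OF b, of y] by (simp add: has_bochner_integral_iff)
  have eq: "- (?c * (\<Phi> \<theta> * exp (- (b * \<theta>\<^sup>2 / 2)) * cos (\<theta> * y))) - (\<Sum>j\<in>J. E (b + a j) \<theta> - E b \<theta>) =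
    R \<theta> * E b \<theta>" for \<theta>
  proof -
    have "E (b + a j) \<theta> = exp (- (a j * \<theta>\<^sup>2 / 2)) * E b \<theta>" for j
      by (simp add: E_def exp_add[symmetric] algebra_simps add_divide_distrib)
    then have "(\<Sum>j\<in>J. E (b + a j) \<theta> - E b \<theta>) = - (\<Sum>j\<in>J. 1 - exp (- (a j * \<theta>\<^sup>2 / 2))) * E b \<theta>"
      by (simp add: sum_distrib_left right_diff_distrib left_diff_distrib mult_ac sum_subtractf)
    moreover have "- (?c * (\<Phi> \<theta> * exp (- (b * \<theta>\<^sup>2 / 2)) * cos (\<theta> * y))) = - (\<Phi> \<theta> * E b \<theta>)"
      by (simp add: E_def)
    ultimately show ?thesis by (simp only: R_def) (simp only: algebra_simps)
  qed
  have h3: "has_bochner_integral lborel (\<lambda>\<theta>. R \<theta> * E b \<theta>) (Lgauss b y - (\<Sum>j\<in>J. gauss (b + a j) y - gauss b y))"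
    using has_bochner_integral_diff[OF h2 h1] by (simp only: eq)
  have h4: "has_bochner_integral lborel (\<lambda>\<theta>. \<alpha> / 2 * (?c * (exp (- (b * \<theta>\<^sup>2 / 2)) * \<theta>\<^sup>2))) (\<alpha> / 2 * (1 / (b * sqrt b)))"
    by (rule has_bochner_integral_mult_right) (rule gauss_second_moment[OF b])
  have "\<bar>LINT \<theta>|lborel. R \<theta> * E b \<theta>\<bar> \<le> (LINT \<theta>|lborel. \<bar>R \<theta> * E b \<theta>\<bar>)"
    by (rule integral_abs_bound)
  also have "\<dots> \<le> (LINT \<theta>|lborel. \<alpha> / 2 * (?c * (exp (- (b * \<theta>\<^sup>2 / 2)) * \<theta>\<^sup>2)))"
  proof (rule integral_mono)
    show "\<bar>R \<theta> * E b \<theta>\<bar> \<le> \<alpha> / 2 * (?c * (exp (- (b * \<theta>\<^sup>2 / 2)) * \<theta>\<^sup>2))" for \<theta>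
    proof -
      have "\<bar>R \<theta>\<bar> \<le> \<alpha> / 2 * \<theta>\<^sup>2"
        using \<Phi>_lower[of \<theta>] \<Phi>_upper[of \<theta>] by (simp add: R_def)
      moreover have "\<bar>E b \<theta>\<bar> \<le> ?c * exp (- (b * \<theta>\<^sup>2 / 2))"
        by (simp add: E_def abs_mult divide_right_mono mult_left_le)
      ultimately have "\<bar>R \<theta>\<bar> * \<bar>E b \<theta>\<bar> \<le> (\<alpha> / 2 * \<theta>\<^sup>2) * (?c * exp (- (b * \<theta>\<^sup>2 / 2)))"
        by (intro mult_mono) (use \<alpha> in auto)
      then show ?thesis by (simp add: abs_mult mult_ac)
    qed
  qed (use h3 h4 in \<open>auto simp: has_bochner_integral_iff\<close>)
  finally show ?thesis using h3 h4 by (simp add: has_bochner_integral_iff)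
qed

text \<open>The multiplier \<open>l / (l + \<Phi> \<theta>)\<close> of \<open>Q\<close> cancels the
  multiplier \<open>1 + \<Phi> \<theta> / l\<close> of the integrand.\<close>

lemma integral_gauss_Lgauss:
  assumes b: "0 < b"
  shows "(LINT v|Q. gauss b (x + v) - Lgauss b (x + v) / l) = gauss b x"
proof -
  let ?c = "1 / sqrt (2 * pi)"
  define g where "g \<theta> = ?c * ((1 + \<Phi> \<theta> / l) * exp (- (b * \<theta>\<^sup>2 / 2)))" for \<theta>
  have g0: "0 \<le> g \<theta>" for \<theta> using \<Phi>_nonneg[of \<theta>] l by (simp add: g_def)
  have [measurable]: "g \<in> borel_measurable borel" unfolding g_def by measurable
  have g_int: "integrable lborel g"
  proof -
    have "integrable lborel (\<lambda>\<theta>. ?c * (exp (- (b * \<theta>\<^sup>2 / 2)) * cos (\<theta> * 0)) + 1 / l * (?c * (\<Phi> \<theta> * exp (- (b * \<theta>\<^sup>2 / 2)))))"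
      by (intro Bochner_Integration.integrable_add integrable_mult_right[of "1 / l"] integrable_\<Phi>_gauss[OF b]
          integrable.intros[OF gauss_fourier[OF b]])
    then show ?thesis by (simp add: g_def[abs_def] field_simps)
  qed
  have rep: "gauss b y - Lgauss b y / l = (LINT \<theta>|lborel. g \<theta> * cos (\<theta> * y))" for y
  proof -
    have h1: "has_bochner_integral lborel (\<lambda>\<theta>. - (?c * (\<Phi> \<theta> * exp (- (b * \<theta>\<^sup>2 / 2)) * cos (\<theta> * y)))) (Lgauss b y)"
      unfolding Lgauss_def using integrable_\<Phi>_gauss_cos[OF b, of y] by (simp add: has_bochner_integral_iff)
    have "has_bochner_integral lborel (\<lambda>\<theta>. ?c * (exp (- (b * \<theta>\<^sup>2 / 2)) * cos (\<theta> * y)) -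
      (1 / l) * - (?c * (\<Phi> \<theta> * exp (- (b * \<theta>\<^sup>2 / 2)) * cos (\<theta> * y)))) (gauss b y - (1 / l) * Lgauss b y)"
      by (intro has_bochner_integral_diff has_bochner_integral_mult_right[OF h1] gauss_fourier[OF b])
    also have "(\<lambda>\<theta>. ?c * (exp (- (b * \<theta>\<^sup>2 / 2)) * cos (\<theta> * y)) -
      (1 / l) * - (?c * (\<Phi> \<theta> * exp (- (b * \<theta>\<^sup>2 / 2)) * cos (\<theta> * y)))) = (\<lambda>\<theta>. g \<theta> * cos (\<theta> * y))"
      by (simp add: g_def fun_eq_iff algebra_simps)
    finally show ?thesis by (simp add: has_bochner_integral_iff)
  qed
  interpret LQ: pair_sigma_finite "lborel :: real measure" Q ..
  have int: "integrable (lborel \<Otimes>\<^sub>M Q) (\<lambda>p. g (fst p) * cos (fst p * (x + snd p)))"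
  proof (rule LQ.Fubini_integrable)
    have bd: "(LINT v|Q. norm (g \<theta> * cos (\<theta> * (x + v)))) \<le> g \<theta>" for \<theta>
    proof (rule integral_le_const)
      show "AE v in Q. norm (g \<theta> * cos (\<theta> * (x + v))) \<le> g \<theta>"
        using g0[of \<theta>] by (intro AE_I2) (simp add: abs_mult mult_left_le)
      then show "integrable Q (\<lambda>v. norm (g \<theta> * cos (\<theta> * (x + v))))"
        by (intro integrable_const_bound[where B = "g \<theta>"]) auto
    qed
    show "integrable lborel (\<lambda>\<theta>. LINT v|Q. norm (g (fst (\<theta>, v)) * cos (fst (\<theta>, v) * (x + snd (\<theta>, v)))))"
    proof (rule Bochner_Integration.integrable_bound[OF g_int])
      show "AE \<theta> in lborel. norm (LINT v|Q. norm (g (fst (\<theta>, v)) * cos (fst (\<theta>, v) * (x + snd (\<theta>, v))))) \<le> norm (g \<theta>)"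
      proof (rule AE_I2)
        fix \<theta>
        have "0 \<le> (LINT v|Q. norm (g \<theta> * cos (\<theta> * (x + v))))" by (rule Bochner_Integration.integral_nonneg) simp
        then show "norm (LINT v|Q. norm (g (fst (\<theta>, v)) * cos (fst (\<theta>, v) * (x + snd (\<theta>, v))))) \<le> norm (g \<theta>)"
          using bd[of \<theta>] g0[of \<theta>] by simp
      qed
    qed measurable
    show "AE \<theta> in lborel. integrable Q (\<lambda>v. g (fst (\<theta>, v)) * cos (fst (\<theta>, v) * (x + snd (\<theta>, v))))"
    proof (rule AE_I2)
      fix \<theta>
      show "integrable Q (\<lambda>v. g (fst (\<theta>, v)) * cos (fst (\<theta>, v) * (x + snd (\<theta>, v))))"
        using g0[of \<theta>] by (intro integrable_const_bound[where B = "g \<theta>"]) (auto simp: abs_mult mult_left_le)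
    qed
  qed measurable
  have "(LINT v|Q. gauss b (x + v) - Lgauss b (x + v) / l) = (LINT v|Q. LINT \<theta>|lborel. g \<theta> * cos (\<theta> * (x + v)))"
    by (simp only: rep)
  also have "\<dots> = (LINT \<theta>|lborel. LINT v|Q. g \<theta> * cos (\<theta> * (x + v)))"
    by (rule LQ.Fubini_integral) (use int in \<open>simp add: split_beta'\<close>)
  also have "\<dots> = (LINT \<theta>|lborel. ?c * (exp (- (b * \<theta>\<^sup>2 / 2)) * cos (\<theta> * x)))"
  proof (rule Bochner_Integration.integral_cong[OF refl])
    fix \<theta>
    have one: "(1 + \<Phi> \<theta> / l) * (l / (l + \<Phi> \<theta>)) = 1"
    proof -
      have "1 + \<Phi> \<theta> / l = (l + \<Phi> \<theta>) / l" using l by (simp add: field_simps)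
      moreover have "l + \<Phi> \<theta> \<noteq> 0" using l \<Phi>_nonneg[of \<theta>] by linarith
      ultimately show ?thesis using l by simp
    qed
    have "(LINT v|Q. g \<theta> * cos (\<theta> * (x + v))) =
      ?c * exp (- (b * \<theta>\<^sup>2 / 2)) * cos (\<theta> * x) * ((1 + \<Phi> \<theta> / l) * (l / (l + \<Phi> \<theta>)))"
      by (simp add: cos_Q g_def mult_ac)
    then show "(LINT v|Q. g \<theta> * cos (\<theta> * (x + v))) = ?c * (exp (- (b * \<theta>\<^sup>2 / 2)) * cos (\<theta> * x))"
      by (simp only: one mult_1_right mult.assoc)
  qed
  also have "\<dots> = gauss b x"
    using gauss_fourier[OF b, of x] by (simp add: has_bochner_integral_iff)
  finally show ?thesis .
qed

end

text \<open>A Gaussian scaled to maximum 1, as is convenient for barriers compared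
  pointwise.\<close>

definition bump :: "real \<Rightarrow> real \<Rightarrow> real" where
  "bump b y = exp (- (y\<^sup>2 / (2 * b)))"

lemma bump_gauss: "0 < b \<Longrightarrow> bump b y = sqrt b * gauss b y"
  by (simp add: bump_def gauss_def)

lemma bump_pos: "0 < bump b y"
  by (simp add: bump_def)

lemma bump_le_1: "0 < b \<Longrightarrow> bump b y \<le> 1"
  by (simp add: bump_def)

lemma bump_continuous [continuous_intros]:
  "0 < b \<Longrightarrow> continuous_on A f \<Longrightarrow> continuous_on A (\<lambda>x. bump b (f x))"
  unfolding bump_def by (intro continuous_intros) auto

lemma bump_measurable [measurable]: "bump b \<in> borel_measurable borel"
  unfolding bump_def[abs_def] by measurable

context jump_kernel begin

text \<open>\<open>generates f Lf\<close> says that \<open>f\<close> is in the domain of the generator with image \<open>Lf\<close>.\<close>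

definition generates :: "(real \<Rightarrow> real) \<Rightarrow> (real \<Rightarrow> real) \<Rightarrow> bool" where
  "generates f Lf \<longleftrightarrow> f \<in> borel_measurable borel \<and> Lf \<in> borel_measurable borel \<and>
    (\<exists>c. \<forall>x. \<bar>f x\<bar> \<le> c \<and> \<bar>Lf x\<bar> \<le> c) \<and> (\<forall>x. (LINT v|Q. f (x + v) - Lf (x + v) / l) = f x)"

lemma integrable_bounded:
  assumes "f \<in> borel_measurable borel" "\<And>x. \<bar>f x\<bar> \<le> (c :: real)"
  shows "integrable Q (\<lambda>v. f (x + v))"
  by (rule integrable_const_bound[where B = c]) (use assms in auto)

lemma generates_integrable:
  assumes "generates f Lf"
  shows "integrable Q (\<lambda>v. f (x + v) - Lf (x + v) / l)"
proof -
  from assms obtain c where "f \<in> borel_measurable borel" "Lf \<in> borel_measurable borel"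
    "\<And>x. \<bar>f x\<bar> \<le> c" "\<And>x. \<bar>Lf x\<bar> \<le> c"
    unfolding generates_def by blast
  then show ?thesis
    by (intro Bochner_Integration.integrable_diff integrable_divide integrable_bounded)
qed

lemma generates_const: "generates (\<lambda>_. c) (\<lambda>_. 0)"
  unfolding generates_def by (auto simp: prob_space)

lemma generates_add:
  assumes f: "generates f Lf" and g: "generates g Lg"
  shows "generates (\<lambda>x. f x + g x) (\<lambda>x. Lf x + Lg x)"
  unfolding generates_def
proof (intro conjI allI)
  show "(\<lambda>x. f x + g x) \<in> borel_measurable borel" "(\<lambda>x. Lf x + Lg x) \<in> borel_measurable borel"
    using f g by (auto simp: generates_def)
  obtain c c' where "\<And>x. \<bar>f x\<bar> \<le> c \<and> \<bar>Lf x\<bar> \<le> c" "\<And>x. \<bar>g x\<bar> \<le> c' \<and> \<bar>Lg x\<bar> \<le> c'"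
    using f g unfolding generates_def by blast
  then have "\<bar>f x + g x\<bar> \<le> c + c' \<and> \<bar>Lf x + Lg x\<bar> \<le> c + c'" for x
    using abs_triangle_ineq[of "f x" "g x"] abs_triangle_ineq[of "Lf x" "Lg x"] by (smt (verit))
  then show "\<exists>c. \<forall>x. \<bar>f x + g x\<bar> \<le> c \<and> \<bar>Lf x + Lg x\<bar> \<le> c" by blast
  fix x
  have "(LINT v|Q. f (x + v) + g (x + v) - (Lf (x + v) + Lg (x + v)) / l) =
    (LINT v|Q. (f (x + v) - Lf (x + v) / l) + (g (x + v) - Lg (x + v) / l))"
    by (intro Bochner_Integration.integral_cong) (auto simp: add_divide_distrib)
  also have "\<dots> = f x + g x"
    by (subst Bochner_Integration.integral_add[OF generates_integrable[OF f] generates_integrable[OF g]])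
      (use f g in \<open>simp add: generates_def\<close>)
  finally show "(LINT v|Q. f (x + v) + g (x + v) - (Lf (x + v) + Lg (x + v)) / l) = f x + g x" .
qed

lemma generates_mult:
  assumes f: "generates f Lf"
  shows "generates (\<lambda>x. k * f x) (\<lambda>x. k * Lf x)"
  unfolding generates_def
proof (intro conjI allI)
  show "(\<lambda>x. k * f x) \<in> borel_measurable borel" "(\<lambda>x. k * Lf x) \<in> borel_measurable borel"
    using f by (auto simp: generates_def)
  obtain c where "\<And>x. \<bar>f x\<bar> \<le> c \<and> \<bar>Lf x\<bar> \<le> c"
    using f unfolding generates_def by blast
  then show "\<exists>c. \<forall>x. \<bar>k * f x\<bar> \<le> c \<and> \<bar>k * Lf x\<bar> \<le> c"
    by (intro exI[of _ "\<bar>k\<bar> * c"]) (auto simp: abs_mult intro!: mult_left_mono)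
  fix x
  have "(LINT v|Q. k * f (x + v) - k * Lf (x + v) / l) = (LINT v|Q. k * (f (x + v) - Lf (x + v) / l))"
    by (intro Bochner_Integration.integral_cong) (auto simp: algebra_simps)
  also have "\<dots> = k * f x" using f by (simp add: generates_def)
  finally show "(LINT v|Q. k * f (x + v) - k * Lf (x + v) / l) = k * f x" .
qed

definition Lbump :: "real \<Rightarrow> real \<Rightarrow> real" where
  "Lbump b y = sqrt b * Lgauss b y"

lemma Lbump_approx:
  assumes b: "0 < b"
  shows "\<bar>Lbump b y - (\<Sum>j\<in>J. sqrt (b / (b + a j)) * bump (b + a j) y - bump b y)\<bar> \<le> \<alpha> / (2 * b)"
proof -
  have 1: "sqrt b * (\<Sum>j\<in>J. gauss (b + a j) y - gauss b y) = (\<Sum>j\<in>J. sqrt (b / (b + a j)) * bump (b + a j) y - bump b y)"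
    unfolding sum_distrib_left
  proof (intro sum.cong refl)
    fix j assume "j \<in> J"
    then have "0 < b + a j" using a b by (simp add: add_pos_nonneg)
    then show "sqrt b * (gauss (b + a j) y - gauss b y) = sqrt (b / (b + a j)) * bump (b + a j) y - bump b y"
      using b by (simp add: bump_def gauss_def real_sqrt_divide right_diff_distrib)
  qed
  have "\<bar>Lbump b y - (\<Sum>j\<in>J. sqrt (b / (b + a j)) * bump (b + a j) y - bump b y)\<bar> =
    sqrt b * \<bar>Lgauss b y - (\<Sum>j\<in>J. gauss (b + a j) y - gauss b y)\<bar>"
    unfolding Lbump_def 1[symmetric] right_diff_distrib[symmetric] using b by (simp add: abs_mult)
  also have "\<dots> \<le> sqrt b * (\<alpha> / (2 * (b * sqrt b)))"
    by (rule mult_left_mono[OF Lgauss_approx[OF b]]) (use b in simp)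
  also have "\<dots> = \<alpha> / (2 * b)" using b by simp
  finally show ?thesis .
qed

lemma generates_bump:
  assumes b: "0 < b"
  shows "generates (\<lambda>x. bump b (x - c)) (\<lambda>x. Lbump b (x - c))"
  unfolding generates_def
proof (intro conjI allI)
  show "(\<lambda>x. bump b (x - c)) \<in> borel_measurable borel" "(\<lambda>x. Lbump b (x - c)) \<in> borel_measurable borel"
    unfolding Lbump_def by measurable
  have "\<bar>Lbump b y\<bar> \<le> real (card J) + \<alpha> / (2 * b)" for y
  proof -
    have "\<bar>\<Sum>j\<in>J. sqrt (b / (b + a j)) * bump (b + a j) y - bump b y\<bar> \<le> (\<Sum>j\<in>J. 1)"
    proof (rule order_trans[OF sum_abs sum_mono])
      fix j assume "j \<in> J"
      then have j: "0 < b + a j" "b \<le> b + a j" using a b by (auto simp: add_pos_nonneg)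
      then have "0 \<le> sqrt (b / (b + a j)) * bump (b + a j) y" "sqrt (b / (b + a j)) * bump (b + a j) y \<le> 1"
        using b bump_le_1[OF j(1), of y] bump_pos[of "b + a j" y] by (auto intro!: mult_le_one)
      then show "\<bar>sqrt (b / (b + a j)) * bump (b + a j) y - bump b y\<bar> \<le> 1"
        using bump_le_1[OF b, of y] bump_pos[of b y] by linarith
    qed
    then show ?thesis using Lbump_approx[OF b, of y] by simp
  qed
  moreover have "\<bar>bump b y\<bar> \<le> 1" for y using bump_pos[of b y] bump_le_1[OF b, of y] by simp
  ultimately show "\<exists>d. \<forall>x. \<bar>bump b (x - c)\<bar> \<le> d \<and> \<bar>Lbump b (x - c)\<bar> \<le> d"
    by (intro exI[of _ "max 1 (real (card J) + \<alpha> / (2 * b))"]) (auto simp: le_max_iff_disj)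
  fix x
  have "(LINT v|Q. bump b (x + v - c) - Lbump b (x + v - c) / l) =
    (LINT v|Q. sqrt b * (gauss b ((x - c) + v) - Lgauss b ((x - c) + v) / l))"
    using b by (intro Bochner_Integration.integral_cong) (auto simp: bump_gauss Lbump_def algebra_simps)
  also have "\<dots> = bump b (x - c)"
    using integral_gauss_Lgauss[OF b, of "x - c"] b by (simp add: bump_gauss)
  finally show "(LINT v|Q. bump b (x + v - c) - Lbump b (x + v - c) / l) = bump b (x - c)" .
qed

text \<open>Since \<open>w\<close> is the \<open>Q\<close>-average of \<open>w - Lw / l\<close>, a
  pointwise bound of \<open>F\<close> by this function is all that is needed: averaging preserves
  order. \<open>subsolution\<close> is the mirror image.\<close>

lemma supersolution:
  assumes w: "generates w Lw" and F: "F \<in> borel_measurable borel" "\<And>x. \<bar>F x\<bar> \<le> c"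
    and le: "\<And>x. l * F x \<le> l * w x - Lw x"
  shows "(LINT v|Q. F (x + v)) \<le> w x"
proof -
  have "(LINT v|Q. F (x + v)) \<le> (LINT v|Q. w (x + v) - Lw (x + v) / l)"
    using le l by (intro integral_mono integrable_bounded[OF F] generates_integrable[OF w])
      (simp add: field_simps)
  then show ?thesis using w by (simp add: generates_def)
qed

lemma subsolution:
  assumes u: "generates u Lu" and F: "F \<in> borel_measurable borel" "\<And>x. \<bar>F x\<bar> \<le> c"
    and le: "\<And>x. l * u x - Lu x \<le> l * F x"
  shows "u x \<le> (LINT v|Q. F (x + v))"
proof -
  have "(LINT v|Q. u (x + v) - Lu (x + v) / l) \<le> (LINT v|Q. F (x + v))"
    using le l by (intro integral_mono integrable_bounded[OF F] generates_integrable[OF u])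
      (simp add: field_simps)
  then show ?thesis using u by (simp add: generates_def)
qed

end

section \<open>Barriers\<close>

text \<open>The length scale is chosen such that the jump \<open>Suc m\<close> has variance \<open>1\<close>, so that all
  earlier jumps are huge and all later ones negligible. The jumps \<open>0, \<dots>, Suc m\<close> have total
  rate \<open>\<Lambda>\<close> (defined below), and \<open>K\<close> is the position of the target.\<close>

locale scale_separation = jump_kernel Q l \<Phi> "{..Suc m}" a "(1 / 4) ^ m"
  for Q l \<Phi> m a +
  fixes \<kappa> K C :: real
  assumes a_Suc: "a (Suc m) = 1" and a_big: "\<And>j. j \<le> m \<Longrightarrow> 4 ^ m \<le> a j"
    and \<kappa>: "0 < \<kappa>" "\<kappa> < 1" and C: "0 < C"
    and K: "4 \<le> K" "C * exp (- (K * \<kappa> / 2)) \<le> exp (- 1 / 2) / 8"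
    and large: "32 \<le> real m + 2"
      "3 / 2 * (real m + 2) * (1 / 2) ^ m + 5 * (1 / 2) ^ m \<le> 1 / (real m + 2)"
      "(1 / 2) ^ m * (real m + 2) / 2 + (real m + 2) * exp (- ((K - 2)\<^sup>2 * (real m + 2) / 2)) +
        (1 / 2) ^ m * (1 + (K - \<kappa> / 2)\<^sup>2) / (2 * (real m + 2))
        \<le> sqrt (1 / (real m + 3)) * exp (- ((K + 2)\<^sup>2 / 2)) / 2"
      "(C + 1) * (exp (- ((K - 2)\<^sup>2 * (real m + 2) / 2)) + 1 / (real m + 2)\<^sup>2) + 32 * C / (real m + 2)\<^sup>2
        < exp (- 1 / 2) * sqrt (1 / (real m + 3)) * exp (- ((K - \<kappa> / 2)\<^sup>2 / 2)) / (8 * (real m + 2))"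
    and l_large: "(real m + 4) * (real m + 2)\<^sup>2 \<le> l"
begin

definition \<Lambda> where "\<Lambda> = real m + 2"
text \<open>Bounds both the factor by which a huge jump flattens a Gaussian (up to
  \<open>sqrt c\<close>) and the total variance of the tail.\<close>

definition q where "q = (1 / 2 :: real) ^ m"
text \<open>The value of the target Gaussian at distance \<open>K - 2\<close> from its centre, hence
  its maximum on \<open>[-2, 2]\<close>.\<close>

definition \<delta> where "\<delta> = exp (- ((K - 2)\<^sup>2 * \<Lambda> / 2))"
definition \<epsilon> where "\<epsilon> = 1 / \<Lambda>\<^sup>2"
definition b where "b = 1 / \<Lambda>"
text \<open>What a jump of variance 1 makes of the target Gaussian;
  \<open>1 / \<Lambda> * p x\<close> is the leading term of the solution inside the ball.\<close>

definition p where "p x = sqrt (b / (b + 1)) * bump (b + 1) (x - K)"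

lemma \<Lambda>: "32 \<le> \<Lambda>" using large(1) by (simp add: \<Lambda>_def)
lemma \<Lambda>_pos: "0 < \<Lambda>" using \<Lambda> by simp
lemma q: "0 < q" "q \<le> 1" by (auto simp: q_def power_le_one)
lemma q_small: "3 / 2 * \<Lambda> * q + 5 * q \<le> 1 / \<Lambda>" using large(2) by (simp add: \<Lambda>_def q_def)
lemma b: "0 < b" "b \<le> 1" using \<Lambda> by (auto simp: b_def)
lemma \<epsilon>: "0 < \<epsilon>" "\<epsilon> \<le> 1 / \<Lambda>" using \<Lambda> by (auto simp: \<epsilon>_def power2_eq_square field_simps)
lemma \<delta>: "0 < \<delta>" by (simp add: \<delta>_def)

lemma var_b: "b / (b + 1) = 1 / (real m + 3)"
proof -
  have "b + 1 = (1 + \<Lambda>) / \<Lambda>" using \<Lambda>_pos by (simp add: b_def field_simps)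
  then have "b / (b + 1) = 1 / (1 + \<Lambda>)" using \<Lambda>_pos by (simp add: b_def)
  then show ?thesis by (simp add: \<Lambda>_def add_ac)
qed

lemma Lbump_sum:
  "(\<Sum>j\<in>{..Suc m}. sqrt (c / (c + a j)) * bump (c + a j) y - bump c y) =
    (\<Sum>j\<le>m. sqrt (c / (c + a j)) * bump (c + a j) y) + sqrt (c / (c + 1)) * bump (c + 1) y - \<Lambda> * bump c y"
  by (simp add: sum_subtractf a_Suc \<Lambda>_def algebra_simps)

lemma q2: "(1 / 4) ^ m \<le> q"
  unfolding q_def by (rule power_mono) auto

text \<open>A huge jump flattens a Gaussian of variance \<open>c\<close> to height at most
  \<open>sqrt c * q\<close>, and there are fewer than \<Lambda> of them. Only the jump of variance 1
  contributes at leading order, and the total rate gives the loss.\<close>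

lemma Lbump_upper:
  assumes c: "0 < c"
  shows "Lbump c y \<le> sqrt (c / (c + 1)) * bump (c + 1) y + \<Lambda> * sqrt c * q + q / (2 * c) - \<Lambda> * bump c y"
proof -
  have "(\<Sum>j\<le>m. sqrt (c / (c + a j)) * bump (c + a j) y) \<le> (\<Sum>j\<le>m. sqrt c * q)"
  proof (rule sum_mono)
    fix j assume "j \<in> {..m}"
    then have aj: "4 ^ m \<le> a j" using a_big by simp
    then have pos: "0 < c + a j" using c by (smt (verit) zero_less_power)
    have "(4::real) ^ m \<le> c + a j" using aj c by simp
    then have "2 ^ m \<le> sqrt (c + a j)"
      by (intro real_le_rsqrt) (simp add: power_mult[symmetric] power2_eq_square power_mult_distrib[symmetric])
    then have "1 / sqrt (c + a j) \<le> 1 / 2 ^ m" by (intro divide_left_mono) (use pos in auto)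
    then have "sqrt c * (1 / sqrt (c + a j)) \<le> sqrt c * q"
      by (intro mult_left_mono) (use c in \<open>auto simp: q_def power_one_over\<close>)
    then have 1: "sqrt (c / (c + a j)) \<le> sqrt c * q" by (simp add: real_sqrt_divide)
    have "sqrt (c / (c + a j)) * bump (c + a j) y \<le> sqrt (c / (c + a j)) * 1"
      by (rule mult_left_mono[OF bump_le_1[OF pos]]) (use c pos in simp)
    then show "sqrt (c / (c + a j)) * bump (c + a j) y \<le> sqrt c * q" using 1 by simp
  qed
  also have "\<dots> = (real m + 1) * (sqrt c * q)" by simp
  also have "\<dots> \<le> \<Lambda> * (sqrt c * q)" by (rule mult_right_mono) (use c q in \<open>auto simp: \<Lambda>_def\<close>)
  finally have 1: "(\<Sum>j\<le>m. sqrt (c / (c + a j)) * bump (c + a j) y) \<le> \<Lambda> * sqrt c * q" by (simp add: mult.assoc)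
  have "(1 / 4) ^ m / (2 * c) \<le> q / (2 * c)" using q2 c by (intro divide_right_mono) auto
  then show ?thesis using Lbump_approx[OF c, of y] 1 unfolding Lbump_sum by linarith
qed

lemma Lbump_lower:
  assumes c: "0 < c"
  shows "sqrt (c / (c + 1)) * bump (c + 1) y - q / (2 * c) - \<Lambda> * bump c y \<le> Lbump c y"
proof -
  have "0 \<le> (\<Sum>j\<le>m. sqrt (c / (c + a j)) * bump (c + a j) y)"
  proof (rule sum_nonneg)
    fix j assume "j \<in> {..m}"
    then have "0 \<le> a j" using a by simp
    then show "0 \<le> sqrt (c / (c + a j)) * bump (c + a j) y"
      using c bump_pos[of "c + a j" y] by simp
  qed
  moreover have "(1 / 4) ^ m / (2 * c) \<le> q / (2 * c)" using q2 c by (intro divide_right_mono) auto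
  ultimately show ?thesis using Lbump_approx[OF c, of y] unfolding Lbump_sum by linarith
qed

definition cutoff where "cutoff x = max 0 (min 1 (2 - \<bar>x :: real\<bar>))"
text \<open>Subtracting \<delta> makes the target vanish on \<open>[-2, 2]\<close>, where the cutoff
  lives, without losing continuity.\<close>

definition target where "target x = max 0 (bump b (x - K) - \<delta>)"
text \<open>The target, its image under one jump of variance 1 divided by the total rate, a
  correction of two-jump order that makes the generator strictly negative on \<open>[-2, 2]\<close>,
  and a constant that serves outside.\<close>

definition upper where
  "upper x = bump b (x - K) + 1 / \<Lambda> * p x + 4 * exp 2 / \<Lambda>\<^sup>2 * bump 1 (x - 0) + \<epsilon>"
definition Lupper where
  "Lupper x = Lbump b (x - K) + 1 / \<Lambda> * (sqrt (b / (b + 1)) * Lbump (b + 1) (x - K)) +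
    4 * exp 2 / \<Lambda>\<^sup>2 * Lbump 1 (x - 0) + 0"
text \<open>The reciprocal of the variance contains the square of the distance from
  \<open>\<kappa> / 2\<close> to the target, so that the steepness of \<open>p\<close> is harmless;
  see \<open>B_bump_le\<close>.\<close>

definition b' where "b' = 1 / (1 + (K - \<kappa> / 2)\<^sup>2)"
definition B where "B = exp (- 1 / 2) * p (\<kappa> / 2) / 2"
text \<open>In place of \<open>p\<close> it carries a narrow Gaussian at
  \<open>\<kappa> / 2\<close>, low enough to use up only half of the gain \<open>p\<close>. The
  negative constants push it below the target minus \<epsilon> as soon as
  \<open>1 \<le> \<bar>x\<bar>\<close>.\<close>

definition lower where
  "lower x = bump b (x - K) + B / \<Lambda> * bump b' (x - \<kappa> / 2) + (- (\<delta> + \<epsilon>) - B / (2 * \<Lambda>))"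
definition Llower where
  "Llower x = Lbump b (x - K) + B / \<Lambda> * Lbump b' (x - \<kappa> / 2) + 0"

lemma exp_2_le: "exp 2 \<le> (8 :: real)"
proof -
  have "exp 2 = (exp 1 :: real)\<^sup>2" by (simp add: power2_eq_square exp_add[symmetric])
  also have "\<dots> \<le> (272 / 100)\<^sup>2" by (rule power_mono) (use e_less_272 in auto)
  also have "\<dots> \<le> 8" by (simp add: power2_eq_square)
  finally show ?thesis .
qed

text \<open>The requirement \<open>32 \<le> \<Lambda>\<close> comes from here: 32 is 4 times the
  bound 8 for \<open>exp 2\<close>.\<close>

lemma coeff_upper: "0 \<le> 4 * exp 2 / \<Lambda>\<^sup>2" "4 * exp 2 / \<Lambda>\<^sup>2 \<le> 32 / \<Lambda>\<^sup>2" "32 / \<Lambda>\<^sup>2 \<le> 1 / \<Lambda>"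
  using \<Lambda> exp_2_le by (auto simp: divide_right_mono power2_eq_square field_simps)

lemma p_pos: "0 < p x"
  using b bump_pos[of "b + 1"] by (simp add: p_def)

lemma p_le_1: "p x \<le> 1"
  using b bump_le_1[of "b + 1" "x - K"] bump_pos[of "b + 1" "x - K"]
  unfolding p_def by (intro mult_le_one) auto

section \<open>The upper barrier\<close>

lemma generates_upper: "generates upper Lupper"
  unfolding upper_def[abs_def] Lupper_def[abs_def] p_def
  by (intro generates_add generates_mult generates_bump generates_const) (use b in auto)

lemma generates_lower: "generates lower Llower"
  unfolding lower_def[abs_def] Llower_def[abs_def]
  by (intro generates_add generates_mult generates_bump generates_const) (use b in \<open>auto simp: b'_def add_pos_nonneg\<close>)

text \<open>The gain \<open>p\<close> of the first term is cancelled by the decay of the second,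
  because \<open>1 / \<Lambda> * p\<close> decays at rate \<Lambda>. The gains of the second and
  third terms and the errors in \<open>q\<close> are at most \<open>1 / \<Lambda>\<close> each. The
  factor 4 in \<open>upper\<close> beats these three with \<open>1 / \<Lambda>\<close> to spare
  wherever \<open>exp 2 * bump 1 x\<close> is at least 1.\<close>

lemma Lupper_le: "Lupper x \<le> 3 / \<Lambda> - 4 / \<Lambda> * (exp 2 * bump 1 x)"
proof -
  have 1: "Lbump b (x - K) \<le> p x + 3 / 2 * \<Lambda> * q"
  proof -
    have "\<Lambda> * sqrt b * q \<le> \<Lambda> * 1 * q"
      by (intro mult_right_mono mult_left_mono) (use b q \<Lambda>_pos in auto)
    moreover have "q / (2 * b) = \<Lambda> * q / 2" by (simp add: b_def)
    moreover have "0 \<le> \<Lambda> * bump b (x - K)" using \<Lambda>_pos bump_pos[of b "x - K"] by simp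
    ultimately show ?thesis using Lbump_upper[OF b(1), of "x - K"] unfolding p_def by linarith
  qed
  have 2: "1 / \<Lambda> * (sqrt (b / (b + 1)) * Lbump (b + 1) (x - K)) \<le> 1 / \<Lambda> + 3 * q - p x"
  proof -
    have c: "0 < b + 1" using b by simp
    have s1: "sqrt ((b + 1) / (b + 1 + 1)) * bump (b + 1 + 1) (x - K) \<le> 1"
      using b bump_le_1[of "b + 1 + 1" "x - K"] bump_pos[of "b + 1 + 1" "x - K"] by (intro mult_le_one) auto
    have s2: "\<Lambda> * sqrt (b + 1) * q \<le> \<Lambda> * 2 * q"
    proof (intro mult_right_mono mult_left_mono)
      show "sqrt (b + 1) \<le> 2" by (rule real_le_lsqrt) (use b in auto)
    qed (use q \<Lambda>_pos in auto)
    have s3: "q / (2 * (b + 1)) \<le> q" using q b by (simp add: field_simps)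
    have s4: "0 \<le> sqrt (b / (b + 1))" "sqrt (b / (b + 1)) \<le> 1" using b by auto
    have "sqrt (b / (b + 1)) * Lbump (b + 1) (x - K) \<le> sqrt (b / (b + 1)) * ((1 + \<Lambda> * 2 * q + q) - \<Lambda> * bump (b + 1) (x - K))"
      by (rule mult_left_mono) (use Lbump_upper[OF c, of "x - K"] s1 s2 s3 s4 in linarith)+
    also have "\<dots> = sqrt (b / (b + 1)) * (1 + \<Lambda> * 2 * q + q) - \<Lambda> * p x"
      by (simp add: p_def algebra_simps)
    also have "sqrt (b / (b + 1)) * (1 + \<Lambda> * 2 * q + q) \<le> 1 * (1 + \<Lambda> * 2 * q + q)"
      by (rule mult_right_mono[OF s4(2)]) (use q \<Lambda>_pos in simp)
    finally have "sqrt (b / (b + 1)) * Lbump (b + 1) (x - K) \<le> 1 + \<Lambda> * 2 * q + q - \<Lambda> * p x" by simp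
    then have "1 / \<Lambda> * (sqrt (b / (b + 1)) * Lbump (b + 1) (x - K)) \<le> 1 / \<Lambda> * (1 + \<Lambda> * 2 * q + q - \<Lambda> * p x)"
      by (rule mult_left_mono) (use \<Lambda>_pos in simp)
    also have "\<dots> = 1 / \<Lambda> + 2 * q + q / \<Lambda> - p x" using \<Lambda>_pos by (simp add: field_simps)
    also have "q / \<Lambda> \<le> q" using q \<Lambda> by (simp add: field_simps)
    finally show ?thesis by simp
  qed
  have 3: "4 * exp 2 / \<Lambda>\<^sup>2 * Lbump 1 (x - 0) \<le> 1 / \<Lambda> + 2 * q - 4 / \<Lambda> * (exp 2 * bump 1 x)"
  proof -
    have s1: "sqrt (1 / (1 + 1)) * bump (1 + 1) (x - 0) \<le> 1"
      using bump_le_1[of "1 + 1" "x - 0"] bump_pos[of "1 + 1" "x - 0"] by (intro mult_le_one) auto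
    have "Lbump 1 (x - 0) \<le> (1 + \<Lambda> * q + q) - \<Lambda> * bump 1 x"
      using Lbump_upper[of 1 "x - 0"] s1 q by simp
    then have "4 * exp 2 / \<Lambda>\<^sup>2 * Lbump 1 (x - 0) \<le> 4 * exp 2 / \<Lambda>\<^sup>2 * ((1 + \<Lambda> * q + q) - \<Lambda> * bump 1 x)"
      by (rule mult_left_mono) (use coeff_upper in simp)
    also have "\<dots> = 4 * exp 2 / \<Lambda>\<^sup>2 * (1 + \<Lambda> * q + q) - 4 / \<Lambda> * (exp 2 * bump 1 x)"
      using \<Lambda>_pos by (simp add: power2_eq_square right_diff_distrib)
    also have "4 * exp 2 / \<Lambda>\<^sup>2 * (1 + \<Lambda> * q + q) \<le> 1 / \<Lambda> * (1 + \<Lambda> * q + q)"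
      by (rule mult_right_mono) (use coeff_upper q \<Lambda>_pos in auto)
    also have "1 / \<Lambda> * (1 + \<Lambda> * q + q) = 1 / \<Lambda> + q + q / \<Lambda>" using \<Lambda>_pos by (simp add: field_simps)
    also have "q / \<Lambda> \<le> q" using q \<Lambda> by (simp add: field_simps)
    finally show ?thesis by simp
  qed
  have "1 / \<Lambda> + (1 / \<Lambda> + 1 / \<Lambda>) = 3 / \<Lambda>" by simp
  then show ?thesis unfolding Lupper_def using 1 2 3 q_small by linarith
qed

lemma Lupper_le_inside:
  assumes "\<bar>x\<bar> \<le> 2"
  shows "Lupper x \<le> - 1 / \<Lambda>"
proof -
  have "x\<^sup>2 \<le> 2\<^sup>2" using assms abs_le_square_iff[of x 2] by simp
  then have "1 \<le> exp (2 + - (x\<^sup>2 / 2))" by simp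
  then have "1 \<le> exp 2 * bump 1 x" unfolding exp_add by (simp add: bump_def)
  then have "4 / \<Lambda> * 1 \<le> 4 / \<Lambda> * (exp 2 * bump 1 x)" by (rule mult_left_mono) (use \<Lambda>_pos in simp)
  then have "Lupper x \<le> 3 / \<Lambda> - 4 / \<Lambda>" using Lupper_le[of x] by simp
  then show ?thesis by (simp add: field_simps)
qed

lemma Lupper_le_global: "Lupper x \<le> 3 / \<Lambda>"
proof -
  have "0 \<le> 4 / \<Lambda> * (exp 2 * bump 1 x)" using \<Lambda>_pos bump_pos[of 1 x] by simp
  then show ?thesis using Lupper_le[of x] by linarith
qed

text \<open>This is what \<open>l\<close> is chosen for: outside of \<open>[-2, 2]\<close> the
  constant \<epsilon> compensates the worst value of the generator of either barrier.\<close>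

lemma l_\<epsilon>: "\<Lambda> + 2 \<le> l * \<epsilon>"
  using l_large \<Lambda>_pos by (simp add: \<epsilon>_def \<Lambda>_def field_simps)

lemma bump_inside_le:
  assumes "\<bar>x\<bar> \<le> 2"
  shows "bump b (x - K) \<le> \<delta>"
proof -
  have "(K - 2)\<^sup>2 \<le> (K - x)\<^sup>2" by (rule power_mono) (use assms K in auto)
  then have "(K - 2)\<^sup>2 * \<Lambda> / 2 \<le> (x - K)\<^sup>2 * \<Lambda> / 2"
    using \<Lambda>_pos by (simp add: power2_commute[of x K])
  then show ?thesis using \<Lambda>_pos by (simp add: bump_def \<delta>_def b_def)
qed

lemma target_inside: "\<bar>x\<bar> \<le> 2 \<Longrightarrow> target x = 0"
  using bump_inside_le[of x] by (simp add: target_def)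

lemma target_nonneg: "0 \<le> target x"
  by (simp add: target_def)

lemma target_le: "target x \<le> bump b (x - K)"
  using bump_pos[of b "x - K"] \<delta> by (simp add: target_def)

lemma target_ge: "bump b (x - K) - \<delta> \<le> target x"
  by (simp add: target_def)

lemma cutoff_bounds: "0 \<le> cutoff x" "cutoff x \<le> 1"
  by (auto simp: cutoff_def)

lemma cutoff_inside: "\<bar>x\<bar> \<le> 1 \<Longrightarrow> cutoff x = 1"
  by (simp add: cutoff_def)

lemma cutoff_outside: "2 \<le> \<bar>x\<bar> \<Longrightarrow> cutoff x = 0"
  by (simp add: cutoff_def)

lemma upper_ge: "bump b (x - K) + \<epsilon> \<le> upper x"
proof -
  have "0 \<le> 1 / \<Lambda> * p x" "0 \<le> 4 * exp 2 / \<Lambda>\<^sup>2 * bump 1 (x - 0)"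
    using \<Lambda>_pos p_pos[of x] bump_pos[of 1 "x - 0"] by auto
  then show ?thesis unfolding upper_def by linarith
qed

lemma upper_le_2: "upper x \<le> 2"
proof -
  have "1 / \<Lambda> * p x \<le> 1 / \<Lambda> * 1" by (rule mult_left_mono[OF p_le_1]) (use \<Lambda>_pos in simp)
  moreover have "4 * exp 2 / \<Lambda>\<^sup>2 * bump 1 (x - 0) \<le> 1 / \<Lambda> * 1"
    by (rule mult_mono) (use coeff_upper bump_le_1[of 1 "x - 0"] bump_pos[of 1 "x - 0"] \<Lambda>_pos in auto)
  moreover have "1 / \<Lambda> \<le> 1 / 32" using \<Lambda> by (intro divide_left_mono) auto
  ultimately show ?thesis unfolding upper_def using bump_le_1[OF b(1), of "x - K"] \<epsilon> by linarith
qed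

lemma upper_pos: "0 < upper x"
  using upper_ge[of x] bump_pos[of b "x - K"] \<epsilon> by linarith

text \<open>The extra factor uses the strict negativity on \<open>[-2, 2]\<close>: as
  \<open>upper\<close> is at most 2, it costs at most \<open>1 / \<Lambda>\<close>. It is what makes
  the operator in the fixed point equation a contraction.\<close>

lemma upper_supersolution:
  "l * ((1 + 1 / (2 * \<Lambda> * l)) * (cutoff x * upper x) + target x) \<le> l * upper x - Lupper x"
proof (cases "\<bar>x\<bar> \<le> 2")
  case True
  have "l * ((1 + 1 / (2 * \<Lambda> * l)) * (cutoff x * upper x)) = (l + 1 / (2 * \<Lambda>)) * (cutoff x * upper x)"
    using l \<Lambda>_pos by (simp add: field_simps)
  also have "\<dots> \<le> (l + 1 / (2 * \<Lambda>)) * (1 * upper x)"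
    by (intro mult_left_mono mult_right_mono) (use cutoff_bounds[of x] upper_pos[of x] l \<Lambda>_pos in auto)
  also have "\<dots> = l * upper x + 1 / (2 * \<Lambda>) * upper x" by (simp add: algebra_simps)
  also have "1 / (2 * \<Lambda>) * upper x \<le> 1 / (2 * \<Lambda>) * 2"
    by (rule mult_left_mono[OF upper_le_2]) (use \<Lambda>_pos in simp)
  finally show ?thesis using Lupper_le_inside[OF True] target_inside[OF True] by simp
next
  case False
  have "l * target x \<le> l * (upper x - \<epsilon>)"
    by (rule mult_left_mono) (use target_le[of x] upper_ge[of x] l in auto)
  moreover have "3 / \<Lambda> \<le> l * \<epsilon>"
  proof -
    have "3 / \<Lambda> \<le> 3" using \<Lambda> by (simp add: field_simps)
    then show ?thesis using l_\<epsilon> \<Lambda> by linarith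
  qed
  ultimately have "l * target x \<le> l * upper x - Lupper x"
    using Lupper_le_global[of x] by (simp add: right_diff_distrib)
  then show ?thesis using False by (simp add: cutoff_outside)
qed

lemma continuous:
  "continuous_on UNIV cutoff" "continuous_on UNIV target" "continuous_on UNIV upper" "continuous_on UNIV lower"
proof -
  have "0 < b'" by (simp add: b'_def add_pos_nonneg)
  then show "continuous_on UNIV cutoff" "continuous_on UNIV target" "continuous_on UNIV upper" "continuous_on UNIV lower"
    unfolding cutoff_def[abs_def] target_def[abs_def] upper_def[abs_def] p_def lower_def[abs_def]
    using b \<Lambda>_pos by (auto intro!: continuous_intros)
qed

section \<open>The lower barrier\<close>

lemma p_kappa: "sqrt (1 / (real m + 3)) * exp (- ((K - \<kappa> / 2)\<^sup>2 / 2)) \<le> p (\<kappa> / 2)"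
proof -
  have "(K - \<kappa> / 2)\<^sup>2 / (2 * (b + 1)) \<le> (K - \<kappa> / 2)\<^sup>2 / 2"
    by (rule divide_left_mono) (use b in auto)
  then show ?thesis
    unfolding p_def var_b by (intro mult_left_mono) (simp_all add: bump_def power2_commute[of "\<kappa> / 2" K])
qed

lemma p_inside:
  assumes "\<bar>x\<bar> \<le> 2"
  shows "sqrt (1 / (real m + 3)) * exp (- ((K + 2)\<^sup>2 / 2)) \<le> p x"
proof -
  have "(x - K)\<^sup>2 / (2 * (b + 1)) \<le> (x - K)\<^sup>2 / 2"
    by (rule divide_left_mono) (use b in auto)
  also have "(x - K)\<^sup>2 \<le> (K + 2)\<^sup>2"
    unfolding power2_commute[of x K] by (rule power_mono) (use assms K in auto)
  finally have "(x - K)\<^sup>2 / (2 * (b + 1)) \<le> (K + 2)\<^sup>2 / 2" by simp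
  then show ?thesis
    unfolding p_def var_b by (intro mult_left_mono) (simp_all add: bump_def)
qed

text \<open>The squared distances of the two points to \<open>K\<close> differ by
  \<open>2 * K * \<kappa>\<close>, and the variance \<open>b + 1\<close> is at most 2. This is the
  source of the unbounded Harnack ratio.\<close>

lemma p_reflected: "p (- \<kappa> / 2) \<le> exp (- (K * \<kappa> / 2)) * p (\<kappa> / 2)"
proof -
  have "K * \<kappa> / 2 \<le> K * \<kappa> / (b + 1)"
    by (rule divide_left_mono) (use b K \<kappa> in auto)
  moreover have "(- \<kappa> / 2 - K)\<^sup>2 / (2 * (b + 1)) = (\<kappa> / 2 - K)\<^sup>2 / (2 * (b + 1)) + K * \<kappa> / (b + 1)"
  proof -
    have "(- \<kappa> / 2 - K)\<^sup>2 = (\<kappa> / 2 - K)\<^sup>2 + 2 * (K * \<kappa>)" by (simp add: power2_eq_square algebra_simps)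
    moreover have "2 * (K * \<kappa>) / (2 * (b + 1)) = K * \<kappa> / (b + 1)" by (rule mult_divide_mult_cancel_left) simp
    ultimately show ?thesis by (simp only: add_divide_distrib)
  qed
  ultimately have "- ((- \<kappa> / 2 - K)\<^sup>2 / (2 * (b + 1))) \<le> - (K * \<kappa> / 2) + - ((\<kappa> / 2 - K)\<^sup>2 / (2 * (b + 1)))"
    by linarith
  then have "bump (b + 1) (- \<kappa> / 2 - K) \<le> exp (- (K * \<kappa> / 2)) * bump (b + 1) (\<kappa> / 2 - K)"
    unfolding bump_def exp_add[symmetric] by (simp only: exp_le_cancel_iff)
  then have "sqrt (b / (b + 1)) * bump (b + 1) (- \<kappa> / 2 - K) \<le>
      sqrt (b / (b + 1)) * (exp (- (K * \<kappa> / 2)) * bump (b + 1) (\<kappa> / 2 - K))"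
    by (rule mult_left_mono) (use b in simp)
  then show ?thesis by (simp only: p_def mult_ac)
qed

lemma B: "0 < B" "B \<le> 1"
proof -
  show "0 < B" using p_pos by (simp add: B_def)
  have "exp (- 1 / 2) * p (\<kappa> / 2) \<le> 1 * 1"
    by (rule mult_mono) (use p_le_1 p_pos[of "\<kappa> / 2"] in auto)
  then show "B \<le> 1" by (simp add: B_def)
qed

text \<open>Moving away from \<open>\<kappa> / 2\<close>, the exponent of \<open>p\<close> changes
  by a linear and a quadratic term. The arithmetic-geometric mean inequality bounds the linear one
  by a constant and a multiple of the square; the constant is paid by the factor
  \<open>exp (- 1 / 2)\<close> in \<open>B\<close>, the squares by \<open>b'\<close>.\<close>

lemma B_bump_le: "B * bump b' (x - \<kappa> / 2) \<le> p x / 2"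
proof -
  define M where "M = K - \<kappa> / 2"
  define y where "y = x - \<kappa> / 2"
  have "2 * \<bar>y * M\<bar> \<le> y\<^sup>2 * M\<^sup>2 + 1"
    using zero_le_power2[of "\<bar>y * M\<bar> - 1"] by (simp add: power2_diff power_mult_distrib)
  then have "- (2 * y * M) \<le> y\<^sup>2 * M\<^sup>2 + 1" using abs_ge_minus_self[of "y * M"] by linarith
  then have "y\<^sup>2 - 2 * y * M \<le> 1 + y\<^sup>2 * (1 + M\<^sup>2)" by (simp add: distrib_left)
  then have "y\<^sup>2 - 2 * y * M \<le> (1 + y\<^sup>2 * (1 + M\<^sup>2)) * (b + 1)"
    using b mult_left_mono[of 1 "b + 1" "1 + y\<^sup>2 * (1 + M\<^sup>2)"] by simp
  then have "(y\<^sup>2 - 2 * y * M) / (2 * (b + 1)) \<le> (1 + y\<^sup>2 * (1 + M\<^sup>2)) / 2"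
    using b by (simp add: field_simps)
  moreover have "(y - M)\<^sup>2 / (2 * (b + 1)) = (y\<^sup>2 - 2 * y * M) / (2 * (b + 1)) + M\<^sup>2 / (2 * (b + 1))"
    by (simp add: add_divide_distrib[symmetric] power2_diff algebra_simps)
  ultimately have "- 1 / 2 + - (M\<^sup>2 / (2 * (b + 1))) + - (y\<^sup>2 * (1 + M\<^sup>2) / 2) \<le> - ((y - M)\<^sup>2 / (2 * (b + 1)))"
    by (simp add: add_divide_distrib)
  then have "exp (- 1 / 2) * exp (- (M\<^sup>2 / (2 * (b + 1)))) * exp (- (y\<^sup>2 * (1 + M\<^sup>2) / 2)) \<le> exp (- ((y - M)\<^sup>2 / (2 * (b + 1))))"
    unfolding exp_add[symmetric] by (simp only: exp_le_cancel_iff)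
  then have "exp (- 1 / 2) * bump (b + 1) (\<kappa> / 2 - K) * bump b' (x - \<kappa> / 2) \<le> bump (b + 1) (x - K)"
    by (simp add: bump_def b'_def M_def y_def power2_commute[of K])
  then have "sqrt (b / (b + 1)) * (exp (- 1 / 2) * bump (b + 1) (\<kappa> / 2 - K) * bump b' (x - \<kappa> / 2)) \<le>
      sqrt (b / (b + 1)) * bump (b + 1) (x - K)"
    by (rule mult_left_mono) (use b in simp)
  then show ?thesis by (simp add: B_def p_def mult_ac)
qed

lemma Llower_ge:
  "p x - q * \<Lambda> / 2 - \<Lambda> * bump b (x - K) - q * (1 + (K - \<kappa> / 2)\<^sup>2) / (2 * \<Lambda>) - B * bump b' (x - \<kappa> / 2) \<le> Llower x"
proof -
  have b'0: "0 < b'" by (simp add: b'_def add_pos_nonneg)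
  have 1: "p x - q * \<Lambda> / 2 - \<Lambda> * bump b (x - K) \<le> Lbump b (x - K)"
    using Lbump_lower[OF b(1), of "x - K"] unfolding p_def by (simp add: b_def)
  have 2: "0 \<le> sqrt (b' / (b' + 1)) * bump (b' + 1) (x - \<kappa> / 2)"
    using b'0 bump_pos[of "b' + 1" "x - \<kappa> / 2"] by simp
  have "- (q / (2 * b')) - \<Lambda> * bump b' (x - \<kappa> / 2) \<le> Lbump b' (x - \<kappa> / 2)"
    using Lbump_lower[OF b'0, of "x - \<kappa> / 2"] 2 by linarith
  then have "B / \<Lambda> * (- (q / (2 * b')) - \<Lambda> * bump b' (x - \<kappa> / 2)) \<le> B / \<Lambda> * Lbump b' (x - \<kappa> / 2)"
    by (rule mult_left_mono) (use B \<Lambda>_pos in simp)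
  moreover have "B / \<Lambda> * (- (q / (2 * b')) - \<Lambda> * bump b' (x - \<kappa> / 2)) =
    - (B * (q * (1 + (K - \<kappa> / 2)\<^sup>2) / (2 * \<Lambda>))) - B * bump b' (x - \<kappa> / 2)"
    using \<Lambda>_pos by (simp add: b'_def right_diff_distrib)
  moreover have "B * (q * (1 + (K - \<kappa> / 2)\<^sup>2) / (2 * \<Lambda>)) \<le> 1 * (q * (1 + (K - \<kappa> / 2)\<^sup>2) / (2 * \<Lambda>))"
    by (rule mult_right_mono) (use B q \<Lambda>_pos in auto)
  ultimately show ?thesis using 1 unfolding Llower_def by linarith
qed

lemma small_terms:
  "q * \<Lambda> / 2 + \<Lambda> * \<delta> + q * (1 + (K - \<kappa> / 2)\<^sup>2) / (2 * \<Lambda>) \<le> sqrt (1 / (real m + 3)) * exp (- ((K + 2)\<^sup>2 / 2)) / 2"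
  using large(3) by (simp only: q_def \<Lambda>_def \<delta>_def)

text \<open>The jump of variance 1 gives the target term a gain of \<open>p\<close>. Half of it pays
  for the decay of the narrow Gaussian, the other half for the errors.\<close>

lemma Llower_inside:
  assumes "\<bar>x\<bar> \<le> 2"
  shows "0 \<le> Llower x"
proof -
  have "\<Lambda> * bump b (x - K) \<le> \<Lambda> * \<delta>"
    by (rule mult_left_mono[OF bump_inside_le[OF assms]]) (use \<Lambda>_pos in simp)
  then show ?thesis
    using Llower_ge[of x] B_bump_le[of x] p_inside[OF assms] small_terms by linarith
qed

lemma Llower_global: "- (\<Lambda> + 2) \<le> Llower x"
proof -
  have "\<Lambda> * bump b (x - K) \<le> \<Lambda> * 1"
    by (rule mult_left_mono[OF bump_le_1[OF b(1)]]) (use \<Lambda>_pos in simp)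
  moreover have "sqrt (1 / (real m + 3)) * exp (- ((K + 2)\<^sup>2 / 2)) \<le> 1 * 1"
    by (rule mult_mono) auto
  moreover have "0 \<le> \<Lambda> * \<delta>" using \<Lambda>_pos \<delta> by simp
  ultimately show ?thesis
    using Llower_ge[of x] B_bump_le[of x] p_le_1[of x] p_pos[of x] small_terms by linarith
qed

text \<open>Points with \<open>1 \<le> \<bar>x\<bar>\<close> are at least 1/2 away from
  \<open>\<kappa> / 2\<close>, where the narrow Gaussian has dropped below one half; the constant
  \<open>B / (2 * \<Lambda>)\<close> therefore swallows it.\<close>

lemma lower_outside:
  assumes "1 \<le> \<bar>x\<bar>"
  shows "lower x \<le> bump b (x - K) - \<delta> - \<epsilon>"
proof -
  have "1 / 2 \<le> \<bar>x - \<kappa> / 2\<bar>" using assms \<kappa> by linarith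
  then have "(1 / 2)\<^sup>2 \<le> (x - \<kappa> / 2)\<^sup>2" using abs_le_square_iff[of "1 / 2" "x - \<kappa> / 2"] by simp
  moreover have "3\<^sup>2 \<le> (K - \<kappa> / 2)\<^sup>2" by (rule power_mono) (use K \<kappa> in auto)
  ultimately have "(1 / 2)\<^sup>2 * (1 + 3\<^sup>2) \<le> (x - \<kappa> / 2)\<^sup>2 * (1 + (K - \<kappa> / 2)\<^sup>2)"
    by (intro mult_mono) auto
  then have "1 \<le> (x - \<kappa> / 2)\<^sup>2 * (1 + (K - \<kappa> / 2)\<^sup>2) / 2" by (simp add: power2_eq_square)
  then have "bump b' (x - \<kappa> / 2) \<le> exp (- 1)" by (simp add: bump_def b'_def)
  also have "\<dots> \<le> 1 / 2"
    using exp_ge_add_one_self[of "1::real"] by (simp add: exp_minus field_simps)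
  finally have "B / \<Lambda> * bump b' (x - \<kappa> / 2) \<le> B / \<Lambda> * (1 / 2)"
    by (rule mult_left_mono) (use B \<Lambda>_pos in simp)
  then show ?thesis unfolding lower_def by simp
qed

text \<open>Where the cutoff is 1, the sign of the generator decides. Where it interpolates,
  \<open>lower\<close> is negative, so damping it only helps. Beyond that, \<epsilon> times
  \<open>l\<close> outweighs the generator.\<close>

lemma lower_subsolution: "l * lower x - Llower x \<le> l * (cutoff x * lower x + target x)"
proof -
  consider "\<bar>x\<bar> \<le> 1" | "1 < \<bar>x\<bar>" "\<bar>x\<bar> \<le> 2" | "2 < \<bar>x\<bar>" by linarith
  then show ?thesis
  proof cases
    case 1
    then have "l * (cutoff x * lower x + target x) = l * lower x + l * target x"
      by (simp add: cutoff_inside distrib_left)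
    moreover have "0 \<le> l * target x" using target_nonneg[of x] l by simp
    ultimately show ?thesis using Llower_inside[of x] 1 by linarith
  next
    case 2
    have "lower x \<le> 0" using lower_outside[of x] bump_inside_le[of x] 2 \<epsilon> by linarith
    then have "1 * lower x \<le> cutoff x * lower x" by (rule mult_right_mono_neg[OF cutoff_bounds(2)])
    then have "lower x \<le> cutoff x * lower x + target x" using target_nonneg[of x] by simp
    then have "l * lower x \<le> l * (cutoff x * lower x + target x)" by (rule mult_left_mono) (use l in simp)
    then show ?thesis using Llower_inside[of x] 2 by linarith
  next
    case 3
    have "lower x + \<epsilon> \<le> target x" using lower_outside[of x] target_ge[of x] 3 by linarith
    then have "l * (lower x + \<epsilon>) \<le> l * target x" by (rule mult_left_mono) (use l in simp)
    then show ?thesis using l_\<epsilon> Llower_global[of x] 3 by (simp add: cutoff_outside distrib_left)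
  qed
qed

text \<open>In units of \<open>B / (4 * \<Lambda>)\<close>: \<open>lower\<close> is at least two
  units at \<open>\<kappa> / 2\<close> up to \<open>\<delta> + \<epsilon>\<close>. The leading term
  of \<open>C * upper\<close> at the reflected point takes one unit by the choice of
  \<open>K\<close>, and all errors of order -2 in \<Lambda> together take less than the
  other.\<close>

lemma barriers_separate: "C * upper (- \<kappa> / 2) < lower (\<kappa> / 2)"
proof -
  have s: "exp (- 1 / 2) * sqrt (1 / (real m + 3)) * exp (- ((K - \<kappa> / 2)\<^sup>2 / 2)) / (8 * \<Lambda>) \<le> B / (4 * \<Lambda>)"
  proof -
    have "exp (- 1 / 2) * (sqrt (1 / (real m + 3)) * exp (- ((K - \<kappa> / 2)\<^sup>2 / 2))) / (8 * \<Lambda>) \<le>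
      exp (- 1 / 2) * p (\<kappa> / 2) / (8 * \<Lambda>)"
      by (intro divide_right_mono mult_left_mono p_kappa) (use \<Lambda>_pos in auto)
    then show ?thesis by (simp add: B_def mult.assoc)
  qed
  have d: "(C + 1) * (\<delta> + \<epsilon>) + 32 * C / \<Lambda>\<^sup>2 < B / (4 * \<Lambda>)"
    using large(4) s by (simp only: \<delta>_def \<epsilon>_def \<Lambda>_def)
  have "upper (- \<kappa> / 2) \<le> \<delta> + 1 / \<Lambda> * p (- \<kappa> / 2) + 32 / \<Lambda>\<^sup>2 + \<epsilon>"
  proof -
    have "4 * exp 2 / \<Lambda>\<^sup>2 * bump 1 (- \<kappa> / 2 - 0) \<le> 32 / \<Lambda>\<^sup>2 * 1"
      by (rule mult_mono[OF coeff_upper(2) bump_le_1]) (use bump_pos[of 1 "- \<kappa> / 2 - 0"] in auto)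
    moreover have "bump b (- \<kappa> / 2 - K) \<le> \<delta>" by (rule bump_inside_le) (use \<kappa> in auto)
    ultimately show ?thesis unfolding upper_def by linarith
  qed
  then have "C * upper (- \<kappa> / 2) \<le> C * (\<delta> + 1 / \<Lambda> * p (- \<kappa> / 2) + 32 / \<Lambda>\<^sup>2 + \<epsilon>)"
    by (rule mult_left_mono) (use C in simp)
  also have "\<dots> = C * (\<delta> + \<epsilon>) + 32 * C / \<Lambda>\<^sup>2 + 1 / \<Lambda> * (C * p (- \<kappa> / 2))" by (simp add: algebra_simps)
  also have "1 / \<Lambda> * (C * p (- \<kappa> / 2)) \<le> 1 / \<Lambda> * (B / 4)"
  proof (rule mult_left_mono)
    have "C * p (- \<kappa> / 2) \<le> C * (exp (- (K * \<kappa> / 2)) * p (\<kappa> / 2))"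
      by (rule mult_left_mono[OF p_reflected]) (use C in simp)
    also have "\<dots> = (C * exp (- (K * \<kappa> / 2))) * p (\<kappa> / 2)" by simp
    also have "\<dots> \<le> exp (- 1 / 2) / 8 * p (\<kappa> / 2)"
      by (rule mult_right_mono[OF K(2)]) (use p_pos[of "\<kappa> / 2"] in simp)
    finally show "C * p (- \<kappa> / 2) \<le> B / 4" by (simp add: B_def)
  qed (use \<Lambda>_pos in simp)
  finally have up: "C * upper (- \<kappa> / 2) \<le> C * (\<delta> + \<epsilon>) + 32 * C / \<Lambda>\<^sup>2 + B / (4 * \<Lambda>)" by simp
  have "B / \<Lambda> * bump b' (\<kappa> / 2 - \<kappa> / 2) = B / (4 * \<Lambda>) + B / (4 * \<Lambda>) + B / (2 * \<Lambda>)"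
    using \<Lambda>_pos by (simp add: bump_def field_simps)
  then have "lower (\<kappa> / 2) = bump b (\<kappa> / 2 - K) + (B / (4 * \<Lambda>) + B / (4 * \<Lambda>)) - (\<delta> + \<epsilon>)"
    unfolding lower_def by simp
  then show ?thesis using up d bump_pos[of b "\<kappa> / 2 - K"] by (simp add: distrib_right)
qed

theorem harnack_ratio_large:
  obtains H f where "continuous_on UNIV H" "\<And>x. 0 \<le> H x" "\<And>x. H x \<le> 3"
    "continuous_on UNIV f" "\<And>x. \<bar>f x\<bar> \<le> 3"
    "\<And>x. H x = (LINT v|Q. f (x + v))" "\<And>x. \<bar>x\<bar> < 1 \<Longrightarrow> f x = H x"
    "C * H (- \<kappa> / 2) < H (\<kappa> / 2)"
proof -
  \<comment> \<open>The margin in \<open>upper_supersolution\<close>; it yields the contraction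
    factor \<open>1 / (1 + c)\<close>.\<close>
  define c where "c = 1 / (2 * \<Lambda> * l)"
  have c: "0 < c" using \<Lambda>_pos l by (simp add: c_def)
  have [measurable]: "cutoff \<in> borel_measurable borel" "target \<in> borel_measurable borel"
      "upper \<in> borel_measurable borel" "lower \<in> borel_measurable borel"
    using continuous by (auto intro: borel_measurable_continuous_onI)
  have ku: "0 \<le> cutoff x * upper x" "cutoff x * upper x \<le> 2" for x
    using cutoff_bounds[of x] upper_pos[of x] upper_le_2[of x] mult_mono[of "cutoff x" 1 "upper x" 2] by auto
  have t1: "target x \<le> 1" for x using target_le[of x] bump_le_1[OF b(1), of "x - K"] by linarith
  have contr: "(LINT v|Q. cutoff (x + v) * upper (x + v)) \<le> 1 / (1 + c) * upper x" for x
  proof -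
    have "(LINT v|Q. (1 + c) * (cutoff (x + v) * upper (x + v))) \<le> upper x"
    proof (rule supersolution[OF generates_upper, where c = "(1 + c) * 2"])
      show "\<bar>(1 + c) * (cutoff x * upper x)\<bar> \<le> (1 + c) * 2" for x
        unfolding abs_mult[of "1 + c"] by (rule mult_mono) (use ku[of x] c in auto)
      show "l * ((1 + c) * (cutoff x * upper x)) \<le> l * upper x - Lupper x" for x
      proof -
        have "0 \<le> l * target x" using l target_nonneg[of x] by simp
        then show ?thesis
          using upper_supersolution[of x] unfolding c_def[symmetric] distrib_left[of l] by linarith
      qed
    qed measurable
    then have "(1 + c) * (LINT v|Q. cutoff (x + v) * upper (x + v)) \<le> upper x"
      by (simp only: Bochner_Integration.integral_mult_right_zero)
    then have "(LINT v|Q. cutoff (x + v) * upper (x + v)) \<le> upper x / (1 + c)"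
      using c by (simp add: pos_le_divide_eq mult.commute)
    then show ?thesis by simp
  qed
  have super: "(LINT v|Q. cutoff (x + v) * upper (x + v) + target (x + v)) \<le> upper x" for x
  proof (rule supersolution[OF generates_upper, where c = 3])
    show "\<bar>cutoff x * upper x + target x\<bar> \<le> 3" for x
      using ku[of x] t1[of x] target_nonneg[of x] by simp
    show "l * (cutoff x * upper x + target x) \<le> l * upper x - Lupper x" for x
    proof -
      have "0 \<le> l * (c * (cutoff x * upper x))" using l c ku[of x] by simp
      then show ?thesis
        using upper_supersolution[of x] unfolding c_def[symmetric] by (simp add: distrib_left distrib_right)
    qed
  qed measurable
  have upper_\<epsilon>: "\<epsilon> \<le> upper x" for x using upper_ge[of x] bump_pos[of b "x - K"] by linarith
  have t2: "target x \<le> 2" for x using t1[of x] by linarith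
  have \<rho>: "0 \<le> 1 / (1 + c)" "1 / (1 + c) < 1" using c by auto
  show ?thesis
  proof (rule obtain_barrier_fixed_point[OF prob_space_axioms sets_Q continuous(1) cutoff_bounds continuous(2)
      target_nonneg t2 continuous(3) upper_\<epsilon> upper_le_2 \<epsilon>(1) \<rho> contr super])
    fix H
    assume H: "continuous_on UNIV H" "\<And>x. 0 \<le> H x" "\<And>x. H x \<le> upper x"
      "\<And>x. H x = (LINT v|Q. cutoff (x + v) * H (x + v) + target (x + v))"
      and comp: "\<And>u c x. continuous_on UNIV u \<Longrightarrow> (\<And>x. \<bar>u x\<bar> \<le> c) \<Longrightarrow>
        (\<And>x. u x \<le> (LINT v|Q. cutoff (x + v) * u (x + v) + target (x + v))) \<Longrightarrow> u x \<le> H x"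
    have H3: "H x \<le> 3" for x using H(3)[of x] upper_le_2[of x] by linarith
    have low: "lower (\<kappa> / 2) \<le> H (\<kappa> / 2)"
    proof (rule comp[OF continuous(4)])
      have b'0: "0 < b'" by (simp add: b'_def add_pos_nonneg)
      define D where "D = 1 + B / \<Lambda> + (\<delta> + \<epsilon> + B / (2 * \<Lambda>))"
      show bd: "\<bar>lower x\<bar> \<le> D" for x
      proof -
        have "0 \<le> B / \<Lambda> * bump b' (x - \<kappa> / 2)"
          using B \<Lambda>_pos bump_pos[of b' "x - \<kappa> / 2"] by simp
        moreover have "B / \<Lambda> * bump b' (x - \<kappa> / 2) \<le> B / \<Lambda> * 1"
          by (rule mult_left_mono[OF bump_le_1[OF b'0]]) (use B \<Lambda>_pos in simp)
        moreover have "0 < B / (2 * \<Lambda>)" using B \<Lambda>_pos by simp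
        ultimately show ?thesis
          unfolding lower_def D_def using bump_pos[of b "x - K"] bump_le_1[OF b(1), of "x - K"] \<delta> \<epsilon>(1) by linarith
      qed
      show "lower x \<le> (LINT v|Q. cutoff (x + v) * lower (x + v) + target (x + v))" for x
      proof (rule subsolution[OF generates_lower, where c = "D + 1"])
        show "\<bar>cutoff x * lower x + target x\<bar> \<le> D + 1" for x
        proof -
          have "\<bar>cutoff x * lower x\<bar> \<le> 1 * \<bar>lower x\<bar>"
            unfolding abs_mult by (rule mult_right_mono) (use cutoff_bounds[of x] in auto)
          then show ?thesis using bd[of x] t1[of x] target_nonneg[of x] by linarith
        qed
      qed (measurable, rule lower_subsolution)
    qed
    have "C * H (- \<kappa> / 2) \<le> C * upper (- \<kappa> / 2)" by (rule mult_left_mono[OF H(3)]) (use C in simp)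
    then have ratio: "C * H (- \<kappa> / 2) < H (\<kappa> / 2)" using barriers_separate low by linarith
    show ?thesis
    proof (rule that[OF H(1,2) H3, of "\<lambda>x. cutoff x * H x + target x"])
      show "continuous_on UNIV (\<lambda>x. cutoff x * H x + target x)" using continuous H(1) by (intro continuous_intros)
      show "\<bar>cutoff x * H x + target x\<bar> \<le> 3" for x
      proof -
        have "H x \<le> 2" using H(3)[of x] upper_le_2[of x] by linarith
        then have "cutoff x * H x \<le> 1 * 2" by (intro mult_mono) (use cutoff_bounds[of x] H(2)[of x] in auto)
        moreover have "0 \<le> cutoff x * H x" using cutoff_bounds[of x] H(2)[of x] by simp
        ultimately show ?thesis using t1[of x] target_nonneg[of x] by linarith
      qed
      show "cutoff x * H x + target x = H x" if "\<bar>x\<bar> < 1" for x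
        using that by (simp add: cutoff_inside target_inside)
    qed (rule H(4) ratio)+
  qed
qed

end

section \<open>Failure of the Harnack inequality\<close>

lemma jump_size_eq: "jump_size j = (1 / 2) ^ (j\<^sup>2)"
  by (simp add: jump_size_def powr_minus powr_realpow[symmetric] power_one_over inverse_eq_divide)

lemma jump_size_pos: "0 < jump_size j"
  by (simp add: jump_size_eq)

text \<open>Consecutive squares differ by \<open>2 * m + 1\<close>, so the gaps between the jump
  sizes widen without bound, although all the rates are equal.\<close>

lemma jump_ratio_big:
  assumes "j \<le> m"
  shows "4 ^ m \<le> jump_size j / jump_size (Suc m)"
proof -
  have "j\<^sup>2 \<le> m\<^sup>2" using assms by (simp add: power_mono)
  then have "j\<^sup>2 + 2 * m \<le> (Suc m)\<^sup>2" by (simp add: power2_eq_square)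
  then have "(1 / 2 :: real) ^ (Suc m)\<^sup>2 \<le> (1 / 2) ^ (j\<^sup>2 + 2 * m)" by (intro power_decreasing) auto
  also have "\<dots> = jump_size j * (1 / 4) ^ m"
    by (simp add: jump_size_eq power_add power_mult power2_eq_square)
  finally have "jump_size (Suc m) * 4 ^ m \<le> jump_size j"
    by (simp add: jump_size_eq[of "Suc m"] power_one_over field_simps)
  then show ?thesis using jump_size_pos[of "Suc m"] by (simp add: field_simps)
qed

lemma jump_tail:
  "jump_size (i + (m + 2)) \<le> jump_size (Suc m) * (1 / 4) ^ m * (1 / 2) ^ Suc i"
proof -
  have "(Suc m)\<^sup>2 + 2 * m + Suc i \<le> (i + (m + 2))\<^sup>2" by (simp add: power2_eq_square algebra_simps)
  then have "(1 / 2 :: real) ^ (i + (m + 2))\<^sup>2 \<le> (1 / 2) ^ ((Suc m)\<^sup>2 + 2 * m + Suc i)"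
    by (intro power_decreasing) auto
  also have "\<dots> = (1 / 2) ^ ((Suc m)\<^sup>2) * ((1 / 2)\<^sup>2) ^ m * (1 / 2) ^ Suc i"
    by (simp only: power_add power_mult)
  finally show ?thesis by (simp add: jump_size_eq power2_eq_square)
qed

text \<open>\<open>1 - exp (- x)\<close> is at most \<open>x\<close>, so the tail is bounded by its
  total variance; \<open>jump_tail\<close> compares this with the series of halves, whose sum is
  1.\<close>

lemma laplace_exponent_split:
  assumes l: "0 \<le> l"
  shows "(\<Sum>j\<in>{..Suc m}. 1 - exp (- (l * jump_size j))) \<le> laplace_exponent 0 jump_measure l"
    and "laplace_exponent 0 jump_measure l \<le>
      (\<Sum>j\<in>{..Suc m}. 1 - exp (- (l * jump_size j))) + l * (jump_size (Suc m) * (1 / 4) ^ m)"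
proof -
  let ?f = "\<lambda>j. 1 - exp (- (l * jump_size j))"
  have nonneg: "0 \<le> ?f j" for j using l jump_size_pos[of j] by simp
  have sums: "?f sums laplace_exponent 0 jump_measure l" by (rule laplace_exponent_jump_measure[OF l])
  then have eq: "laplace_exponent 0 jump_measure l = (\<Sum>j. ?f (j + (m + 2))) + (\<Sum>j<m + 2. ?f j)"
    using suminf_split_initial_segment[OF sums_summable[OF sums], of "m + 2"] sums_unique[OF sums] by simp
  have idx: "{..<m + 2} = {..Suc m}" by auto
  have summ: "summable (\<lambda>j. ?f (j + (m + 2)))"
    using sums_summable[OF sums] by (subst summable_iff_shift)
  show "(\<Sum>j\<in>{..Suc m}. ?f j) \<le> laplace_exponent 0 jump_measure l"
    unfolding eq idx using suminf_nonneg[OF summ] nonneg by simp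
  let ?c = "l * (jump_size (Suc m) * (1 / 4) ^ m)"
  have geo: "(\<lambda>i. ?c * (1 / 2) ^ Suc i) sums (?c * 1)"
    by (intro sums_mult power_half_series)
  have "(\<Sum>j. ?f (j + (m + 2))) \<le> (\<Sum>i. ?c * (1 / 2) ^ Suc i)"
  proof (rule suminf_le[OF _ summ sums_summable[OF geo]])
    fix i
    have "?f (i + (m + 2)) \<le> l * jump_size (i + (m + 2))"
      using exp_ge_add_one_self[of "- (l * jump_size (i + (m + 2)))"] by linarith
    also have "\<dots> \<le> l * (jump_size (Suc m) * (1 / 4) ^ m * (1 / 2) ^ Suc i)"
      by (rule mult_left_mono[OF jump_tail l])
    finally show "?f (i + (m + 2)) \<le> ?c * (1 / 2) ^ Suc i" by (simp only: mult.assoc)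
  qed
  also have "\<dots> = ?c" using sums_unique[OF geo] by simp
  finally show "laplace_exponent 0 jump_measure l \<le> (\<Sum>j\<in>{..Suc m}. ?f j) + ?c"
    unfolding eq idx by linarith
qed

text \<open>The exponentials in \<open>K\<close> and \<kappa> are replaced by positive parameters
  because only the growth in \<open>m\<close> matters once \<open>K\<close> is fixed. The last
  condition makes the radius admissible.\<close>

lemma eventually_scale_separation:
  fixes K C D G P R \<rho> :: real
  assumes "0 < C" "0 < D" "0 < G" "0 < P" "0 < R" "0 < \<rho>"
  shows "eventually (\<lambda>m::nat. 32 \<le> real m + 2 \<and>
      3 / 2 * (real m + 2) * (1 / 2) ^ m + 5 * (1 / 2) ^ m \<le> 1 / (real m + 2) \<and>
      (1 / 2) ^ m * (real m + 2) / 2 + (real m + 2) * exp (- (D * (real m + 2) / 2)) +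
        (1 / 2) ^ m * G / (2 * (real m + 2)) \<le> sqrt (1 / (real m + 3)) * P / 2 \<and>
      (C + 1) * (exp (- (D * (real m + 2) / 2)) + 1 / (real m + 2)\<^sup>2) + 32 * C / (real m + 2)\<^sup>2
        < R * sqrt (1 / (real m + 3)) / (8 * (real m + 2)) \<and>
      2 * (1 / 2) ^ Suc m \<le> \<rho>) sequentially"
proof (intro eventually_conj)
  have "eventually (\<lambda>m::nat. (1 / 2) ^ m * (real m + 2) / 2 \<le> sqrt (1 / (real m + 3)) * P / 6) sequentially"
    using assms by real_asymp
  moreover have "eventually (\<lambda>m::nat. (real m + 2) * exp (- (D * (real m + 2) / 2)) \<le> sqrt (1 / (real m + 3)) * P / 6) sequentially"
    using assms by real_asymp
  moreover have "eventually (\<lambda>m::nat. (1 / 2) ^ m * G / (2 * (real m + 2)) \<le> sqrt (1 / (real m + 3)) * P / 6) sequentially"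
    using assms by real_asymp
  ultimately show "eventually (\<lambda>m::nat. (1 / 2) ^ m * (real m + 2) / 2 + (real m + 2) * exp (- (D * (real m + 2) / 2)) +
      (1 / 2) ^ m * G / (2 * (real m + 2)) \<le> sqrt (1 / (real m + 3)) * P / 2) sequentially"
    by eventually_elim linarith
qed (use assms in real_asymp)+

lemma obtain_target_position:
  fixes C \<kappa> e :: real
  assumes "0 < \<kappa>" "0 < e"
  obtains K where "4 \<le> K" "C * exp (- (K * \<kappa> / 2)) \<le> e"
proof -
  have "((\<lambda>K. C * exp (- (K * \<kappa> / 2))) \<longlongrightarrow> 0) at_top" using assms(1) by real_asymp
  from order_tendstoD(2)[OF this assms(2)] eventually_ge_at_top[of "4::real"]
  have *: "eventually (\<lambda>K. 4 \<le> K \<and> C * exp (- (K * \<kappa> / 2)) \<le> e) at_top"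
    by eventually_elim simp
  then show ?thesis using that eventually_happens[OF *] by auto
qed

context subordinated_bm begin

text \<open>\<open>f\<close> and \<open>H\<close> agree on a slab containing the rescaled ball.
  Compactness of the closure of \<open>E\<close> keeps the coordinate at a positive distance from
  the edge of the slab, as \<open>resolvent_generator_small\<close> requires.\<close>

lemma harmonic_coordinate:
  fixes H f :: "real \<Rightarrow> real"
  assumes l: "0 < l" and s: "0 < s"
    and H: "continuous_on UNIV H" "\<And>x. \<bar>H x\<bar> \<le> C" and f: "continuous_on UNIV f" "\<And>x. \<bar>f x\<bar> \<le> C"
    and H_eq: "\<And>x. H x = (LINT v|distr (resolvent_measure l k) borel (\<lambda>v. v / s). f (x + v))"
    and eq: "\<And>x. \<bar>x\<bar> < 1 \<Longrightarrow> f x = H x"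
  shows "harmonic_on M X (ball 0 s) (\<lambda>x. H (x $ k / s))"
proof (rule harmonic_onI)
  have fm [measurable]: "f \<in> borel_measurable borel" and Hm [measurable]: "H \<in> borel_measurable borel"
    using f(1) H(1) by (auto intro: borel_measurable_continuous_onI)
  show "continuous_on UNIV (\<lambda>x::real^'d. H (x $ k / s))"
    by (rule continuous_on_compose2[OF H(1)]) (auto intro!: continuous_intros simp: s less_imp_neq[symmetric])
  show "\<bar>H (z $ k / s)\<bar> \<le> C" for z :: "real ^ 'd" by (rule H(2))
  show "AE \<omega> in M. \<exists>t\<ge>0. x + X t \<omega> \<notin> E" if "bounded E" for E x by (rule exits_bounded[OF that])
  fix E :: "(real ^ 'd) set" and e :: real
  assume E: "open E" "compact (closure E)" "closure E \<subseteq> ball 0 s" and e: "0 < e"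
  obtain \<epsilon> where \<epsilon>: "0 < \<epsilon>" "\<And>z. z \<in> E \<Longrightarrow> norm z \<le> s - \<epsilon>"
  proof (cases "E = {}")
    case True
    then show ?thesis using that[of 1] by auto
  next
    case False
    have "continuous_on (closure E) (norm :: real ^ 'd \<Rightarrow> real)" by (intro continuous_intros)
    then obtain z0 where z0: "z0 \<in> closure E" "\<And>z. z \<in> closure E \<Longrightarrow> norm z \<le> norm z0"
      using continuous_attains_sup[OF E(2)] False by (metis closure_eq_empty)
    then have "norm z0 < s" using E(3) by auto
    then show ?thesis using that[of "s - norm z0"] z0(2) closure_subset by auto
  qed
  have res: "H (x / s) = (LINT v|resolvent_measure l k. f ((x + v) / s))" for x
    unfolding H_eq by (subst integral_distr) (auto simp: add_divide_distrib)
  have "\<exists>d>0. \<forall>t z. 0 < t \<and> t < d \<and> \<bar>z\<bar> \<le> s - \<epsilon> \<longrightarrow>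
      \<bar>semi k t (\<lambda>v. H (v / s)) z - H (z / s)\<bar> \<le> e * t"
  proof (rule resolvent_generator_small[OF l _ _ res _ _ _ \<epsilon>(1) e])
    show "f (v / s) = H (v / s)" if "\<bar>v\<bar> < s" for v
      by (rule eq) (use that s in \<open>simp add: abs_divide\<close>)
  qed (use f H in auto)
  then obtain d where d: "0 < d" "\<And>t z. 0 < t \<Longrightarrow> t < d \<Longrightarrow> \<bar>z\<bar> \<le> s - \<epsilon> \<Longrightarrow>
      \<bar>semi k t (\<lambda>v. H (v / s)) z - H (z / s)\<bar> \<le> e * t"
    by blast
  have "\<bar>(LINT \<omega>|M. H ((z + X t \<omega>) $ k / s)) - H (z $ k / s)\<bar> \<le> e * t"
    if "0 < t" "t < d" "z \<in> E" for t z
    using d(2)[of t "z $ k"] that \<epsilon>(2)[of z] component_le_norm_cart[of z k]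
    by (simp add: semi_def)
  then show "\<exists>d>0. \<forall>t z. 0 < t \<and> t < d \<and> z \<in> E \<longrightarrow>
      \<bar>(LINT \<omega>|M. H ((z + X t \<omega>) $ k / s)) - H (z $ k / s)\<bar> \<le> e * t"
    using d(1) by blast
qed

theorem not_small_EHI: "\<not> small_EHI M X"
proof
  assume "small_EHI M X"
  then obtain C1 C \<kappa> where C: "0 < C1" "0 < C" and \<kappa>: "0 < \<kappa>" "\<kappa> < 1"
    and EHI: "\<forall>x0 r. 0 < r \<and> r \<le> C1 \<longrightarrow>
      (\<forall>h. (\<forall>z. 0 \<le> h z) \<and> harmonic_on M X (ball x0 r) h \<longrightarrow>
        (\<forall>x\<in>ball x0 (\<kappa> * r). \<forall>y\<in>ball x0 (\<kappa> * r). h x \<le> C * h y))"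
    unfolding small_EHI_def by (elim exE conjE) (erule (4) that)
  obtain k :: 'd where True by simp
  obtain K where K: "4 \<le> K" "C * exp (- (K * \<kappa> / 2)) \<le> exp (- 1 / 2) / 8"
    using obtain_target_position[OF \<kappa>(1), of "exp (- 1 / 2) / 8" C] by auto
  have pos: "0 < (K - 2)\<^sup>2" "0 < 1 + (K - \<kappa> / 2)\<^sup>2" "0 < exp (- ((K + 2)\<^sup>2 / 2))"
    "0 < exp (- 1 / 2) * exp (- ((K - \<kappa> / 2)\<^sup>2 / 2))" "0 < C1\<^sup>2"
    using K C by (auto simp: add_pos_nonneg)
  note ev = eventually_happens'[OF sequentially_bot eventually_scale_separation[OF C(2) pos]]
  obtain m :: nat where m: "32 \<le> real m + 2"
      "3 / 2 * (real m + 2) * (1 / 2) ^ m + 5 * (1 / 2) ^ m \<le> 1 / (real m + 2)"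
      "(1 / 2) ^ m * (real m + 2) / 2 + (real m + 2) * exp (- ((K - 2)\<^sup>2 * (real m + 2) / 2)) +
        (1 / 2) ^ m * (1 + (K - \<kappa> / 2)\<^sup>2) / (2 * (real m + 2))
        \<le> sqrt (1 / (real m + 3)) * exp (- ((K + 2)\<^sup>2 / 2)) / 2"
      "(C + 1) * (exp (- ((K - 2)\<^sup>2 * (real m + 2) / 2)) + 1 / (real m + 2)\<^sup>2) + 32 * C / (real m + 2)\<^sup>2
        < exp (- 1 / 2) * exp (- ((K - \<kappa> / 2)\<^sup>2 / 2)) * sqrt (1 / (real m + 3)) / (8 * (real m + 2))"
      "2 * (1 / 2) ^ Suc m \<le> C1\<^sup>2"
    using ev by blast
  define s where "s = sqrt (jump_size (Suc m))"
  have s: "0 < s" "s\<^sup>2 = jump_size (Suc m)" using jump_size_pos[of "Suc m"] by (auto simp: s_def)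
  have s_le: "s \<le> C1"
    unfolding s_def by (rule real_le_lsqrt) (use C m(5) jump_size_le[of "Suc m"] in auto)
  \<comment> \<open>The smallest rate allowed by \<open>l_large\<close>, namely
    \<open>(\<Lambda> + 2) * \<Lambda>\<^sup>2\<close>.\<close>
  define l where "l = (real m + 4) * (real m + 2)\<^sup>2"
  have l: "0 < l" by (simp add: l_def)
  \<comment> \<open>Dividing lengths by \<open>s\<close> divides variances by
    \<open>jump_size (Suc m)\<close>, so jump \<open>Suc m\<close> becomes the one of variance
    1.\<close>
  define Q where "Q = distr (resolvent_measure l k) borel (\<lambda>v. v / s)"
  define a where "a j = jump_size j / jump_size (Suc m)" for j
  define \<Phi> where "\<Phi> \<theta> = laplace_exponent 0 jump_measure ((\<theta> / s)\<^sup>2 / 2)" for \<theta>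
  have lap: "(\<theta> / s)\<^sup>2 / 2 * jump_size j = a j * \<theta>\<^sup>2 / 2" for \<theta> j
    by (simp add: a_def power_divide s)
  interpret R: prob_space "resolvent_measure l k" by (rule prob_space_resolvent_measure[OF l])
  interpret sep: scale_separation Q l \<Phi> m a \<kappa> K C
  proof (intro scale_separation.intro jump_kernel.intro jump_kernel_axioms.intro scale_separation_axioms.intro)
    show "prob_space Q"
      unfolding Q_def by (rule R.prob_space_distr) simp
    show "sets Q = sets borel" by (simp add: Q_def)
    show "\<Phi> \<in> borel_measurable borel"
      unfolding \<Phi>_def[abs_def] by (rule measurable_compose[OF _ laplace_exponent_measurable]) simp
    show "0 \<le> \<Phi> \<theta>" for \<theta> unfolding \<Phi>_def by (rule laplace_exponent_jump_measure_nonneg) simp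
    show "(\<Sum>j\<in>{..Suc m}. 1 - exp (- (a j * \<theta>\<^sup>2 / 2))) \<le> \<Phi> \<theta>" for \<theta>
      using laplace_exponent_split(1)[of "(\<theta> / s)\<^sup>2 / 2" m] unfolding lap \<Phi>_def by simp
    show "\<Phi> \<theta> \<le> (\<Sum>j\<in>{..Suc m}. 1 - exp (- (a j * \<theta>\<^sup>2 / 2))) + (1 / 4) ^ m * \<theta>\<^sup>2 / 2" for \<theta>
    proof -
      have var: "(\<theta> / s)\<^sup>2 / 2 * (jump_size (Suc m) * (1 / 4) ^ m) = (1 / 4) ^ m * \<theta>\<^sup>2 / 2"
        unfolding mult.assoc[symmetric] lap using jump_size_pos[of "Suc m"] by (simp add: a_def)
      then show ?thesis
        using laplace_exponent_split(2)[of "(\<theta> / s)\<^sup>2 / 2" m] unfolding lap var \<Phi>_def by simp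
    qed
    show "(LINT v|Q. cos (\<theta> * (x + v))) = cos (\<theta> * x) * (l / (l + \<Phi> \<theta>))" for \<theta> x
    proof -
      have "(LINT v|Q. cos (\<theta> * (x + v))) = (LINT v|resolvent_measure l k. cos (\<theta> / s * (s * x + v)))"
        unfolding Q_def using s by (subst integral_distr) (auto simp: field_simps)
      also have "\<dots> = cos (\<theta> * x) * (l / (l + \<Phi> \<theta>))"
        unfolding cos_resolvent_measure[OF l] \<Phi>_def using s by simp
      finally show ?thesis .
    qed
    show "4 ^ m \<le> a j" if "j \<le> m" for j unfolding a_def by (rule jump_ratio_big[OF that])
    show "0 \<le> a j" for j using jump_size_pos by (simp add: a_def less_imp_le)
    show "a (Suc m) = 1" using jump_size_pos[of "Suc m"] by (simp add: a_def)
    show "(C + 1) * (exp (- ((K - 2)\<^sup>2 * (real m + 2) / 2)) + 1 / (real m + 2)\<^sup>2) + 32 * C / (real m + 2)\<^sup>2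
        < exp (- 1 / 2) * sqrt (1 / (real m + 3)) * exp (- ((K - \<kappa> / 2)\<^sup>2 / 2)) / (8 * (real m + 2))"
      using m(4) by (simp only: mult_ac)
  qed ((rule l \<kappa> C(2) K m(1-3) | simp add: l_def)+)
  show False
  proof (rule sep.harnack_ratio_large)
    fix H f
    assume H: "continuous_on UNIV H" "\<And>x. 0 \<le> H x" "\<And>x. H x \<le> 3"
      "continuous_on UNIV f" "\<And>x. \<bar>f x\<bar> \<le> 3"
      "\<And>x. H x = (LINT v|Q. f (x + v))" "\<And>x. \<bar>x\<bar> < 1 \<Longrightarrow> f x = H x"
      "C * H (- \<kappa> / 2) < H (\<kappa> / 2)"
    have harm: "harmonic_on M X (ball 0 s) (\<lambda>x. H (x $ k / s))"
    proof (rule harmonic_coordinate[OF l s(1) H(1) _ H(4,5)])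
      show "\<bar>H x\<bar> \<le> 3" for x using H(2,3)[of x] by simp
      show "H x = (LINT v|distr (resolvent_measure l k) borel (\<lambda>v. v / s). f (x + v))" for x
        using H(6)[of x] unfolding Q_def .
    qed (rule H(7))
    have in_ball: "axis k (\<kappa> / 2 * s) \<in> ball 0 (\<kappa> * s)" "axis k (- \<kappa> / 2 * s) \<in> ball 0 (\<kappa> * s)"
      using s(1) \<kappa> by (auto simp: norm_eq_sqrt_inner inner_axis_axis real_sqrt_divide)
    have "\<forall>x\<in>ball 0 (\<kappa> * s). \<forall>y\<in>ball 0 (\<kappa> * s). H (x $ k / s) \<le> C * H (y $ k / s)"
      by (rule EHI[THEN spec, THEN spec, THEN mp, OF conjI[OF s(1) s_le], THEN spec, THEN mp])
        (use H(2) harm in blast)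
    from this[THEN bspec, OF in_ball(1), THEN bspec, OF in_ball(2)]
    have "H (axis k (\<kappa> / 2 * s) $ k / s) \<le> C * H (axis k (- \<kappa> / 2 * s) $ k / s)" .
    then have "H (\<kappa> / 2) \<le> C * H (- \<kappa> / 2)" using s(1) by simp
    then show False using H(8) by simp
  qed
qed

end

theorem mainTheorem6:
  fixes M :: "'w measure"
    and S :: "real \<Rightarrow> 'w \<Rightarrow> real"
    and W :: "real \<Rightarrow> 'w \<Rightarrow> real ^ 'd"
  assumes "prob_space M"
    and "subordinator M 0 jump_measure S"
    and "standard_brownian_motion M W"
    and "independent_processes M W S"
  shows "\<not> small_EHI M (\<lambda>t \<omega>. W (S t \<omega>) \<omega>)"
proof -
  interpret subordinated_bm M S W "\<lambda>t \<omega>. W (S t \<omega>) \<omega>"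
    by (intro subordinated_bm.intro subordinated_bm_axioms.intro) (use assms in auto)
  show ?thesis by (rule not_small_EHI)
qed

end
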